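(* Let $f$ and $g$ be transcendental entire functions, let $n,m$ be integers with $\min\{n,m\}\ge 2$, and let $\alpha\not\equiv 0$ be a meromorphic function that is a small function with respect to both $f$ and $g$. Let $L(z,h)=\sum_{i=1}^{q} b_i(z)\,h^{(\nu_i)}(z)$ be a linear differential polynomial, where the $\nu_i$ are nonnegative integers and the coefficients $b_i$ are entire functions that are small functions of both $f$ and $g$, and suppose $L(z,f)\not\equiv 0$ and $L(z,g)\not\equiv 0$. Then $f^nL(z,g)$ and $g^mL(z,f)$ cannot have $\alpha$ as a common generalized Picard exceptional small function; that is, it is impossible that both $f(z)^nL(z,g)-\alpha(z)$ and $g(z)^mL(z,f)-\alpha(z)$ have only finitely many zeros.
   Context: $T(r,f)$ denotes the Nevanlinna characteristic of a meromorphic function $f$ on $\mathbb{C}$. A meromorphic function $a$ is a small function of (with respect to) $f$ if $T(r,a)=S(r,f)$, where $S(r,f)$ denotes any quantity with $S(r,f)=o(T(r,f))$ as $r\to\infty$ outside a possible exceptional set of finite linear measure. A meromorphic function $\alpha$ is a generalized Picard exceptional function of a meromorphic function $F$ if $F-\alpha$ has finitely many zeros. Here $f^n$, $g^m$ denote powers, and $h^{(\nu)}$ denotes the $\nu$-th derivative (with $h^{(0)}=h$). In this statement the smallness of $\alpha$ is with respect to $f$ and $g$. *)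

theory Defs
  imports "HOL-Complex_Analysis.Complex_Analysis" "HOL-Library.Landau_Symbols"
begin

text \<open>
  Meromorphic functions are those of \<^const>\<open>meromorphic_on\<close> with domain \<^term>\<open>UNIV\<close>. Such a
  function may take arbitrary values at its poles and at other isolated points. All notions below
  are insensitive to these values: poles and zeros are described by limits.
\<close>

subsection \<open>The Nevanlinna characteristic\<close>

text \<open>This is \<open>max {0, ln x}\<close>, with the value 0 at \<open>x = 0\<close>.\<close>
definition log_plus :: "real \<Rightarrow> real" where
  "log_plus x = ln (max 1 x)"

definition proximity_fun :: "(complex \<Rightarrow> complex) \<Rightarrow> real \<Rightarrow> real" where
  "proximity_fun f r = 1 / (2 * pi) *
     integral {0..2 * pi} (\<lambda>\<theta>. log_plus (norm (f (of_real r * cis \<theta>))))"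

text \<open>Poles are counted with multiplicity; the order of a pole is minus the \<^const>\<open>zorder\<close>.\<close>
definition pole_count :: "(complex \<Rightarrow> complex) \<Rightarrow> real \<Rightarrow> nat" where
  "pole_count f t = (\<Sum>z | norm z \<le> t \<and> is_pole f z. nat (- zorder f z))"

definition counting_fun :: "(complex \<Rightarrow> complex) \<Rightarrow> real \<Rightarrow> real" where
  "counting_fun f r =
     integral {0..r} (\<lambda>t. (real (pole_count f t) - real (pole_count f 0)) / t)
     + real (pole_count f 0) * ln r"

definition nevanlinna_char :: "(complex \<Rightarrow> complex) \<Rightarrow> real \<Rightarrow> real" where
  "nevanlinna_char f r = proximity_fun f r + counting_fun f r"

subsection \<open>Small functions and generalized Picard exceptional functions\<close>

text \<open>
  The quantity \<open>\<phi>\<close> is an \<open>S(r, f)\<close>: the filter expresses \<open>r \<rightarrow> \<infinity>\<close> with \<open>r\<close> outside the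
  exceptional set \<open>E\<close>, which is a Lebesgue measurable set of finite measure.
\<close>
definition is_S :: "(real \<Rightarrow> real) \<Rightarrow> (complex \<Rightarrow> complex) \<Rightarrow> bool" where
  "is_S \<phi> f \<longleftrightarrow>
     (\<exists>E \<in> lmeasurable. \<phi> \<in> o[inf at_top (principal (- E))](nevanlinna_char f))"

definition small_function :: "(complex \<Rightarrow> complex) \<Rightarrow> (complex \<Rightarrow> complex) \<Rightarrow> bool" where
  "small_function a f \<longleftrightarrow> a meromorphic_on UNIV \<and> is_S (nevanlinna_char a) f"

text \<open>
  A zero of the meromorphic function \<open>F - \<alpha>\<close> is a point where it tends to 0. This includes
  points where \<open>F\<close> and \<open>\<alpha>\<close> have poles that cancel, and it excludes poles of \<open>F - \<alpha>\<close>, whatever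
  value the function happens to have there. If \<open>F - \<alpha>\<close> vanishes identically, every point is a zero.
\<close>
definition gen_Picard_exceptional :: "(complex \<Rightarrow> complex) \<Rightarrow> (complex \<Rightarrow> complex) \<Rightarrow> bool" where
  "gen_Picard_exceptional \<alpha> F \<longleftrightarrow> finite {z. (\<lambda>w. F w - \<alpha> w) \<midarrow>z\<rightarrow> 0}"

subsection \<open>Transcendental entire functions and linear differential polynomials\<close>

definition transcendental_entire :: "(complex \<Rightarrow> complex) \<Rightarrow> bool" where
  "transcendental_entire f \<longleftrightarrow> f holomorphic_on UNIV \<and> (\<nexists>p :: complex poly. f = poly p)"

definition lin_diff_poly ::
  "nat \<Rightarrow> (nat \<Rightarrow> complex \<Rightarrow> complex) \<Rightarrow> (nat \<Rightarrow> nat) \<Rightarrow> complex \<Rightarrow> (complex \<Rightarrow> complex) \<Rightarrow> complex" where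
  "lin_diff_poly q b \<nu> z h = (\<Sum>i = 1..q. b i z * (deriv ^^ \<nu> i) h z)"

end

theory Submission
  imports Defs
begin

text \<open>
  Write \<open>\<mu>(u)\<close> for the proximity function of \<open>u\<close>, which is the characteristic if \<open>u\<close> is entire, and
  \<open>T = \<mu>(f) + \<mu>(g)\<close>. If \<open>f^n L(g) - \<alpha>\<close> and \<open>g^m L(f) - \<alpha>\<close> have finitely many zeros, then
  \<open>n \<mu>(f) \<le> \<mu>(g) + o(T)\<close> and \<open>m \<mu>(g) \<le> \<mu>(f) + o(T)\<close> along some sequence of radii. The sum of these
  inequalities is \<open>2 T \<le> T + o(T)\<close>, which is impossible.

  For the first inequality let \<open>F = f^n L(g)\<close>, let \<open>\<gamma>\<close> be the logarithmic derivative of \<open>F - \<alpha>\<close>, and put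
  \<open>A = F' - \<gamma> F = \<alpha>' - \<gamma> \<alpha>\<close>. Since \<open>F - \<alpha>\<close> has few zeros and poles, \<open>\<gamma>\<close> and \<open>A\<close> are small functions. But \<open>A\<close> is
  divisible by \<open>f^(n-1)\<close> up to poles of \<open>\<gamma>\<close>, so \<open>f\<close> has few zeros unless \<open>A = 0\<close>; and
  \<open>1 / F = (F'/F - \<gamma>) / A\<close> has a small proximity function. The formula of Jensen for \<open>F\<close> now gives
  \<open>\<mu>(F) \<le> N + o(T)\<close>, where \<open>N\<close> is the counting function of the zeros of \<open>L(g)\<close>, and division by \<open>L(g)\<close> gives
  \<open>n \<mu>(f) \<le> \<mu>(L(g)) + o(T)\<close>. If \<open>A = 0\<close>, then \<open>F\<close> is a multiple of \<open>\<alpha>\<close>, hence small. This is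
  \<open>proximity_power_le_of_few_zeros\<close>. Finally \<open>L(g) / g\<close> is a combination of products of logarithmic
  derivatives with small coefficients, so \<open>\<mu>(L(g)) \<le> \<mu>(g) + o(T)\<close>.

  The tools are the formula of Jensen (\<open>Jensen_formula\<close>) and the lemma on the logarithmic derivative
  (\<open>lemma_on_logarithmic_derivative\<close>). Meromorphic functions are written as quotients \<open>p / q\<close> of entire functions,
  and the counting function of the zeros of an entire function \<open>p\<close> is replaced by the mean of \<open>ln \<bar>p\<bar>\<close>, from which
  it differs by a constant.

  The lemma on the logarithmic derivative bounds a mean over a circle of radius \<open>r\<close> by the logarithm of
  characteristics at some \<open>R > r\<close>. The lemma \<open>comparable_radii\<close> supplies arbitrarily large pairs, avoiding the
  exceptional sets, at which a given function \<open>\<Phi>\<close> at most doubles from \<open>r\<close> to \<open>R\<close> and \<open>R - r\<close> is at least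
  \<open>1 / (8 \<Phi>(r))\<close>. With the sum of all relevant characteristics as \<open>\<Phi>\<close> the error terms become
  \<open>O(ln \<Phi>(r) + ln r)\<close>, and \<open>\<Phi>(r) = O(T)\<close> follows from the same estimates. Transcendence gives
  \<open>ln r = o(T)\<close>.
\<close>

section \<open>Means over circles\<close>

definition circle_mean :: "(complex \<Rightarrow> real) \<Rightarrow> real \<Rightarrow> real" where
  "circle_mean \<phi> r = 1 / (2 * pi) * integral {0..2 * pi} (\<lambda>\<theta>. \<phi> (of_real r * cis \<theta>))"

lemma continuous_on_circle_param:
  assumes "continuous_on (sphere 0 r) \<phi>" "0 \<le> r"
  shows "continuous_on S (\<lambda>\<theta>. \<phi> (of_real r * cis \<theta>))"
  by (rule continuous_on_compose2[OF assms(1)])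
     (use assms(2) in \<open>auto intro!: continuous_intros simp: norm_mult\<close>)

lemma circle_integrable:
  fixes \<phi> :: "complex \<Rightarrow> 'a::banach"
  assumes "continuous_on (sphere 0 r) \<phi>" "0 \<le> r"
  shows "(\<lambda>\<theta>. \<phi> (of_real r * cis \<theta>)) integrable_on {0..2 * pi}"
  by (intro integrable_continuous_real continuous_on_circle_param assms)

lemma circle_mean_const [simp]: "circle_mean (\<lambda>_. c) r = c"
  by (simp add: circle_mean_def)

lemma circle_mean_cmult: "circle_mean (\<lambda>z. c * \<phi> z) r = c * circle_mean \<phi> r"
  by (simp add: circle_mean_def)

lemma circle_mean_add:
  assumes "continuous_on (sphere 0 r) \<phi>" "continuous_on (sphere 0 r) \<psi>" "0 \<le> r"
  shows "circle_mean (\<lambda>z. \<phi> z + \<psi> z) r = circle_mean \<phi> r + circle_mean \<psi> r"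
  unfolding circle_mean_def
  by (subst integral_add) (auto intro!: circle_integrable assms simp: add_divide_distrib diff_divide_distrib)

lemma circle_mean_diff:
  assumes "continuous_on (sphere 0 r) \<phi>" "continuous_on (sphere 0 r) \<psi>" "0 \<le> r"
  shows "circle_mean (\<lambda>z. \<phi> z - \<psi> z) r = circle_mean \<phi> r - circle_mean \<psi> r"
  unfolding circle_mean_def
  by (subst integral_diff) (auto intro!: circle_integrable assms simp: add_divide_distrib diff_divide_distrib)

lemma circle_mean_sum:
  assumes "finite A" "\<And>a. a \<in> A \<Longrightarrow> continuous_on (sphere 0 r) (\<phi> a)" "0 \<le> r"
  shows "circle_mean (\<lambda>z. \<Sum>a\<in>A. \<phi> a z) r = (\<Sum>a\<in>A. circle_mean (\<phi> a) r)"
  using assms(1,2)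
proof (induction A rule: finite_induct)
  case (insert a A)
  have "circle_mean (\<lambda>z. \<phi> a z + (\<Sum>a\<in>A. \<phi> a z)) r =
        circle_mean (\<phi> a) r + circle_mean (\<lambda>z. \<Sum>a\<in>A. \<phi> a z) r"
    by (rule circle_mean_add) (use insert assms(3) in \<open>auto intro!: continuous_on_sum\<close>)
  with insert show ?case by simp
qed simp

lemma circle_mean_mono:
  assumes "continuous_on (sphere 0 r) \<phi>" "continuous_on (sphere 0 r) \<psi>" "0 \<le> r"
    and "\<And>z. norm z = r \<Longrightarrow> \<phi> z \<le> \<psi> z"
  shows "circle_mean \<phi> r \<le> circle_mean \<psi> r"
  unfolding circle_mean_def
  by (intro mult_left_mono integral_le circle_integrable assms)
     (use assms(3) in \<open>auto simp: norm_mult\<close>)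

lemma circle_mean_cong:
  assumes "\<And>z. norm z = r \<Longrightarrow> \<phi> z = \<psi> z" "0 \<le> r"
  shows "circle_mean \<phi> r = circle_mean \<psi> r"
proof -
  have "(\<lambda>\<theta>. \<phi> (of_real r * cis \<theta>)) = (\<lambda>\<theta>. \<psi> (of_real r * cis \<theta>))"
    by (rule ext, rule assms(1)) (use assms(2) in \<open>simp add: norm_mult\<close>)
  then show ?thesis by (simp add: circle_mean_def)
qed

lemma circle_mean_nonneg:
  assumes "continuous_on (sphere 0 r) \<phi>" "0 \<le> r" "\<And>z. norm z = r \<Longrightarrow> 0 \<le> \<phi> z"
  shows "0 \<le> circle_mean \<phi> r"
  using circle_mean_mono[of r "\<lambda>_. 0" \<phi>] assms by simp

text \<open>
  This is the concavity of the logarithm. It follows from the tangent line inequality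
  \<open>ln x \<le> ln M + (x - M) / M\<close> at the mean \<open>M\<close>.
\<close>
lemma circle_mean_ln_le:
  assumes "continuous_on (sphere 0 r) \<phi>" "0 \<le> r" "\<And>z. norm z = r \<Longrightarrow> 1 \<le> \<phi> z"
  shows "circle_mean (\<lambda>z. ln (\<phi> z)) r \<le> ln (circle_mean \<phi> r)"
proof -
  define M where "M = circle_mean \<phi> r"
  have "circle_mean (\<lambda>_. 1) r \<le> M"
    unfolding M_def using assms by (intro circle_mean_mono) auto
  then have M: "1 \<le> M" "M \<noteq> 0" by simp_all
  have pos: "\<phi> z \<noteq> 0" if "norm z = r" for z
    using assms(3)[OF that] by simp
  have tangent: "ln (\<phi> z) \<le> (ln M - 1) + (1 / M) * \<phi> z" if "norm z = r" for z
  proof -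
    have "ln (\<phi> z / M) \<le> \<phi> z / M - 1"
      using M assms(3)[OF that] by (intro ln_le_minus_one) auto
    then show ?thesis
      using M assms(3)[OF that] by (simp add: ln_div)
  qed
  have "circle_mean (\<lambda>z. ln (\<phi> z)) r \<le> circle_mean (\<lambda>z. (ln M - 1) + (1 / M) * \<phi> z) r"
    using assms tangent pos
    by (intro circle_mean_mono continuous_intros) auto
  also have "\<dots> = (ln M - 1) + circle_mean (\<lambda>z. (1 / M) * \<phi> z) r"
    using assms M by (subst circle_mean_add) (auto intro!: continuous_intros)
  also have "\<dots> = ln M"
    using M unfolding circle_mean_cmult M_def[symmetric] by simp
  finally show ?thesis by (simp add: M_def)
qed

lemma circle_mean_Re_holomorphic:
  assumes hol: "v holomorphic_on ball 0 R'" and R: "0 < R" "R < R'"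
  shows "circle_mean (\<lambda>z. Re (v z)) R = Re (v 0)"
proof -
  have "((\<lambda>u. v u / (u - 0)) has_contour_integral (2 * of_real pi * \<i> * v 0)) (circlepath 0 R)"
    using hol R by (intro Cauchy_integral_circlepath_simple)
                   (auto intro!: holomorphic_on_subset[OF hol])
  then have "((\<lambda>\<theta>. v (0 + of_real R * cis \<theta>) / (of_real R * cis \<theta>) * R * \<i> * cis \<theta>)
      has_integral (2 * of_real pi * \<i> * v 0)) {0..2 * pi}"
    by (simp add: circlepath_def has_contour_integral_part_circlepath_iff)
  also have "(\<lambda>\<theta>. v (0 + of_real R * cis \<theta>) / (of_real R * cis \<theta>) * R * \<i> * cis \<theta>) =
      (\<lambda>\<theta>. \<i> * v (of_real R * cis \<theta>))"
    using R by (auto simp: field_simps)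
  finally have "((\<lambda>\<theta>. - \<i> * (\<i> * v (of_real R * cis \<theta>))) has_integral
      (- \<i> * (2 * of_real pi * \<i> * v 0))) {0..2 * pi}"
    by (rule has_integral_mult_right)
  then have "((\<lambda>\<theta>. v (of_real R * cis \<theta>)) has_integral (2 * of_real pi * v 0)) {0..2 * pi}"
    by (simp add: mult.assoc[symmetric]) (simp add: algebra_simps)
  then have "((\<lambda>\<theta>. Re (v (of_real R * cis \<theta>))) has_integral Re (2 * of_real pi * v 0)) {0..2 * pi}"
    by (rule has_integral_Re)
  then show ?thesis
    unfolding circle_mean_def by (simp add: integral_unique)
qed

text \<open>
  On the circle of radius \<open>R\<close> the conjugate of \<open>v\<close> is a power series in \<open>1 / w\<close>, so Cauchy's formula
  for \<open>v'\<close> gives 0 for it. Adding this to the formula for \<open>v\<close> leaves only the real part of \<open>v\<close>.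
\<close>
lemma norm_deriv_le_circle_mean_Re:
  assumes hol: "v holomorphic_on ball 0 R'" and R: "0 < R" "R < R'" and z: "norm z \<le> r" "r < R"
  shows "norm (deriv v z) \<le> 2 * R / (R - r)\<^sup>2 * circle_mean (\<lambda>w. \<bar>Re (v w)\<bar>) R"
proof -
  have aux: "- \<i> * (a / b * c * \<i> * d) = a * (c * d / b)" for a b c d :: complex
    by (simp add: divide_inverse) (simp add: mult_ac)
  define W where "W = (\<lambda>\<theta>. of_real R * cis \<theta> :: complex)"
  have nW: "norm (W \<theta>) = R" for \<theta> using R by (simp add: W_def norm_mult)
  have W0: "W \<theta> \<noteq> 0" for \<theta> using nW[of \<theta>] R by auto
  have Wz: "W \<theta> \<noteq> z" for \<theta> using nW[of \<theta>] R z by auto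
  have contv: "continuous_on (cball 0 R) v"
    by (rule continuous_on_subset[OF holomorphic_on_imp_continuous_on[OF hol]]) (use R in auto)
  have holb: "v holomorphic_on ball 0 R"
    by (rule holomorphic_on_subset[OF hol]) (use R in auto)
  have zin: "z \<in> ball 0 R" using z by auto
  note C = Cauchy_derivative_integral_circlepath[OF contv holb zin]
  define I where "I = contour_integral (circlepath 0 R) (\<lambda>u. v u / (u - z)\<^sup>2)"
  have d: "deriv v z = 1 / (2 * of_real pi * \<i>) * I"
    using C(2) by (simp add: I_def DERIV_imp_deriv)
  have "((\<lambda>u. v u / (u - z)\<^sup>2) has_contour_integral I) (circlepath 0 R)"
    using C(1) by (simp add: I_def has_contour_integral_integral)
  then have i1: "((\<lambda>\<theta>. v (W \<theta>) / (W \<theta> - z)\<^sup>2 * R * \<i> * cis \<theta>) has_integral I) {0..2 * pi}"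
    by (simp add: circlepath_def has_contour_integral_part_circlepath_iff W_def)
  have e1: "(\<lambda>\<theta>. - \<i> * (v (W \<theta>) / (W \<theta> - z)\<^sup>2 * R * \<i> * cis \<theta>)) =
     (\<lambda>\<theta>. v (W \<theta>) * (W \<theta> / (W \<theta> - z)\<^sup>2))"
    by (rule ext) (simp only: aux, simp only: W_def mult.assoc)
  have A: "((\<lambda>\<theta>. v (W \<theta>) * (W \<theta> / (W \<theta> - z)\<^sup>2)) has_integral - \<i> * I) {0..2 * pi}"
    using has_integral_mult_right[OF i1, of "- \<i>"] unfolding e1 .
  define N where "N = (\<lambda>w. of_real R ^ 2 - cnj z * w)"
  have N0: "N w \<noteq> 0" if "norm w \<le> R" for w
  proof
    assume "N w = 0"
    then have "cnj z * w = of_real (R\<^sup>2)"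
      by (simp add: N_def)
    then have "norm (cnj z * w) = R\<^sup>2"
      by (simp only: norm_of_real) simp
    moreover have "norm z * norm w \<le> norm z * R" using that by (intro mult_left_mono) auto
    moreover have "norm z * R < R * R" using z R by simp
    ultimately show False by (simp add: norm_mult power2_eq_square)
  qed
  have "((\<lambda>w. v w * (of_real R)^2 / (N w)\<^sup>2) has_contour_integral 0) (circlepath 0 R)"
  proof (rule Cauchy_theorem_convex[of "cball 0 R" _ "{}"])
    show "continuous_on (cball 0 R) (\<lambda>w. v w * (of_real R)^2 / (N w)\<^sup>2)"
      using N0 by (intro continuous_intros contv) (auto simp: N_def intro!: continuous_intros)
    show "(\<lambda>w. v w * (of_real R)^2 / (N w)\<^sup>2) field_differentiable at x"
      if "x \<in> interior (cball 0 R) - {}" for x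
    proof -
      have x: "x \<in> ball 0 R" using that by simp
      have "(\<lambda>w. v w * (of_real R)^2 / (N w)\<^sup>2) holomorphic_on ball 0 R"
        using N0 by (intro holomorphic_intros holb) (auto simp: N_def intro!: holomorphic_intros)
      then show ?thesis using x by (simp add: holomorphic_on_open field_differentiable_def)
    qed
  qed (use R in auto)
  then have i2: "((\<lambda>\<theta>. v (W \<theta>) * (of_real R)^2 / (N (W \<theta>))\<^sup>2 * R * \<i> * cis \<theta>) has_integral 0) {0..2 * pi}"
    by (simp add: circlepath_def has_contour_integral_part_circlepath_iff W_def)
  have e2: "(\<lambda>\<theta>. - \<i> * (v (W \<theta>) * (of_real R)^2 / (N (W \<theta>))\<^sup>2 * R * \<i> * cis \<theta>)) =
     (\<lambda>\<theta>. v (W \<theta>) * ((of_real R)^2 * W \<theta> / (N (W \<theta>))\<^sup>2))"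
    by (rule ext) (simp only: aux, simp add: W_def)
  have i3: "((\<lambda>\<theta>. cnj (v (W \<theta>) * ((of_real R)^2 * W \<theta> / (N (W \<theta>))\<^sup>2))) has_integral cnj (- \<i> * 0)) {0..2 * pi}"
    using has_integral_mult_right[OF i2, of "- \<i>", unfolded e2]
    by (rule has_integral_cnj[THEN iffD2, unfolded o_def])
  have e3: "(\<lambda>\<theta>. cnj (v (W \<theta>) * ((of_real R)^2 * W \<theta> / (N (W \<theta>))\<^sup>2))) =
      (\<lambda>\<theta>. cnj (v (W \<theta>)) * (W \<theta> / (W \<theta> - z)\<^sup>2))"
  proof
    fix \<theta>
    have RR: "(of_real R)^2 = W \<theta> * cnj (W \<theta>)"
      using nW[of \<theta>] by (simp add: complex_norm_square[symmetric])
    have "cnj (N (W \<theta>)) = W \<theta> * cnj (W \<theta>) - z * cnj (W \<theta>)"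
      unfolding N_def using RR by simp
    then have "cnj (N (W \<theta>)) = cnj (W \<theta>) * (W \<theta> - z)" by (simp add: algebra_simps)
    moreover have "cnj ((of_real R)^2) = W \<theta> * cnj (W \<theta>)" using RR by simp
    ultimately have "cnj ((of_real R)^2 * W \<theta> / (N (W \<theta>))\<^sup>2) =
        W \<theta> * cnj (W \<theta>) * cnj (W \<theta>) / (cnj (W \<theta>) * (W \<theta> - z))\<^sup>2"
      by simp
    also have "\<dots> = W \<theta> / (W \<theta> - z)\<^sup>2"
      using W0[of \<theta>] Wz[of \<theta>] by (simp add: power2_eq_square)
    finally show "cnj (v (W \<theta>) * ((of_real R)^2 * W \<theta> / (N (W \<theta>))\<^sup>2)) =
        cnj (v (W \<theta>)) * (W \<theta> / (W \<theta> - z)\<^sup>2)"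
      by (simp only: complex_cnj_mult[of "v (W \<theta>)"])
  qed
  have B: "((\<lambda>\<theta>. cnj (v (W \<theta>)) * (W \<theta> / (W \<theta> - z)\<^sup>2)) has_integral 0) {0..2 * pi}"
    using i3 unfolding e3 by simp
  have "((\<lambda>\<theta>. of_real (2 * Re (v (W \<theta>))) * (W \<theta> / (W \<theta> - z)\<^sup>2)) has_integral - \<i> * I) {0..2 * pi}"
    using has_integral_add[OF A B] by (simp only: distrib_right[symmetric] complex_add_cnj) simp
  then have I: "integral {0..2 * pi} (\<lambda>\<theta>. of_real (2 * Re (v (W \<theta>))) * (W \<theta> / (W \<theta> - z)\<^sup>2)) = - \<i> * I"
    and ii: "(\<lambda>\<theta>. of_real (2 * Re (v (W \<theta>))) * (W \<theta> / (W \<theta> - z)\<^sup>2)) integrable_on {0..2 * pi}"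
    by auto
  have cR: "continuous_on (sphere 0 R) (\<lambda>w. \<bar>Re (v w)\<bar>)"
    by (intro continuous_intros continuous_on_subset[OF contv]) auto
  have "norm (- \<i> * I) \<le> integral {0..2 * pi} (\<lambda>\<theta>. 2 * R / (R - r)\<^sup>2 * \<bar>Re (v (W \<theta>))\<bar>)"
    unfolding I[symmetric]
  proof (rule integral_norm_bound_integral[OF ii])
    show "(\<lambda>\<theta>. 2 * R / (R - r)\<^sup>2 * \<bar>Re (v (W \<theta>))\<bar>) integrable_on {0..2 * pi}"
      unfolding W_def using circle_integrable[OF cR] R by (intro integrable_on_mult_right) auto
    fix \<theta>
    have "R - r \<le> norm (W \<theta> - z)"
      using norm_triangle_ineq2[of "W \<theta>" z] nW[of \<theta>] z by auto
    then have "(R - r)\<^sup>2 \<le> (norm (W \<theta> - z))\<^sup>2" "0 < (R - r)\<^sup>2"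
      using z by (auto intro!: power_mono)
    then have "norm (W \<theta> / (W \<theta> - z)\<^sup>2) \<le> R / (R - r)\<^sup>2"
      using R by (simp add: norm_divide norm_power nW frac_le)
    then have "2 * \<bar>Re (v (W \<theta>))\<bar> * norm (W \<theta> / (W \<theta> - z)\<^sup>2) \<le> 2 * \<bar>Re (v (W \<theta>))\<bar> * (R / (R - r)\<^sup>2)"
      by (intro mult_left_mono) auto
    then show "norm (of_real (2 * Re (v (W \<theta>))) * (W \<theta> / (W \<theta> - z)\<^sup>2)) \<le>
        2 * R / (R - r)\<^sup>2 * \<bar>Re (v (W \<theta>))\<bar>"
      unfolding norm_mult norm_of_real abs_mult by (simp add: mult_ac)
  qed
  also have "\<dots> = 2 * R / (R - r)\<^sup>2 * (2 * pi * circle_mean (\<lambda>w. \<bar>Re (v w)\<bar>) R)"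
    by (simp add: circle_mean_def W_def)
  finally have "norm I \<le> 2 * pi * (2 * R / (R - r)\<^sup>2 * circle_mean (\<lambda>w. \<bar>Re (v w)\<bar>) R)"
    by (simp add: norm_mult mult.commute mult.left_commute)
  then show ?thesis
    unfolding d by (simp add: norm_mult norm_divide field_simps)
qed

section \<open>Factorization in a disc and the formula of Jensen\<close>

definition nonzero_entire :: "(complex \<Rightarrow> complex) \<Rightarrow> bool" where
  "nonzero_entire p \<longleftrightarrow> p holomorphic_on UNIV \<and> (\<exists>z. p z \<noteq> 0)"

definition zero_mult :: "(complex \<Rightarrow> complex) \<Rightarrow> complex \<Rightarrow> nat" where
  "zero_mult p a = nat (zorder p a)"

definition zeros_in_disc :: "(complex \<Rightarrow> complex) \<Rightarrow> real \<Rightarrow> complex set" where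
  "zeros_in_disc p R = {z. norm z < R \<and> p z = 0}"

definition blaschke :: "real \<Rightarrow> complex \<Rightarrow> complex \<Rightarrow> complex" where
  "blaschke R a z = of_real R * (z - a) / (of_real (R\<^sup>2) - cnj a * z)"

lemma nonzero_entireD:
  assumes "nonzero_entire p"
  shows "p holomorphic_on UNIV" "p holomorphic_on S" "continuous_on S p"
  using assms unfolding nonzero_entire_def
  by (auto intro: holomorphic_on_subset continuous_on_subset[OF holomorphic_on_imp_continuous_on])

lemma finite_zeros_in_cball:
  assumes "nonzero_entire p"
  shows "finite {z. norm z \<le> R \<and> p z = 0}"
proof (cases "p constant_on UNIV")
  case True
  then show ?thesis
    using assms by (auto simp: nonzero_entire_def constant_on_def)
next
  case False
  have "finite {z \<in> cball 0 R. p z = 0}"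
    by (rule holomorphic_compact_finite_zeros[of p UNIV])
       (use assms False in \<open>auto simp: nonzero_entire_def\<close>)
  then show ?thesis by simp
qed

lemma finite_zeros_in_disc:
  assumes "nonzero_entire p"
  shows "finite (zeros_in_disc p R)"
  by (rule finite_subset[OF _ finite_zeros_in_cball[OF assms, of R]]) (auto simp: zeros_in_disc_def)

lemma countable_zeros:
  assumes "nonzero_entire p"
  shows "countable {z. p z = 0}"
proof -
  have "{z. p z = 0} = (\<Union>n::nat. {z. norm z \<le> real n \<and> p z = 0})"
    using real_arch_simple by auto
  moreover have "countable \<dots>"
    by (rule countable_UN) (auto intro: countable_finite finite_zeros_in_cball[OF assms])
  ultimately show ?thesis by simp
qed

lemma nonzero_entire_mult:
  assumes "nonzero_entire p" "nonzero_entire q"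
  shows "nonzero_entire (\<lambda>z. p z * q z)"
proof -
  have "countable ({z. p z = 0} \<union> {z. q z = 0})"
    using countable_zeros assms by blast
  then have "{z. p z = 0} \<union> {z. q z = 0} \<noteq> UNIV"
    using uncountable_UNIV_complex by metis
  then show ?thesis
    using assms by (auto simp: nonzero_entire_def intro!: holomorphic_intros)
qed

lemma nonzero_entire_power: "nonzero_entire u \<Longrightarrow> nonzero_entire (\<lambda>z. u z ^ n)"
  by (auto simp: nonzero_entire_def intro!: holomorphic_intros)

lemma zero_mult_factor:
  assumes "nonzero_entire p"
  obtains r where "r > 0" "zor_poly p a holomorphic_on cball a r"
    "\<And>w. w \<in> cball a r \<Longrightarrow> p w = zor_poly p a w * (w - a) ^ zero_mult p a"
    "\<And>w. w \<in> cball a r \<Longrightarrow> zor_poly p a w \<noteq> 0"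
    "zorder p a = int (zero_mult p a)" "zero_mult p a > 0 \<longleftrightarrow> p a = 0"
proof -
  have "(if p a = 0 then zorder p a > 0 else zorder p a = 0) \<and>
     (\<exists>r>0. cball a r \<subseteq> UNIV \<and> zor_poly p a holomorphic_on cball a r \<and>
       (\<forall>w\<in>cball a r. p w = zor_poly p a w * (w - a) ^ nat (zorder p a) \<and> zor_poly p a w \<noteq> 0))"
    using assms unfolding nonzero_entire_def by (intro zorder_exist_zero) auto
  then obtain r where "r > 0" "zor_poly p a holomorphic_on cball a r"
    "\<forall>w\<in>cball a r. p w = zor_poly p a w * (w - a) ^ zero_mult p a \<and> zor_poly p a w \<noteq> 0"
    and "if p a = 0 then zorder p a > 0 else zorder p a = 0"
    unfolding zero_mult_def by blast
  then show thesis
    by (intro that[of r]) (auto simp: zero_mult_def split: if_splits)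
qed

lemma norm_blaschke_on_circle:
  assumes "norm a < R" "norm z = R"
  shows "norm (blaschke R a z) = 1"
proof -
  have "of_real (R\<^sup>2) = z * cnj z"
    using assms(2) by (simp add: complex_norm_square[symmetric])
  then have "of_real (R\<^sup>2) - cnj a * z = z * cnj (z - a)"
    by (simp add: algebra_simps)
  then have "norm (of_real (R\<^sup>2) - cnj a * z) = R * norm (z - a)"
    using assms(2) by (simp add: norm_mult del: complex_cnj_diff)
  moreover have "z \<noteq> a" "R > 0"
    using assms norm_ge_zero[of a] by (auto simp del: norm_ge_zero)
  ultimately show ?thesis
    unfolding blaschke_def norm_divide norm_mult by simp
qed

text \<open>
  Dividing by the Blaschke product of the zeros leaves a function without zeros in a slightly
  larger disc. It has a holomorphic logarithm there, whose real part on the circle is \<open>ln \<bar>p\<bar>\<close>.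
\<close>
lemma blaschke_decomposition:
  assumes p: "nonzero_entire p" and R: "0 < R" and nz: "\<And>z. norm z = R \<Longrightarrow> p z \<noteq> 0"
  obtains R' v where "R < R'" "v holomorphic_on ball 0 R'"
    "\<And>a z. a \<in> zeros_in_disc p R \<Longrightarrow> z \<in> ball 0 R' \<Longrightarrow> of_real (R\<^sup>2) - cnj a * z \<noteq> 0"
    "\<And>z. z \<in> ball 0 R' \<Longrightarrow>
       p z = (\<Prod>a\<in>zeros_in_disc p R. blaschke R a z ^ zero_mult p a) * exp (v z)"
proof -
  define Z where "Z = zeros_in_disc p R"
  have finZ: "finite Z" unfolding Z_def by (rule finite_zeros_in_disc[OF p])
  have ZR: "norm a < R" if "a \<in> Z" for a using that by (simp add: Z_def zeros_in_disc_def)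
  define Y where "Y = {z. norm z \<le> 2 * R \<and> p z = 0} - Z"
  have finY: "finite Y" unfolding Y_def using finite_zeros_in_cball[OF p] by blast
  have YR: "R < norm a" if "a \<in> Y" for a
    using that nz[of a] by (force simp: Y_def Z_def zeros_in_disc_def)
  have "eventually (\<lambda>x. x < 2 * R) (at_right R)"
    using R by (intro eventually_at_rightI[of R "2 * R"]) auto
  moreover have "eventually (\<lambda>x. \<forall>a\<in>Y. x < norm a) (at_right R)"
    using YR by (intro eventually_ball_finite[OF finY] ballI) (auto intro!: eventually_at_rightI)
  moreover have "eventually (\<lambda>x. \<forall>a\<in>Z. norm a * x < R\<^sup>2) (at_right R)"
  proof (intro eventually_ball_finite[OF finZ] ballI)
    fix a assume "a \<in> Z"
    have "((\<lambda>x. norm a * x) \<longlongrightarrow> norm a * R) (at_right R)" by (intro tendsto_intros)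
    moreover have "norm a * R < R\<^sup>2" using ZR[OF \<open>a \<in> Z\<close>] R by (simp add: power2_eq_square)
    ultimately show "eventually (\<lambda>x. norm a * x < R\<^sup>2) (at_right R)"
      by (rule order_tendstoD(2))
  qed
  moreover have "eventually (\<lambda>x. R < x) (at_right R)" by (rule eventually_at_right_less)
  ultimately have "eventually (\<lambda>x. x < 2 * R \<and> (\<forall>a\<in>Y. x < norm a) \<and>
      (\<forall>a\<in>Z. norm a * x < R\<^sup>2) \<and> R < x) (at_right R)"
    by eventually_elim auto
  then obtain R' where R': "R < R'" "R' < 2 * R" "\<forall>a\<in>Y. R' < norm a" "\<forall>a\<in>Z. norm a * R' < R\<^sup>2"
    using eventually_happens'[OF trivial_limit_at_right_real] by blast
  define D where "D = ball (0::complex) R'"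
  have den: "of_real (R\<^sup>2) - cnj a * z \<noteq> 0" if "a \<in> Z" "z \<in> D" for a z
  proof
    assume "of_real (R\<^sup>2) - cnj a * z = 0"
    then have "norm (cnj a * z) = R\<^sup>2"
      by (metis eq_iff_diff_eq_0 norm_of_real abs_power2)
    moreover have "norm a * norm z \<le> norm a * R'" using that by (intro mult_left_mono) (auto simp: D_def)
    ultimately show False using R'(4) that by (auto simp: norm_mult)
  qed
  have zeroD: "p z = 0 \<longleftrightarrow> z \<in> Z" if "z \<in> D" for z
    using that R' by (force simp: D_def Y_def Z_def zeros_in_disc_def)
  define B where "B = (\<lambda>z. \<Prod>a\<in>Z. blaschke R a z ^ zero_mult p a)"
  have holb: "blaschke R a holomorphic_on D" if "a \<in> Z" for a
    unfolding blaschke_def using den[OF that] by (intro holomorphic_intros) auto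
  have holB: "B holomorphic_on D"
    unfolding B_def using holb by (intro holomorphic_intros) auto
  have b0: "blaschke R a z = 0 \<longleftrightarrow> z = a" if "a \<in> Z" "z \<in> D" for a z
    using den[OF that] R by (simp add: blaschke_def)
  have mpos: "zero_mult p a > 0 \<longleftrightarrow> p a = 0" and zint: "zorder p a = int (zero_mult p a)" for a
    by (rule zero_mult_factor[OF p, of a]; simp)+
  have B0: "B z = 0 \<longleftrightarrow> z \<in> Z" if "z \<in> D" for z
    using that finZ b0 mpos zeroD[OF that] by (auto simp: B_def)
  have zo: "zorder B z = zorder p z" if z: "z \<in> D" for z
  proof (cases "z \<in> Z")
    case False
    then have "zorder B z = 0"
      using B0[OF z] z holB unfolding D_def
      by (intro zorder_eq_0I) (auto simp: analytic_at intro!: exI[of _ "ball 0 R'"])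
    moreover have "zorder p z = 0"
      using zeroD[OF z] False mpos[of z] zint[of z] by simp
    ultimately show ?thesis by simp
  next
    case True
    define G where "G = (\<lambda>w. (of_real R / (of_real (R\<^sup>2) - cnj z * w)) ^ zero_mult p z *
        (\<Prod>a\<in>Z - {z}. blaschke R a w ^ zero_mult p a))"
    have "zorder B z = int (zero_mult p z)"
    proof (rule zorder_eqI[of D z G])
      show "G holomorphic_on D"
        unfolding G_def using den True holb by (intro holomorphic_intros) auto
      show "G z \<noteq> 0"
        using den[OF True z] R b0[OF _ z] finZ by (auto simp: G_def)
      fix w assume w: "w \<in> D" "w \<noteq> z"
      have "B w = blaschke R z w ^ zero_mult p z * (\<Prod>a\<in>Z - {z}. blaschke R a w ^ zero_mult p a)"
        unfolding B_def using finZ True by (simp add: prod.remove)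
      then show "B w = G w * (w - z) powi int (zero_mult p z)"
        by (simp add: G_def blaschke_def power_divide power_mult_distrib)
    qed (use z in \<open>auto simp: D_def\<close>)
    with zint show ?thesis by simp
  qed
  obtain h where h: "h holomorphic_on D" "\<And>z. z \<in> D \<Longrightarrow> h z \<noteq> 0" "\<And>z. z \<in> D \<Longrightarrow> p z = h z * B z"
    by (rule holomorphic_zorder_factorization[of p D B])
       (use nonzero_entireD[OF p] holB B0 zeroD zo in \<open>auto simp: D_def\<close>)
  obtain v where v: "v holomorphic_on D" "\<And>z. z \<in> D \<Longrightarrow> h z = exp (v z)"
    using contractible_imp_holomorphic_log[OF h(1) _ h(2)] convex_imp_contractible[of D]
    by (auto simp: D_def)
  show thesis
  proof (rule that[of R' v])
    show "p z = (\<Prod>a\<in>zeros_in_disc p R. blaschke R a z ^ zero_mult p a) * exp (v z)"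
      if "z \<in> ball 0 R'" for z
      using h(3)[of z] v(2)[of z] that by (simp add: D_def B_def Z_def mult.commute)
  qed (use R' v den in \<open>auto simp: D_def Z_def\<close>)
qed

text \<open>
  By the formula of Jensen below, this is the counting function of the zeros of an entire function \<open>p\<close>
  up to an additive constant. In contrast to the counting function it is additive on products by definition.
\<close>
definition log_mean :: "(complex \<Rightarrow> complex) \<Rightarrow> real \<Rightarrow> real" where
  "log_mean p r = circle_mean (\<lambda>z. ln (norm (p z))) r"

lemma ln_norm_eq_Re_on_circle:
  assumes "\<And>z. z \<in> ball 0 R' \<Longrightarrow>
       p z = (\<Prod>a\<in>zeros_in_disc p R. blaschke R a z ^ zero_mult p a) * exp (v z)"
    and "norm z = R" "R < R'"
  shows "ln (norm (p z)) = Re (v z)"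
proof -
  have "norm (\<Prod>a\<in>zeros_in_disc p R. blaschke R a z ^ zero_mult p a) = 1"
    unfolding prod_norm[symmetric] norm_power
    by (rule prod.neutral) (auto simp: zeros_in_disc_def norm_blaschke_on_circle assms(2))
  then have "norm (p z) = exp (Re (v z))"
    using assms by (simp add: norm_mult)
  then show ?thesis by simp
qed

text \<open>
  The left side is the value at 0 of the harmonic function \<open>Re v\<close> of the decomposition above, by the mean
  value property, and \<open>\<bar>blaschke R a 0\<bar> = \<bar>a\<bar> / R\<close>. Since \<open>p\<close> may vanish at 0, the leading coefficient of
  its expansion takes the place of \<open>p 0\<close>.
\<close>
theorem Jensen_formula:
  assumes p: "nonzero_entire p" and R: "0 < R" and nz: "\<And>z. norm z = R \<Longrightarrow> p z \<noteq> 0"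
  shows "log_mean p R = ln (norm (zor_poly p 0 0)) + real (zero_mult p 0) * ln R +
     (\<Sum>a\<in>zeros_in_disc p R - {0}. real (zero_mult p a) * ln (R / norm a))"
proof -
  obtain R' v where R': "R < R'" and v: "v holomorphic_on ball 0 R'"
    and den: "\<And>a z. a \<in> zeros_in_disc p R \<Longrightarrow> z \<in> ball 0 R' \<Longrightarrow> of_real (R\<^sup>2) - cnj a * z \<noteq> 0"
    and pv: "\<And>z. z \<in> ball 0 R' \<Longrightarrow>
       p z = (\<Prod>a\<in>zeros_in_disc p R. blaschke R a z ^ zero_mult p a) * exp (v z)"
    using blaschke_decomposition[OF p R nz] by blast
  define Z where "Z = zeros_in_disc p R"
  define k where "k = zero_mult p 0"
  define g where "g = zor_poly p 0"
  have finZ: "finite Z" unfolding Z_def by (rule finite_zeros_in_disc[OF p])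
  obtain r where r: "r > 0" "g holomorphic_on cball 0 r"
    "\<And>w. w \<in> cball 0 r \<Longrightarrow> p w = g w * (w - 0) ^ k"
    "\<And>w. w \<in> cball 0 r \<Longrightarrow> g w \<noteq> 0" and k0: "k > 0 \<longleftrightarrow> p 0 = 0"
    using zero_mult_factor[OF p, of 0] unfolding k_def g_def by metis
  have "log_mean p R = circle_mean (\<lambda>z. Re (v z)) R"
    unfolding log_mean_def
    by (rule circle_mean_cong) (use ln_norm_eq_Re_on_circle[OF pv _ R'] R in auto)
  also have "\<dots> = Re (v 0)"
    by (rule circle_mean_Re_holomorphic[OF v R R'])
  finally have J: "log_mean p R = Re (v 0)" .
  \<comment> \<open>Both sides of the next identity are continuous at 0, where the leading coefficient is read off.\<close>
  define P where "P = (\<lambda>w. \<Prod>a\<in>Z - {0}. blaschke R a w ^ zero_mult p a)"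
  have geq: "g w = P w * exp (v w) / of_real R ^ k" if w: "w \<noteq> 0" "norm w < r" "norm w < R'" for w
  proof -
    have "(\<Prod>a\<in>Z. blaschke R a w ^ zero_mult p a) = blaschke R 0 w ^ k * P w"
    proof (cases "0 \<in> Z")
      case True
      then show ?thesis using finZ by (simp add: prod.remove P_def k_def)
    next
      case False
      then have "k = 0" using k0 R by (simp add: Z_def zeros_in_disc_def)
      then show ?thesis using False by (simp add: P_def)
    qed
    moreover have "blaschke R 0 w = w / of_real R" using R by (simp add: blaschke_def power2_eq_square)
    moreover have "p w = g w * w ^ k" using r(3)[of w] w by simp
    moreover have "p w = (\<Prod>a\<in>Z. blaschke R a w ^ zero_mult p a) * exp (v w)"
      using pv[of w] w by (simp add: Z_def)
    ultimately have "g w * w ^ k = (w / of_real R) ^ k * P w * exp (v w)" by simp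
    then show ?thesis using w R by (simp add: power_divide field_simps)
  qed
  have contP: "isCont P 0"
    unfolding P_def blaschke_def
    using den[of _ 0] R R' by (intro continuous_intros) (auto simp: Z_def)
  have "isCont v 0"
    using v R R' by (intro continuous_on_interior[OF holomorphic_on_imp_continuous_on[OF v]]) auto
  then have lim1: "(\<lambda>w. P w * exp (v w) / of_real R ^ k) \<midarrow>0\<rightarrow> P 0 * exp (v 0) / of_real R ^ k"
    using contP R unfolding isCont_def by (intro tendsto_intros) auto
  have "isCont g 0"
    using r by (intro continuous_on_interior[OF holomorphic_on_imp_continuous_on[OF r(2)]]) auto
  then have lim2: "g \<midarrow>0\<rightarrow> g 0" by (simp add: isCont_def)
  have "eventually (\<lambda>w. g w = P w * exp (v w) / of_real R ^ k) (at 0)"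
    unfolding eventually_at using r(1) R R'
    by (intro exI[of _ "min r R'"]) (auto simp: geq)
  then have "(\<lambda>w. P w * exp (v w) / of_real R ^ k) \<midarrow>0\<rightarrow> g 0"
    by (rule Lim_transform_eventually[OF lim2])
  with lim1 have g0: "g 0 = P 0 * exp (v 0) / of_real R ^ k"
    by (rule LIM_unique[symmetric])
  have nb: "norm (blaschke R a 0) = norm a / R" if "a \<in> Z" for a
    using R by (simp add: blaschke_def norm_divide norm_mult power2_eq_square)
  have "norm (P 0) = (\<Prod>a\<in>Z - {0}. (norm a / R) ^ zero_mult p a)"
    unfolding P_def prod_norm[symmetric] norm_power by (intro prod.cong) (auto simp: nb)
  also have "ln \<dots> = (\<Sum>a\<in>Z - {0}. ln ((norm a / R) ^ zero_mult p a))"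
    using R finZ by (subst ln_prod) auto
  also have "\<dots> = (\<Sum>a\<in>Z - {0}. real (zero_mult p a) * ln (norm a / R))"
    using R by (intro sum.cong) (auto simp: ln_realpow)
  also have "\<dots> = - (\<Sum>a\<in>Z - {0}. real (zero_mult p a) * ln (R / norm a))"
    using R unfolding sum_negf[symmetric] by (intro sum.cong) (auto simp: ln_div algebra_simps)
  finally have lP: "ln (norm (P 0)) = - (\<Sum>a\<in>Z - {0}. real (zero_mult p a) * ln (R / norm a))" .
  have "P 0 \<noteq> 0" using g0 r(4)[of 0] r(1) by auto
  then have "ln (norm (g 0)) = ln (norm (P 0)) + Re (v 0) - real k * ln R"
    unfolding g0 using R by (simp add: norm_mult norm_divide norm_power ln_mult ln_div ln_realpow)
  then show ?thesis
    unfolding J lP by (simp add: Z_def k_def g_def)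
qed

section \<open>Rules for the proximity function\<close>

lemma proximity_eq: "proximity_fun u r = circle_mean (\<lambda>z. log_plus (norm (u z))) r"
  by (simp add: proximity_fun_def circle_mean_def)

lemma log_plus_nonneg: "0 \<le> log_plus x"
  by (simp add: log_plus_def)

lemma ln_le_log_plus: "0 < x \<Longrightarrow> ln x \<le> log_plus x"
  by (simp add: log_plus_def)

lemma log_plus_mono: "x \<le> y \<Longrightarrow> log_plus x \<le> log_plus y"
  by (simp add: log_plus_def)

lemma log_plus_mult_le:
  assumes "0 \<le> x" "0 \<le> y"
  shows "log_plus (x * y) \<le> log_plus x + log_plus y"
proof -
  have "max 1 (x * y) \<le> max 1 x * max 1 y"
    using assms mult_mono[of 1 "max 1 x" 1 "max 1 y"] mult_mono[of x "max 1 x" y "max 1 y"] by auto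
  then have "log_plus (x * y) \<le> ln (max 1 x * max 1 y)"
    unfolding log_plus_def by simp
  also have "\<dots> = log_plus x + log_plus y"
    unfolding log_plus_def by (rule ln_mult_pos) auto
  finally show ?thesis .
qed

lemma log_plus_add_le:
  assumes "0 \<le> x" "0 \<le> y"
  shows "log_plus (x + y) \<le> log_plus x + log_plus y + ln 2"
proof -
  have "max 1 (x + y) \<le> 2 * max 1 x * max 1 y"
  proof -
    have "max 1 x \<le> max 1 x * max 1 y" "max 1 y \<le> max 1 x * max 1 y"
      by (simp_all add: mult_le_cancel_left1 mult_le_cancel_right1)
    moreover have "1 \<le> max 1 x" "x \<le> max 1 x" "y \<le> max 1 y" by simp_all
    ultimately show ?thesis unfolding mult.assoc by (intro max.boundedI) linarith+
  qed
  then have "log_plus (x + y) \<le> ln (2 * max 1 x * max 1 y)"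
    unfolding log_plus_def by simp
  also have "\<dots> = log_plus x + log_plus y + ln 2"
    unfolding log_plus_def by (simp add: ln_mult_pos)
  finally show ?thesis .
qed

lemma log_plus_power: "0 \<le> x \<Longrightarrow> log_plus (x ^ n) = real n * log_plus x"
proof -
  assume x: "0 \<le> x"
  have "max 1 (x ^ n) = (max 1 x) ^ n"
    using x one_le_power[of x n] power_le_one[of x n] by (auto simp: max_def)
  then show ?thesis by (simp add: log_plus_def ln_realpow)
qed

lemma log_plus_diff_inverse: "0 < x \<Longrightarrow> log_plus x - log_plus (1 / x) = ln x"
  by (auto simp: log_plus_def max_def ln_div)

lemma log_plus_add_inverse: "0 < x \<Longrightarrow> log_plus x + log_plus (1 / x) = \<bar>ln x\<bar>"
  by (auto simp: log_plus_def max_def ln_div)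

lemma cont_log_plus_norm:
  fixes u :: "complex \<Rightarrow> complex"
  assumes "continuous_on S u"
  shows "continuous_on S (\<lambda>z. log_plus (norm (u z)))"
proof -
  have "max 1 (norm (u z)) \<noteq> 0" for z by (auto simp: max_def)
  then show ?thesis unfolding log_plus_def by (intro continuous_intros assms) auto
qed

lemma proximity_nonneg:
  assumes "continuous_on (sphere 0 r) u" "0 \<le> r"
  shows "0 \<le> proximity_fun u r"
  unfolding proximity_eq
  by (intro circle_mean_nonneg cont_log_plus_norm assms) (auto simp: log_plus_nonneg)

lemma proximity_cong:
  assumes "\<And>z. norm z = r \<Longrightarrow> norm (u z) = norm (v z)" "0 \<le> r"
  shows "proximity_fun u r = proximity_fun v r"
  unfolding proximity_eq by (intro circle_mean_cong) (use assms in auto)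

lemma proximity_const [simp]: "proximity_fun (\<lambda>_. c) r = log_plus (norm c)"
  by (simp add: proximity_eq)

lemma proximity_mult_le:
  assumes "continuous_on (sphere 0 r) u" "continuous_on (sphere 0 r) v" "0 \<le> r"
  shows "proximity_fun (\<lambda>z. u z * v z) r \<le> proximity_fun u r + proximity_fun v r"
proof -
  have "proximity_fun (\<lambda>z. u z * v z) r \<le>
      circle_mean (\<lambda>z. log_plus (norm (u z)) + log_plus (norm (v z))) r"
    unfolding proximity_eq using assms
    by (intro circle_mean_mono continuous_on_add cont_log_plus_norm continuous_intros)
       (auto simp: norm_mult intro: log_plus_mult_le)
  also have "\<dots> = proximity_fun u r + proximity_fun v r"
    unfolding proximity_eq using assms by (intro circle_mean_add cont_log_plus_norm)
  finally show ?thesis .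
qed

lemma proximity_add_le:
  assumes "continuous_on (sphere 0 r) u" "continuous_on (sphere 0 r) v" "0 \<le> r"
  shows "proximity_fun (\<lambda>z. u z + v z) r \<le> proximity_fun u r + proximity_fun v r + ln 2"
proof -
  have "proximity_fun (\<lambda>z. u z + v z) r \<le>
      circle_mean (\<lambda>z. (log_plus (norm (u z)) + log_plus (norm (v z))) + ln 2) r"
    unfolding proximity_eq using assms
    by (intro circle_mean_mono continuous_on_add continuous_on_const cont_log_plus_norm)
       (auto intro: order.trans[OF log_plus_mono[OF norm_triangle_ineq] log_plus_add_le])
  also have "\<dots> = proximity_fun u r + proximity_fun v r + ln 2"
    unfolding proximity_eq using assms
    by (subst circle_mean_add circle_mean_const |
        intro continuous_on_add continuous_on_const cont_log_plus_norm | assumption | simp)+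
  finally show ?thesis .
qed

lemma proximity_uminus [simp]: "proximity_fun (\<lambda>z. - u z) r = proximity_fun u r"
  by (simp add: proximity_eq)

lemma proximity_diff_le:
  assumes "continuous_on (sphere 0 r) u" "continuous_on (sphere 0 r) v" "0 \<le> r"
  shows "proximity_fun (\<lambda>z. u z - v z) r \<le> proximity_fun u r + proximity_fun v r + ln 2"
  using proximity_add_le[of r u "\<lambda>z. - v z"] assms by (simp add: continuous_on_minus)

lemma proximity_power:
  "proximity_fun (\<lambda>z. u z ^ n) r = real n * proximity_fun u r"
  by (simp add: proximity_eq norm_power log_plus_power circle_mean_cmult)

lemma proximity_sum_le:
  assumes "finite I" "\<And>i. i \<in> I \<Longrightarrow> continuous_on (sphere 0 r) (u i)" "0 \<le> r"
  shows "proximity_fun (\<lambda>z. \<Sum>i\<in>I. u i z) r \<le> (\<Sum>i\<in>I. proximity_fun (u i) r + ln 2)"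
  using assms(1,2)
proof (induction I rule: finite_induct)
  case empty
  then show ?case by (simp add: log_plus_def)
next
  case (insert i I)
  have "proximity_fun (\<lambda>z. u i z + (\<Sum>i\<in>I. u i z)) r \<le>
      proximity_fun (u i) r + proximity_fun (\<lambda>z. \<Sum>i\<in>I. u i z) r + ln 2"
    using insert assms(3) by (intro proximity_add_le continuous_on_sum) auto
  with insert show ?case by fastforce
qed

lemma proximity_diff_inverse:
  assumes "continuous_on (sphere 0 r) u" "\<And>z. norm z = r \<Longrightarrow> u z \<noteq> 0" "0 \<le> r"
  shows "proximity_fun u r - proximity_fun (\<lambda>z. 1 / u z) r = log_mean u r"
proof -
  have "continuous_on (sphere 0 r) (\<lambda>z. 1 / u z)"
    using assms by (intro continuous_intros) auto
  then have "proximity_fun u r - proximity_fun (\<lambda>z. 1 / u z) r =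
      circle_mean (\<lambda>z. log_plus (norm (u z)) - log_plus (norm (1 / u z))) r"
    unfolding proximity_eq using assms(1,3)
    by (intro circle_mean_diff[symmetric] cont_log_plus_norm)
  also have "\<dots> = log_mean u r"
    unfolding log_mean_def
    by (rule circle_mean_cong) (use assms log_plus_diff_inverse in \<open>auto simp: norm_divide\<close>)
  finally show ?thesis .
qed

lemma proximity_add_inverse:
  assumes "continuous_on (sphere 0 r) u" "\<And>z. norm z = r \<Longrightarrow> u z \<noteq> 0" "0 \<le> r"
  shows "circle_mean (\<lambda>z. \<bar>ln (norm (u z))\<bar>) r = proximity_fun u r + proximity_fun (\<lambda>z. 1 / u z) r"
proof -
  have "continuous_on (sphere 0 r) (\<lambda>z. 1 / u z)"
    using assms by (intro continuous_intros) auto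
  then have "proximity_fun u r + proximity_fun (\<lambda>z. 1 / u z) r =
      circle_mean (\<lambda>z. log_plus (norm (u z)) + log_plus (norm (1 / u z))) r"
    unfolding proximity_eq using assms(1,3)
    by (intro circle_mean_add[symmetric] cont_log_plus_norm)
  also have "\<dots> = circle_mean (\<lambda>z. \<bar>ln (norm (u z))\<bar>) r"
    by (rule circle_mean_cong) (use assms log_plus_add_inverse in \<open>auto simp: norm_divide\<close>)
  finally show ?thesis by simp
qed

lemma continuous_on_ln_norm:
  fixes u :: "complex \<Rightarrow> complex"
  assumes "continuous_on (sphere 0 r) u" "\<And>z. norm z = r \<Longrightarrow> u z \<noteq> 0"
  shows "continuous_on (sphere 0 r) (\<lambda>z. ln (norm (u z)))"
  using assms by (intro continuous_intros) auto

lemma log_mean_mult: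
  assumes "continuous_on (sphere 0 r) u" "\<And>z. norm z = r \<Longrightarrow> u z \<noteq> 0"
    "continuous_on (sphere 0 r) v" "\<And>z. norm z = r \<Longrightarrow> v z \<noteq> 0" "0 \<le> r"
  shows "log_mean (\<lambda>z. u z * v z) r = log_mean u r + log_mean v r"
proof -
  have "log_mean (\<lambda>z. u z * v z) r = circle_mean (\<lambda>z. ln (norm (u z)) + ln (norm (v z))) r"
    unfolding log_mean_def
    by (rule circle_mean_cong) (use assms in \<open>auto simp: norm_mult ln_mult\<close>)
  also have "\<dots> = log_mean u r + log_mean v r"
    unfolding log_mean_def using assms by (intro circle_mean_add continuous_on_ln_norm)
  finally show ?thesis .
qed

lemma log_mean_divide:
  assumes "continuous_on (sphere 0 r) u" "\<And>z. norm z = r \<Longrightarrow> u z \<noteq> 0"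
    "continuous_on (sphere 0 r) v" "\<And>z. norm z = r \<Longrightarrow> v z \<noteq> 0" "0 \<le> r"
  shows "log_mean (\<lambda>z. u z / v z) r = log_mean u r - log_mean v r"
proof -
  have "log_mean (\<lambda>z. u z / v z) r = circle_mean (\<lambda>z. ln (norm (u z)) - ln (norm (v z))) r"
    unfolding log_mean_def
    by (rule circle_mean_cong) (use assms in \<open>auto simp: norm_divide ln_div\<close>)
  also have "\<dots> = log_mean u r - log_mean v r"
    unfolding log_mean_def using assms by (intro circle_mean_diff continuous_on_ln_norm)
  finally show ?thesis .
qed

lemma log_mean_power:
  assumes "\<And>z. norm z = r \<Longrightarrow> u z \<noteq> 0" "0 \<le> r"
  shows "log_mean (\<lambda>z. u z ^ n) r = real n * log_mean u r"
proof -
  have "log_mean (\<lambda>z. u z ^ n) r = circle_mean (\<lambda>z. real n * ln (norm (u z))) r"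
    unfolding log_mean_def
    by (rule circle_mean_cong) (use assms in \<open>auto simp: norm_power ln_realpow\<close>)
  then show ?thesis by (simp add: circle_mean_cmult log_mean_def)
qed

lemma log_mean_le_proximity:
  assumes "continuous_on (sphere 0 r) u" "\<And>z. norm z = r \<Longrightarrow> u z \<noteq> 0" "0 \<le> r"
  shows "log_mean u r \<le> proximity_fun u r"
  unfolding log_mean_def proximity_eq using assms
  by (intro circle_mean_mono continuous_on_ln_norm cont_log_plus_norm)
     (auto intro: ln_le_log_plus)

section \<open>The lemma on the logarithmic derivative\<close>

lemma has_integral_inverse_sqrt_abs:
  fixes a b c :: real
  assumes "a \<le> b"
  shows "((\<lambda>x. 1 / sqrt \<bar>x - c\<bar>) has_integral
     (2 * sgn (b - c) * sqrt \<bar>b - c\<bar> - 2 * sgn (a - c) * sqrt \<bar>a - c\<bar>)) {a..b}"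
proof (rule fundamental_theorem_of_calculus_interior_strong[of "{c}"])
  show "continuous_on {a..b} (\<lambda>x. 2 * sgn (x - c) * sqrt \<bar>x - c\<bar>)"
  proof -
    have "isCont (\<lambda>x. 2 * sgn (x - c) * sqrt \<bar>x - c\<bar>) x" for x
    proof (cases "x = c")
      case False
      then show ?thesis by (auto intro!: continuous_intros)
    next
      case True
      have "((\<lambda>x. 2 * sgn (x - c) * sqrt \<bar>x - c\<bar>) \<longlongrightarrow> 0) (at c)"
      proof (rule Lim_null_comparison)
        show "\<forall>\<^sub>F x in at c. norm (2 * sgn (x - c) * sqrt \<bar>x - c\<bar>) \<le> 2 * sqrt \<bar>x - c\<bar>"
          by (intro always_eventually allI) (auto simp: abs_mult sgn_if)
        show "((\<lambda>x. 2 * sqrt \<bar>x - c\<bar>) \<longlongrightarrow> 0) (at c)"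
          by (auto intro!: tendsto_eq_intros)
      qed
      then show ?thesis using True by (simp add: isCont_def)
    qed
    then show ?thesis by (simp add: continuous_at_imp_continuous_on)
  qed
  fix x assume x: "x \<in> {a<..<b} - {c}"
  show "((\<lambda>x. 2 * sgn (x - c) * sqrt \<bar>x - c\<bar>) has_vector_derivative 1 / sqrt \<bar>x - c\<bar>) (at x)"
  proof (cases "x < c")
    case True
    have "((\<lambda>x. - 2 * sqrt (c - x)) has_real_derivative 1 / sqrt (c - x)) (at x)"
      using True by (auto intro!: derivative_eq_intros simp: field_simps)
    then have "((\<lambda>x. - 2 * sqrt (c - x)) has_vector_derivative 1 / sqrt \<bar>x - c\<bar>) (at x)"
      using True by (simp add: has_real_derivative_iff_has_vector_derivative)
    then show ?thesis
      by (rule has_vector_derivative_transform_within_open[of _ _ _ "{..<c}"])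
         (use True in \<open>auto simp: sgn_if\<close>)
  next
    case False
    have "((\<lambda>x. 2 * sqrt (x - c)) has_real_derivative 1 / sqrt (x - c)) (at x)"
      using False x by (auto intro!: derivative_eq_intros simp: field_simps)
    then have "((\<lambda>x. 2 * sqrt (x - c)) has_vector_derivative 1 / sqrt \<bar>x - c\<bar>) (at x)"
      using False by (simp add: has_real_derivative_iff_has_vector_derivative)
    then show ?thesis
      by (rule has_vector_derivative_transform_within_open[of _ _ _ "{c<..}"])
         (use False x in \<open>auto simp: sgn_if\<close>)
  qed
qed (use assms in auto)

text \<open>
  The sine is compared with the distance to its nearest zero. The bound on \<open>k\<close> leaves finitely many
  singularities when the inverse square root is integrated over a period.
\<close>
lemma abs_sin_ge_near_multiple_of_pi:
  fixes x :: real
  assumes "\<bar>x\<bar> \<le> 2 * pi"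
  obtains k :: int where "k \<in> {-2..2}" "\<bar>sin x\<bar> \<ge> \<bar>x - of_int k * pi\<bar> / 4"
proof -
  define k :: int where "k = round (x / pi)"
  define y where "y = x - of_int k * pi"
  have "\<bar>of_int (round (x / pi)) - x / pi\<bar> \<le> 1 / 2" by (rule of_int_round_abs_le)
  then have "\<bar>(x - of_int k * pi) / pi\<bar> \<le> 1 / 2"
    by (simp add: k_def diff_divide_distrib abs_minus_commute)
  then have y: "\<bar>y\<bar> \<le> pi / 2" by (simp add: y_def abs_divide field_simps)
  have "\<bar>x / pi\<bar> \<le> 2" using assms by (simp add: field_simps)
  then have "- 2 \<le> x / pi" "x / pi \<le> 2" by (simp_all only: abs_le_iff) linarith+
  then have k: "k \<in> {-2..2}"
    unfolding k_def by (auto simp: round_def le_floor_iff floor_le_iff)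
  have s: "\<bar>sin x\<bar> = \<bar>sin y\<bar>"
  proof -
    have "sin x = sin (y + of_int k * pi)" by (simp add: y_def)
    also have "\<dots> = sin y * cos (of_int k * pi)"
      by (simp add: sin_add) (metis sin_zero_iff_int2)
    finally have "\<bar>sin x\<bar> = \<bar>sin y\<bar> * \<bar>cos (of_int k * pi)\<bar>" by (simp add: abs_mult)
    moreover have "sin (of_int k * pi) = 0" by (metis sin_zero_iff_int2)
    then have "\<bar>cos (of_int k * pi)\<bar> = 1" using sin_cos_squared_add[of "of_int k * pi"] by (auto simp: power2_eq_1_iff)
    ultimately show ?thesis by simp
  qed
  have nonneg: "t / 4 \<le> sin t" if "0 \<le> t" "t \<le> pi / 2" for t :: real
  proof (cases "t \<le> 1")
    case True
    have "\<bar>sin t - t\<bar> \<le> \<bar>t\<bar> ^ 3 / 6" using Maclaurin_sin_bound[of t 3]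
      by (simp add: sin_coeff_def eval_nat_numeral lessThan_Suc fact_numeral)
    moreover have "t ^ 3 \<le> t * 1" using True that by (simp add: power3_eq_cube mult_le_one mult.assoc mult_left_le)
    ultimately show ?thesis using that abs_ge_minus_self[of "sin t - t"] by simp
  next
    case False
    have "sin 1 \<le> sin t" using False that by (intro sin_monotone_2pi_le) auto
    moreover have "\<bar>sin 1 - 1\<bar> \<le> (1::real) / 6" using Maclaurin_sin_bound[of 1 3]
      by (simp add: sin_coeff_def eval_nat_numeral lessThan_Suc fact_numeral)
    moreover have "pi < 10 / 3" using pi_approx by simp
    ultimately show ?thesis using that by (auto simp: abs_le_iff)
  qed
  have "\<bar>y\<bar> / 4 \<le> \<bar>sin y\<bar>"
    using nonneg[of y] nonneg[of "-y"] y by (cases "y \<ge> 0") auto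
  with k s that show thesis by (auto simp: y_def)
qed

text \<open>
  In polar form \<open>a = \<rho> cis \<phi>\<close> the distance of \<open>a\<close> to the point of angle \<open>\<theta>\<close> is at least
  \<open>r \<bar>sin (\<theta> - \<phi>)\<bar>\<close>, and the inverse square root of this is integrable, uniformly in \<open>\<phi>\<close>.
\<close>
lemma circle_mean_inverse_sqrt_dist_le:
  assumes "1 \<le> r" "norm a \<noteq> r"
  shows "circle_mean (\<lambda>z. 1 / sqrt (norm (z - a))) r \<le> 100"
proof -
  obtain \<rho> \<phi> where a: "a = of_real \<rho> * cis \<phi>" and \<phi>: "0 \<le> \<phi>" "\<phi> < 2 * pi"
  proof -
    show thesis
      using that[of "norm a" "Arg2pi a"] Arg2pi[of a] by (simp add: cis_conv_exp is_Arg_def)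
  qed
  define c where "c = (\<lambda>k::int. \<phi> + of_int k * pi)"
  define M where "M = (\<lambda>\<theta>. \<Sum>k\<in>{-2..2}. 2 * (1 / sqrt \<bar>\<theta> - c k\<bar>))"
  define I where "I = (\<Sum>k\<in>{-2..2}. 2 * (2 * sgn (2 * pi - c k) * sqrt \<bar>2 * pi - c k\<bar> - 2 * sgn (0 - c k) * sqrt \<bar>0 - c k\<bar>))"
  have M: "(M has_integral I) {0..2 * pi}"
    unfolding M_def I_def
    by (intro has_integral_sum has_integral_mult_right has_integral_inverse_sqrt_abs) auto
  have cont: "continuous_on (sphere 0 r) (\<lambda>z. 1 / sqrt (norm (z - a)))"
    using assms by (intro continuous_intros) auto
  have bound: "1 / sqrt (norm (of_real r * cis \<theta> - a)) \<le> M \<theta>"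
    if \<theta>: "\<theta> \<in> {0..2 * pi} - c ` {-2..2}" for \<theta>
  proof -
    have "\<bar>\<theta> - \<phi>\<bar> \<le> 2 * pi" using \<theta> \<phi> by auto
    then obtain k :: int where k: "k \<in> {-2..2}" "\<bar>\<theta> - \<phi> - of_int k * pi\<bar> / 4 \<le> \<bar>sin (\<theta> - \<phi>)\<bar>"
      by (rule abs_sin_ge_near_multiple_of_pi)
    have "of_real r * cis \<theta> - a = cis \<phi> * (of_real r * cis (\<theta> - \<phi>) - of_real \<rho>)"
      by (simp add: a algebra_simps cis_mult)
    then have "norm (of_real r * cis \<theta> - a) = norm (of_real r * cis (\<theta> - \<phi>) - of_real \<rho>)"
      by (simp add: norm_mult)
    also have "\<dots> \<ge> \<bar>Im (of_real r * cis (\<theta> - \<phi>) - of_real \<rho>)\<bar>"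
      by (rule abs_Im_le_cmod)
    finally have "norm (of_real r * cis \<theta> - a) \<ge> r * \<bar>sin (\<theta> - \<phi>)\<bar>"
      using assms by (simp add: abs_mult)
    moreover have "r * \<bar>sin (\<theta> - \<phi>)\<bar> \<ge> 1 * \<bar>sin (\<theta> - \<phi>)\<bar>"
      using assms by (intro mult_right_mono) auto
    moreover have pos: "\<bar>\<theta> - c k\<bar> > 0" using \<theta> k(1) by auto
    ultimately have le: "\<bar>\<theta> - c k\<bar> / 4 \<le> norm (of_real r * cis \<theta> - a)"
      using k(2) by (simp add: c_def algebra_simps)
    have "1 / sqrt (norm (of_real r * cis \<theta> - a)) \<le> 1 / sqrt (\<bar>\<theta> - c k\<bar> / 4)"
      using pos le by (intro divide_left_mono mult_pos_pos) auto
    also have "\<dots> = 2 * (1 / sqrt \<bar>\<theta> - c k\<bar>)"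
      using pos by (simp add: real_sqrt_divide)
    also have "\<dots> \<le> M \<theta>"
      unfolding M_def using k(1) by (intro member_le_sum) auto
    finally show ?thesis .
  qed
  define M' where "M' = (\<lambda>\<theta>. if \<theta> \<in> c ` {-2..2} then 1 / sqrt (norm (of_real r * cis \<theta> - a)) else M \<theta>)"
  have hM': "(M' has_integral I) {0..2 * pi}"
    by (rule has_integral_spike_finite[OF _ _ M, of "c ` {-2..2}"]) (auto simp: M'_def)
  have "((\<lambda>\<theta>. 1 / sqrt (norm (of_real r * cis \<theta> - a))) has_integral
      integral {0..2 * pi} (\<lambda>\<theta>. 1 / sqrt (norm (of_real r * cis \<theta> - a)))) {0..2 * pi}"
    using circle_integrable[OF cont] assms by (intro integrable_integral) auto
  from has_integral_le[OF this hM']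
  have "integral {0..2 * pi} (\<lambda>\<theta>. 1 / sqrt (norm (of_real r * cis \<theta> - a))) \<le> I"
    by (auto simp: M'_def bound)
  also have "I \<le> (\<Sum>k\<in>{-2..2::int}. 2 * (2 * 4 + 2 * 4))"
    unfolding I_def
  proof (intro sum_mono mult_left_mono)
    fix k :: int assume k: "k \<in> {-2..2}"
    have "\<bar>k\<bar> \<le> 2" using k by auto
    then have "\<bar>of_int k * pi\<bar> \<le> 2 * pi"
      by (simp add: abs_mult)
    then have "of_int k * pi \<le> 2 * pi" "- (2 * pi) \<le> of_int k * pi"
      unfolding abs_le_iff by linarith+
    then have c: "\<bar>2 * pi - c k\<bar> \<le> 16" "\<bar>0 - c k\<bar> \<le> 16"
      using \<phi> pi_less_4 unfolding c_def abs_le_iff by linarith+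
    have *: "sgn y * sqrt \<bar>y\<bar> \<le> 4" "- (sgn y * sqrt \<bar>y\<bar>) \<le> 4" if "\<bar>y\<bar> \<le> 16" for y :: real
    proof -
      have "sqrt \<bar>y\<bar> \<le> sqrt (4\<^sup>2)" using that by (intro real_sqrt_le_mono) simp
      then have "\<bar>sgn y * sqrt \<bar>y\<bar>\<bar> \<le> 4" by (cases y "0::real" rule: linorder_cases) (simp_all add: abs_mult)
      then show "sgn y * sqrt \<bar>y\<bar> \<le> 4" "- (sgn y * sqrt \<bar>y\<bar>) \<le> 4"
        by (simp_all only: abs_le_iff)
    qed
    show "2 * sgn (2 * pi - c k) * sqrt \<bar>2 * pi - c k\<bar> - 2 * sgn (0 - c k) * sqrt \<bar>0 - c k\<bar> \<le> 2 * 4 + 2 * 4"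
      using *(1)[OF c(1)] *(2)[OF c(2)] by linarith
  qed auto
  also have "\<dots> = 160" by simp
  finally have "integral {0..2 * pi} (\<lambda>\<theta>. 1 / sqrt (norm (of_real r * cis \<theta> - a))) \<le> 160" .
  then have "circle_mean (\<lambda>z. 1 / sqrt (norm (z - a))) r \<le> 1 / (2 * pi) * 160"
    unfolding circle_mean_def by (intro mult_left_mono) auto
  also have "\<dots> \<le> 100" using pi_gt3 by (simp add: field_simps)
  finally show ?thesis .
qed

lemma blaschke_log_derivative:
  assumes "z \<noteq> a" and den: "of_real (R\<^sup>2) - cnj a * z \<noteq> 0"
  shows "(blaschke R a has_field_derivative
     (of_real (R\<^sup>2 - (norm a)\<^sup>2) / ((z - a) * (of_real (R\<^sup>2) - cnj a * z))) * blaschke R a z) (at z)"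
proof -
  have aa: "of_real ((norm a)\<^sup>2) = a * cnj a" by (rule complex_norm_square)
  have "(blaschke R a has_field_derivative
     (of_real R * (of_real (R\<^sup>2) - cnj a * z) + of_real R * (z - a) * cnj a) /
        (of_real (R\<^sup>2) - cnj a * z)\<^sup>2) (at z)"
    unfolding blaschke_def using den
    by (auto intro!: derivative_eq_intros simp: power2_eq_square)
  also have "(of_real R * (of_real (R\<^sup>2) - cnj a * z) + of_real R * (z - a) * cnj a) /
        (of_real (R\<^sup>2) - cnj a * z)\<^sup>2 =
     (of_real (R\<^sup>2 - (norm a)\<^sup>2) / ((z - a) * (of_real (R\<^sup>2) - cnj a * z))) * blaschke R a z"
  proof -
    have "of_real R * (of_real (R\<^sup>2) - cnj a * z) + of_real R * (z - a) * cnj a =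
        of_real R * of_real (R\<^sup>2 - (norm a)\<^sup>2)"
      unfolding of_real_diff aa by (simp add: algebra_simps)
    then show ?thesis
      using assms(1) den by (simp add: blaschke_def power2_eq_square)
  qed
  finally show ?thesis .
qed

lemma has_field_derivative_prod_power:
  fixes f :: "'a \<Rightarrow> complex \<Rightarrow> complex"
  assumes "finite A" "\<And>a. a \<in> A \<Longrightarrow> (f a has_field_derivative d a * f a z) (at z)"
  shows "((\<lambda>z. \<Prod>a\<in>A. f a z ^ k a) has_field_derivative
     (\<Sum>a\<in>A. of_nat (k a) * d a) * (\<Prod>a\<in>A. f a z ^ k a)) (at z)"
  using assms
proof (induction A rule: finite_induct)
  case (insert a A)
  have "((\<lambda>z. f a z ^ k a) has_field_derivative of_nat (k a) * d a * f a z ^ k a) (at z)"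
  proof (cases "k a")
    case (Suc j)
    then show ?thesis
      using DERIV_power[OF insert.prems[of a], of "k a"] by (simp add: algebra_simps)
  qed simp
  from DERIV_mult[OF this insert.IH] insert show ?case
    by (simp add: algebra_simps)
qed simp

lemma sqrt_sum_le:
  assumes "finite A" "\<And>a. a \<in> A \<Longrightarrow> 0 \<le> f a"
  shows "sqrt (\<Sum>a\<in>A. f a) \<le> (\<Sum>a\<in>A. sqrt (f a))"
  using assms
proof (induction A rule: finite_induct)
  case (insert a A)
  have "sqrt (f a + sum f A) \<le> sqrt (f a) + sqrt (sum f A)"
    using insert by (intro sqrt_add_le_add_sqrt sum_nonneg) auto
  with insert show ?case by fastforce
qed simp

lemma sqrt_le_1_plus: "0 \<le> x \<Longrightarrow> sqrt x \<le> 1 + x"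
  by (rule real_le_lsqrt) (auto simp: power2_eq_square algebra_simps)

text \<open>
  The weight \<open>(R - \<bar>a\<bar>) / R\<close> of a zero is a lower bound of its contribution \<open>ln (R / \<bar>a\<bar>)\<close> to the formula
  of Jensen, and it stays finite at \<open>a = 0\<close>.
\<close>
definition weighted_zero_sum :: "(complex \<Rightarrow> complex) \<Rightarrow> real \<Rightarrow> real" where
  "weighted_zero_sum p R = (\<Sum>a\<in>zeros_in_disc p R. real (zero_mult p a) * ((R - norm a) / R))"

lemma weighted_zero_sum_nonneg: "0 < R \<Longrightarrow> 0 \<le> weighted_zero_sum p R"
  unfolding weighted_zero_sum_def by (intro sum_nonneg) (auto simp: zeros_in_disc_def)

text \<open>
  A zero at distance at least \<open>(R - r) / 2\<close> from the circle of radius \<open>r\<close> contributes a bounded multiple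
  of its weight. A zero in the disc of radius \<open>(R + r) / 2\<close> has weight at least \<open>(R - r) / (2 R)\<close>, so
  that there the weights control the number of zeros.
\<close>
lemma sqrt_sum_blaschke_le:
  assumes fin: "finite Z" and ZR: "\<And>a. a \<in> Z \<Longrightarrow> norm a < R"
    and r: "norm z = r" "r < R" "1 \<le> R" and d: "1 / (R - r) \<le> d" "1 \<le> d" and za: "z \<notin> Z"
  shows "sqrt (norm (\<Sum>a\<in>Z. of_nat (k a) *
      (of_real (R\<^sup>2 - (norm a)\<^sup>2) / ((z - a) * (of_real (R\<^sup>2) - cnj a * z)))))
    \<le> 1 + 4 * R\<^sup>2 * d\<^sup>2 *
      (\<Sum>a\<in>Z. real (k a) * ((R - norm a) / R) * (1 + 1 / sqrt (norm (z - a))))"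
proof -
  define w where "w = (\<lambda>a::complex. (R - norm a) / R)"
  define t where "t = (\<lambda>a. of_real (R\<^sup>2 - (norm a)\<^sup>2) / ((z - a) * (of_real (R\<^sup>2) - cnj a * z)))"
  define F where "F = {a\<in>Z. (r + R) / 2 \<le> norm a}"
  define N where "N = {a\<in>Z. norm a < (r + R) / 2}"
  have Z: "Z = F \<union> N" "F \<inter> N = {}" "finite F" "finite N"
    using fin by (auto simp: F_def N_def)
  have w0: "0 \<le> w a" if "a \<in> Z" for a using ZR[OF that] r by (simp add: w_def)
  have d': "1 \<le> d * (R - r)" using d r by (simp add: field_simps)
  have RR: "R * d \<le> R\<^sup>2 * d\<^sup>2" "R * d\<^sup>2 \<le> R\<^sup>2 * d\<^sup>2" "1 \<le> R * d"
  proof -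
    show 1: "1 \<le> R * d" using mult_mono[of 1 R 1 d] r d by simp
    show "R * d \<le> R\<^sup>2 * d\<^sup>2" using mult_mono[of 1 "R*d" "R*d" "R*d"] 1 by (simp add: power2_eq_square algebra_simps)
    show "R * d\<^sup>2 \<le> R\<^sup>2 * d\<^sup>2" using r by (intro mult_right_mono) (auto simp: power2_eq_square)
  qed
  have t: "norm (t a) \<le> 2 * R * d * w a / norm (z - a)" if a: "a \<in> Z" for a
  proof -
    have nz: "0 < norm (z - a)" using za a by auto
    have "norm a * r \<le> R * r"
      using ZR[OF a] r norm_ge_zero[of z] by (intro mult_right_mono) auto
    moreover have "R\<^sup>2 - norm a * r \<le> norm (of_real (R\<^sup>2) - cnj a * z)"
      using norm_triangle_ineq2[of "of_real (R\<^sup>2)" "cnj a * z"] r by (simp add: norm_mult del: of_real_power)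
    ultimately have den: "R * (R - r) \<le> norm (of_real (R\<^sup>2) - cnj a * z)"
      by (simp add: power2_eq_square algebra_simps)
    have "R\<^sup>2 - (norm a)\<^sup>2 = (R - norm a) * (R + norm a)"
      by (simp add: power2_eq_square algebra_simps)
    also have "\<dots> \<le> (R - norm a) * (2 * R)"
      using ZR[OF a] by (intro mult_left_mono) auto
    also have "\<dots> = 2 * R\<^sup>2 * w a"
      using r by (simp add: w_def power2_eq_square)
    finally have num: "R\<^sup>2 - (norm a)\<^sup>2 \<le> 2 * R\<^sup>2 * w a" .
    have num0: "0 \<le> R\<^sup>2 - (norm a)\<^sup>2"
      using ZR[OF a] r by (simp add: power_mono)
    have "norm (t a) = (R\<^sup>2 - (norm a)\<^sup>2) / (norm (z - a) * norm (of_real (R\<^sup>2) - cnj a * z))"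
      unfolding t_def norm_divide norm_mult norm_of_real using num0 by simp
    also have "\<dots> \<le> (2 * R\<^sup>2 * w a) / (norm (z - a) * (R * (R - r)))"
      using num num0 den nz r w0[OF a] by (intro frac_le mult_left_mono mult_pos_pos) auto
    also have "\<dots> = (2 * R * w a / norm (z - a)) * (1 / (R - r))"
      using r nz by (simp add: power2_eq_square field_simps)
    also have "\<dots> \<le> (2 * R * w a / norm (z - a)) * d"
      using d w0[OF a] r by (intro mult_left_mono) auto
    finally show ?thesis by (simp add: mult_ac)
  qed
  have far: "norm (t a) \<le> 4 * R\<^sup>2 * d\<^sup>2 * w a" if a: "a \<in> F" for a
  proof -
    have "(R - r) / 2 \<le> norm (z - a)"
      using norm_triangle_ineq2[of a z] a r by (auto simp: F_def norm_minus_commute field_simps)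
    moreover have "1 / (2 * d) \<le> (R - r) / 2" using d' d by (simp add: field_simps)
    ultimately have n: "1 / (2 * d) \<le> norm (z - a)" by linarith
    have aZ: "a \<in> Z" using a by (simp add: F_def)
    have "norm (t a) \<le> 2 * R * d * w a / norm (z - a)" by (rule t[OF aZ])
    also have "\<dots> \<le> 2 * R * d * w a / (1 / (2 * d))"
      using n d r w0[OF aZ] za aZ by (intro divide_left_mono mult_pos_pos mult_nonneg_nonneg) auto
    also have "\<dots> = 4 * (R * d\<^sup>2) * w a" by (simp add: power2_eq_square)
    also have "\<dots> \<le> 4 * (R\<^sup>2 * d\<^sup>2) * w a"
      by (rule mult_right_mono[OF mult_left_mono[OF RR(2)] w0[OF aZ]]) simp
    finally show ?thesis by (simp add: mult_ac)
  qed
  have near: "sqrt (norm (t a)) \<le> 4 * R\<^sup>2 * d\<^sup>2 * w a * (1 / sqrt (norm (z - a)))" if a: "a \<in> N" for a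
  proof -
    have aZ: "a \<in> Z" using a by (simp add: N_def)
    have nz: "0 < norm (z - a)" using za aZ by auto
    have w1: "w a \<le> 1" using r by (simp add: w_def field_simps)
    have "R - r \<le> 2 * (R - norm a)" using a by (simp add: N_def)
    then have "d * (R - r) \<le> d * (2 * (R - norm a))" using d by (intro mult_left_mono) auto
    moreover have "d * (2 * (R - norm a)) = 2 * (R * d) * w a" using r by (simp add: w_def)
    ultimately have w2: "1 \<le> 2 * (R * d) * w a" using d' by linarith
    have "norm (t a) \<le> 2 * R * d * w a / norm (z - a)" by (rule t[OF aZ])
    also have "\<dots> \<le> 2 * R * d * 1 / norm (z - a)"
      using w1 RR nz r d by (intro divide_right_mono mult_left_mono) auto
    also have "\<dots> \<le> (2 * (R * d))\<^sup>2 / norm (z - a)"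
      using RR nz by (intro divide_right_mono) (auto simp: power2_eq_square algebra_simps)
    finally have "sqrt (norm (t a)) \<le> sqrt ((2 * (R * d))\<^sup>2 / norm (z - a))"
      by (rule real_sqrt_le_mono)
    also have "\<dots> = 2 * (R * d) * 1 * (1 / sqrt (norm (z - a)))"
      using RR unfolding real_sqrt_divide real_sqrt_abs by simp
    also have "\<dots> \<le> 2 * (R * d) * (2 * (R * d) * w a) * (1 / sqrt (norm (z - a)))"
      using RR w2 nz by (intro mult_right_mono mult_left_mono) auto
    finally show ?thesis by (simp add: power2_eq_square mult_ac)
  qed
  have "sqrt (norm (\<Sum>a\<in>Z. of_nat (k a) * t a)) \<le> sqrt (\<Sum>a\<in>Z. real (k a) * norm (t a))"
    by (intro real_sqrt_le_mono order.trans[OF norm_sum] sum_mono) (simp add: norm_mult)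
  also have "\<dots> \<le> sqrt (\<Sum>a\<in>F. real (k a) * norm (t a)) + sqrt (\<Sum>a\<in>N. real (k a) * norm (t a))"
    unfolding Z(1) using Z by (subst sum.union_disjoint) (auto intro!: sqrt_add_le_add_sqrt sum_nonneg)
  also have "\<dots> \<le> (1 + (\<Sum>a\<in>F. real (k a) * norm (t a))) + (\<Sum>a\<in>N. real (k a) * sqrt (norm (t a)))"
  proof (intro add_mono)
    show "sqrt (\<Sum>a\<in>F. real (k a) * norm (t a)) \<le> 1 + (\<Sum>a\<in>F. real (k a) * norm (t a))"
      by (intro sqrt_le_1_plus sum_nonneg) auto
    have "sqrt (\<Sum>a\<in>N. real (k a) * norm (t a)) \<le> (\<Sum>a\<in>N. sqrt (real (k a) * norm (t a)))"
      using Z by (intro sqrt_sum_le) auto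
    also have "\<dots> \<le> (\<Sum>a\<in>N. real (k a) * sqrt (norm (t a)))"
    proof (intro sum_mono)
      fix a
      have "sqrt (real (k a)) \<le> real (k a)"
        by (cases "k a = 0") (auto intro!: real_le_lsqrt simp: power2_eq_square)
      then show "sqrt (real (k a) * norm (t a)) \<le> real (k a) * sqrt (norm (t a))"
        unfolding real_sqrt_mult by (intro mult_right_mono) auto
    qed
    finally show "sqrt (\<Sum>a\<in>N. real (k a) * norm (t a)) \<le> (\<Sum>a\<in>N. real (k a) * sqrt (norm (t a)))" .
  qed
  also have "\<dots> \<le> (1 + (\<Sum>a\<in>F. real (k a) * (4 * R\<^sup>2 * d\<^sup>2 * w a * (1 + 1 / sqrt (norm (z - a)))))) +
      (\<Sum>a\<in>N. real (k a) * (4 * R\<^sup>2 * d\<^sup>2 * w a * (1 + 1 / sqrt (norm (z - a)))))"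
  proof (intro add_mono order.refl sum_mono mult_left_mono)
    fix a assume a: "a \<in> F"
    have "norm (t a) \<le> 4 * R\<^sup>2 * d\<^sup>2 * w a * 1" using far[OF a] by simp
    also have "\<dots> \<le> 4 * R\<^sup>2 * d\<^sup>2 * w a * (1 + 1 / sqrt (norm (z - a)))"
      using w0[of a] a by (intro mult_left_mono) (auto simp: F_def)
    finally show "norm (t a) \<le> 4 * R\<^sup>2 * d\<^sup>2 * w a * (1 + 1 / sqrt (norm (z - a)))" .
  next
    fix a assume a: "a \<in> N"
    have "4 * R\<^sup>2 * d\<^sup>2 * w a * (1 / sqrt (norm (z - a))) \<le> 4 * R\<^sup>2 * d\<^sup>2 * w a * (1 + 1 / sqrt (norm (z - a)))"
      using w0[of a] a by (intro mult_left_mono) (auto simp: N_def)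
    with near[OF a] show "sqrt (norm (t a)) \<le> 4 * R\<^sup>2 * d\<^sup>2 * w a * (1 + 1 / sqrt (norm (z - a)))"
      by linarith
  qed auto
  also have "\<dots> = 1 + (\<Sum>a\<in>Z. real (k a) * (4 * R\<^sup>2 * d\<^sup>2 * w a * (1 + 1 / sqrt (norm (z - a)))))"
    unfolding Z(1) using Z by (subst sum.union_disjoint) auto
  also have "\<dots> = 1 + 4 * R\<^sup>2 * d\<^sup>2 * (\<Sum>a\<in>Z. real (k a) * w a * (1 + 1 / sqrt (norm (z - a))))"
    unfolding sum_distrib_left by (simp add: mult_ac)
  finally show ?thesis unfolding t_def w_def .
qed

text \<open>
  Means are taken only over circles on which the entire functions involved have no zeros. All integrands
  are then continuous, and only countably many radii are excluded.
\<close>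
definition nonzero_on_circle :: "(complex \<Rightarrow> complex) \<Rightarrow> real \<Rightarrow> bool" where
  "nonzero_on_circle p r \<longleftrightarrow> (\<forall>z. norm z = r \<longrightarrow> p z \<noteq> 0)"

lemma weighted_zero_sum_le_log_mean:
  assumes p: "nonzero_entire p" and R: "1 \<le> R" and nz: "nonzero_on_circle p R"
  shows "weighted_zero_sum p R \<le> real (zero_mult p 0) - ln (norm (zor_poly p 0 0)) + log_mean p R"
proof -
  define Z where "Z = zeros_in_disc p R"
  have fin: "finite Z" unfolding Z_def by (rule finite_zeros_in_disc[OF p])
  have J: "log_mean p R = ln (norm (zor_poly p 0 0)) + real (zero_mult p 0) * ln R +
     (\<Sum>a\<in>Z - {0}. real (zero_mult p a) * ln (R / norm a))"
    unfolding Z_def by (rule Jensen_formula[OF p]) (use R nz in \<open>auto simp: nonzero_on_circle_def\<close>)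
  have "weighted_zero_sum p R \<le> (\<Sum>a\<in>insert 0 (Z - {0}). real (zero_mult p a) * ((R - norm a) / R))"
    unfolding weighted_zero_sum_def Z_def[symmetric]
    by (rule sum_mono2) (use fin R in \<open>auto simp: Z_def zeros_in_disc_def\<close>)
  also have "\<dots> = real (zero_mult p 0) + (\<Sum>a\<in>Z - {0}. real (zero_mult p a) * ((R - norm a) / R))"
    using fin R by (subst sum.insert) auto
  also have "\<dots> \<le> real (zero_mult p 0) + (\<Sum>a\<in>Z - {0}. real (zero_mult p a) * ln (R / norm a))"
  proof (intro add_left_mono sum_mono mult_left_mono)
    fix a assume a: "a \<in> Z - {0}"
    have "ln (norm a / R) \<le> norm a / R - 1"
      using a R by (intro ln_le_minus_one) auto
    then show "(R - norm a) / R \<le> ln (R / norm a)"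
      using a R by (simp add: ln_div field_simps)
  qed auto
  also have "\<dots> = real (zero_mult p 0) - ln (norm (zor_poly p 0 0)) + log_mean p R - real (zero_mult p 0) * ln R"
    unfolding J by simp
  also have "\<dots> \<le> real (zero_mult p 0) - ln (norm (zor_poly p 0 0)) + log_mean p R"
    using R by simp
  finally show ?thesis .
qed

definition blaschke_sum :: "(complex \<Rightarrow> complex) \<Rightarrow> real \<Rightarrow> complex \<Rightarrow> complex" where
  "blaschke_sum p R z = (\<Sum>a\<in>zeros_in_disc p R. of_nat (zero_mult p a) *
     (of_real (R\<^sup>2 - (norm a)\<^sup>2) / ((z - a) * (of_real (R\<^sup>2) - cnj a * z))))"

text \<open>
  This is the logarithmic derivative of the decomposition of \<open>p\<close> into a Blaschke product and \<open>exp v\<close>.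
\<close>
lemma log_derivative_decomposition:
  assumes p: "nonzero_entire p" and R: "0 < R" and nz: "nonzero_on_circle p R"
  obtains R' v where "R < R'" "v holomorphic_on ball 0 R'"
    "\<And>z. norm z = R \<Longrightarrow> ln (norm (p z)) = Re (v z)"
    "\<And>z. norm z < R \<Longrightarrow> p z \<noteq> 0 \<Longrightarrow> deriv p z / p z = deriv v z +
       blaschke_sum p R z"
proof -
  obtain R' v where R': "R < R'" and v: "v holomorphic_on ball 0 R'"
    and den: "\<And>a z. a \<in> zeros_in_disc p R \<Longrightarrow> z \<in> ball 0 R' \<Longrightarrow> of_real (R\<^sup>2) - cnj a * z \<noteq> 0"
    and pv: "\<And>z. z \<in> ball 0 R' \<Longrightarrow>
       p z = (\<Prod>a\<in>zeros_in_disc p R. blaschke R a z ^ zero_mult p a) * exp (v z)"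
    using blaschke_decomposition[OF p R] nz unfolding nonzero_on_circle_def by blast
  show thesis
  proof (rule that[OF R' v])
    show "ln (norm (p z)) = Re (v z)" if "norm z = R" for z
      by (rule ln_norm_eq_Re_on_circle[OF pv that R'])
    fix z assume z: "norm z < R" "p z \<noteq> 0"
    define Z where "Z = zeros_in_disc p R"
    define S where "S = (\<Sum>a\<in>Z. of_nat (zero_mult p a) *
         (of_real (R\<^sup>2 - (norm a)\<^sup>2) / ((z - a) * (of_real (R\<^sup>2) - cnj a * z))))"
    have zb: "z \<in> ball 0 R'" using z R' by simp
    have "((\<lambda>z. \<Prod>a\<in>Z. blaschke R a z ^ zero_mult p a) has_field_derivative
        S * (\<Prod>a\<in>Z. blaschke R a z ^ zero_mult p a)) (at z)"
      unfolding S_def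
    proof (rule has_field_derivative_prod_power)
      show "finite Z" unfolding Z_def by (rule finite_zeros_in_disc[OF p])
      fix a assume a: "a \<in> Z"
      then have "z \<noteq> a" using z by (auto simp: Z_def zeros_in_disc_def)
      then show "(blaschke R a has_field_derivative
          of_real (R\<^sup>2 - (norm a)\<^sup>2) / ((z - a) * (of_real (R\<^sup>2) - cnj a * z)) * blaschke R a z) (at z)"
        using den[OF a[unfolded Z_def] zb] by (rule blaschke_log_derivative)
    qed
    moreover have "(v has_field_derivative deriv v z) (at z)"
      using v zb by (auto intro: holomorphic_derivI)
    then have "((\<lambda>z. exp (v z)) has_field_derivative exp (v z) * deriv v z) (at z)"
      by (rule DERIV_chain2[OF DERIV_exp])
    ultimately have "((\<lambda>z. (\<Prod>a\<in>Z. blaschke R a z ^ zero_mult p a) * exp (v z)) has_field_derivative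
        (deriv v z + S) * p z) (at z)"
      using DERIV_mult[of _ _ z UNIV] pv[OF zb] by (fastforce simp: Z_def algebra_simps)
    then have "(p has_field_derivative (deriv v z + S) * p z) (at z)"
      by (rule has_field_derivative_transform_within_open[of _ _ _ "ball 0 R'"]) (use zb pv in \<open>auto simp: Z_def\<close>)
    then have "deriv p z = (deriv v z + S) * p z" by (rule DERIV_imp_deriv)
    then show "deriv p z / p z = deriv v z + blaschke_sum p R z"
      using z by (simp add: S_def Z_def blaschke_sum_def)
  qed
qed

lemma circle_mean_weighted_sum_le:
  assumes p: "nonzero_entire p" and r: "1 \<le> r" "r < R" and nz: "nonzero_on_circle p r"
  shows "continuous_on (sphere 0 r) (\<lambda>z. \<Sum>a\<in>zeros_in_disc p R.
      real (zero_mult p a) * ((R - norm a) / R) * (1 + 1 / sqrt (norm (z - a))))" (is "?C")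
    and "circle_mean (\<lambda>z. \<Sum>a\<in>zeros_in_disc p R.
      real (zero_mult p a) * ((R - norm a) / R) * (1 + 1 / sqrt (norm (z - a)))) r \<le>
      101 * weighted_zero_sum p R" (is "?M")
proof -
  define Z where "Z = zeros_in_disc p R"
  define w where "w = (\<lambda>a. real (zero_mult p a) * ((R - norm a) / R))"
  have w0: "0 \<le> w a" if "a \<in> Z" for a
    using that r by (auto simp: w_def Z_def zeros_in_disc_def)
  have fin: "finite Z" unfolding Z_def by (rule finite_zeros_in_disc[OF p])
  have ar: "norm a \<noteq> r" if "a \<in> Z" for a
    using that nz by (auto simp: Z_def zeros_in_disc_def nonzero_on_circle_def)
  have c0: "continuous_on (sphere 0 r) (\<lambda>z. 1 / sqrt (norm (z - a)))" if "a \<in> Z" for a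
    using ar[OF that] by (intro continuous_intros) auto
  have c: "continuous_on (sphere 0 r) (\<lambda>z. w a * (1 + 1 / sqrt (norm (z - a))))" if "a \<in> Z" for a
    by (intro continuous_intros c0 that)
  then have "continuous_on (sphere 0 r) (\<lambda>z. \<Sum>a\<in>Z. w a * (1 + 1 / sqrt (norm (z - a))))"
    by (intro continuous_on_sum)
  then show ?C unfolding w_def Z_def .
  have "circle_mean (\<lambda>z. \<Sum>a\<in>Z. w a * (1 + 1 / sqrt (norm (z - a)))) r =
      (\<Sum>a\<in>Z. circle_mean (\<lambda>z. w a * (1 + 1 / sqrt (norm (z - a)))) r)"
    using r by (intro circle_mean_sum fin c) auto
  also have "\<dots> \<le> (\<Sum>a\<in>Z. w a * 101)"
  proof (intro sum_mono)
    fix a assume a: "a \<in> Z"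
    have "circle_mean (\<lambda>z. 1 + 1 / sqrt (norm (z - a))) r = 1 + circle_mean (\<lambda>z. 1 / sqrt (norm (z - a))) r"
      using r c0[OF a] by (subst circle_mean_add) auto
    also have "\<dots> \<le> 101"
      using circle_mean_inverse_sqrt_dist_le[OF r(1) ar[OF a]] by simp
    finally show "circle_mean (\<lambda>z. w a * (1 + 1 / sqrt (norm (z - a)))) r \<le> w a * 101"
      unfolding circle_mean_cmult by (intro mult_left_mono w0 a)
  qed
  also have "\<dots> = 101 * weighted_zero_sum p R"
    unfolding weighted_zero_sum_def w_def Z_def sum_distrib_left by (simp add: mult_ac)
  finally show ?M unfolding w_def Z_def .
qed

text \<open>
  Taking square roots makes the singularities \<open>1 / \<bar>z - a\<bar>\<close> of the logarithmic derivative integrable,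
  and concavity of the logarithm then bounds the mean of the logarithm by that of the square root.
\<close>
lemma proximity_log_derivative_le:
  assumes p: "nonzero_entire p" and q: "nonzero_entire q"
    and r: "1 \<le> r" "r < R" and d: "1 / (R - r) \<le> d" "1 \<le> d"
    and nz: "nonzero_on_circle p r" "nonzero_on_circle q r" "nonzero_on_circle p R" "nonzero_on_circle q R"
  shows "proximity_fun (\<lambda>z. deriv p z / p z - deriv q z / q z) r \<le>
    2 * ln (412 * R\<^sup>2 * d\<^sup>2 * (1 + circle_mean (\<lambda>z. \<bar>ln (norm (p z / q z))\<bar>) R +
      weighted_zero_sum p R + weighted_zero_sum q R))"
proof -
  have R: "0 < R" "1 \<le> R" using r by auto
  obtain R1 v1 where R1: "R < R1" and v1: "v1 holomorphic_on ball 0 R1"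
    and Re1: "\<And>z. norm z = R \<Longrightarrow> ln (norm (p z)) = Re (v1 z)"
    and D1: "\<And>z. norm z < R \<Longrightarrow> p z \<noteq> 0 \<Longrightarrow> deriv p z / p z = deriv v1 z +
       blaschke_sum p R z"
    by (rule log_derivative_decomposition[OF p R(1) nz(3)]) blast
  obtain R2 v2 where R2: "R < R2" and v2: "v2 holomorphic_on ball 0 R2"
    and Re2: "\<And>z. norm z = R \<Longrightarrow> ln (norm (q z)) = Re (v2 z)"
    and D2: "\<And>z. norm z < R \<Longrightarrow> q z \<noteq> 0 \<Longrightarrow> deriv q z / q z = deriv v2 z +
       blaschke_sum q R z"
    by (rule log_derivative_decomposition[OF q R(1) nz(4)]) blast
  define v where "v = (\<lambda>z. v1 z - v2 z)"
  define R' where "R' = min R1 R2"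
  have R': "R < R'" using R1 R2 by (simp add: R'_def)
  have v1': "v1 holomorphic_on ball 0 R'"
    by (rule holomorphic_on_subset[OF v1]) (auto simp: R'_def)
  have v2': "v2 holomorphic_on ball 0 R'"
    by (rule holomorphic_on_subset[OF v2]) (auto simp: R'_def)
  have v: "v holomorphic_on ball 0 R'" unfolding v_def by (intro holomorphic_intros v1' v2')
  define X where "X = circle_mean (\<lambda>z. \<bar>ln (norm (p z / q z))\<bar>) R"
  have X: "X = circle_mean (\<lambda>z. \<bar>Re (v z)\<bar>) R"
    unfolding X_def
    by (rule circle_mean_cong)
       (use R nz in \<open>auto simp: nonzero_on_circle_def norm_divide ln_div Re1 Re2 v_def\<close>)
  have X0: "0 \<le> X" unfolding X
    by (rule circle_mean_nonneg)
       (use R R' in \<open>auto intro!: continuous_intros continuous_on_subset[OF holomorphic_on_imp_continuous_on[OF v]]\<close>)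
  define Y where "Y = weighted_zero_sum p R + weighted_zero_sum q R"
  have Y0: "0 \<le> Y" unfolding Y_def using R by (intro add_nonneg_nonneg weighted_zero_sum_nonneg)
  define W where "W = (\<lambda>p z. \<Sum>a\<in>zeros_in_disc p R.
      real (zero_mult p a) * ((R - norm a) / R) * (1 + 1 / sqrt (norm (z - a))))"
  define E where "E = R\<^sup>2 * d\<^sup>2"
  have E: "1 \<le> E" "R * d\<^sup>2 \<le> E"
  proof -
    show "1 \<le> E" using mult_mono[of 1 "R\<^sup>2" 1 "d\<^sup>2"] R d by (simp add: E_def one_le_power)
    show "R * d\<^sup>2 \<le> E" using R unfolding E_def by (intro mult_right_mono) (auto simp: power2_eq_square)
  qed
  \<comment> \<open>\<open>\<Psi>\<close> collects the bounds for \<open>v'\<close> and for the two Blaschke products.\<close>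
  define \<Psi> where "\<Psi> = (\<lambda>z. (4 + 2 * E * X) + 4 * E * (W p z + W q z))"
  define G where "G = (\<lambda>z. deriv p z / p z - deriv q z / q z)"
  have contW: "continuous_on (sphere 0 r) (W p)" "continuous_on (sphere 0 r) (W q)"
    unfolding W_def using circle_mean_weighted_sum_le(1)[OF p r nz(1)]
      circle_mean_weighted_sum_le(1)[OF q r nz(2)] .
  have contPsi: "continuous_on (sphere 0 r) \<Psi>"
    unfolding \<Psi>_def by (intro continuous_intros contW)
  have W0: "0 \<le> W p z" "0 \<le> W q z" for z
    unfolding W_def using R by (auto intro!: sum_nonneg mult_nonneg_nonneg simp: zeros_in_disc_def)
  have Psi1: "1 \<le> \<Psi> z" for z
  proof -
    have "0 \<le> 2 * E * X" "0 \<le> 4 * E * (W p z + W q z)"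
      using E X0 W0[of z] by (auto intro!: mult_nonneg_nonneg add_nonneg_nonneg)
    then show ?thesis unfolding \<Psi>_def by linarith
  qed
  have G: "1 + sqrt (norm (G z)) \<le> \<Psi> z" if z: "norm z = r" for z
  proof -
    define Sp where "Sp = blaschke_sum p R z"
    define Sq where "Sq = blaschke_sum q R z"
    have zn: "p z \<noteq> 0" "q z \<noteq> 0" using z nz by (auto simp: nonzero_on_circle_def)
    have "z \<in> ball 0 R'" using z r R' by simp
    then have "deriv v z = deriv v1 z - deriv v2 z"
      unfolding v_def using v1' v2'
      by (intro deriv_diff) (auto intro: holomorphic_on_imp_differentiable_at)
    then have "G z = deriv v z + (Sp - Sq)"
      unfolding G_def using D1[of z] D2[of z] zn z r by (simp add: Sp_def Sq_def)
    then have "norm (G z) \<le> norm (deriv v z) + (norm Sp + norm Sq)"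
      using norm_triangle_ineq[of "deriv v z" "Sp - Sq"] norm_triangle_ineq4[of Sp Sq] by simp
    then have "sqrt (norm (G z)) \<le> sqrt (norm (deriv v z) + (norm Sp + norm Sq))"
      by (rule real_sqrt_le_mono)
    also have "\<dots> \<le> sqrt (norm (deriv v z)) + (sqrt (norm Sp) + sqrt (norm Sq))"
      by (intro order.trans[OF sqrt_add_le_add_sqrt] add_left_mono sqrt_add_le_add_sqrt add_nonneg_nonneg) auto
    also have "\<dots> \<le> (1 + 2 * E * X) + ((1 + 4 * E * W p z) + (1 + 4 * E * W q z))"
    proof (intro add_mono)
      have "norm (deriv v z) \<le> 2 * R / (R - r)\<^sup>2 * X"
        unfolding X by (rule norm_deriv_le_circle_mean_Re[OF v R(1) R']) (use z r in auto)
      also have "\<dots> = 2 * (R * (1 / (R - r))\<^sup>2) * X" by (simp add: power_divide)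
      also have "\<dots> \<le> 2 * (R * d\<^sup>2) * X"
        using d r R X0 by (intro mult_right_mono mult_left_mono power_mono) auto
      also have "\<dots> \<le> 2 * E * X" using E X0 by (intro mult_right_mono mult_left_mono) auto
      finally show "sqrt (norm (deriv v z)) \<le> 1 + 2 * E * X"
        using sqrt_le_1_plus[of "norm (deriv v z)"] by simp
      have "sqrt (norm Sp) \<le> 1 + 4 * R\<^sup>2 * d\<^sup>2 * W p z"
        unfolding Sp_def W_def blaschke_sum_def
        by (rule sqrt_sum_blaschke_le[OF finite_zeros_in_disc[OF p] _ z r(2) R(2) d])
           (use zn in \<open>auto simp: zeros_in_disc_def\<close>)
      then show "sqrt (norm Sp) \<le> 1 + 4 * E * W p z" by (simp add: E_def mult_ac)
      have "sqrt (norm Sq) \<le> 1 + 4 * R\<^sup>2 * d\<^sup>2 * W q z"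
        unfolding Sq_def W_def blaschke_sum_def
        by (rule sqrt_sum_blaschke_le[OF finite_zeros_in_disc[OF q] _ z r(2) R(2) d])
           (use zn in \<open>auto simp: zeros_in_disc_def\<close>)
      then show "sqrt (norm Sq) \<le> 1 + 4 * E * W q z" by (simp add: E_def mult_ac)
    qed
    finally show ?thesis unfolding \<Psi>_def by (simp add: algebra_simps)
  qed
  have lp: "log_plus (norm (G z)) \<le> 2 * ln (\<Psi> z)" if z: "norm z = r" for z
  proof -
    have s: "0 \<le> sqrt (norm (G z))" by simp
    have "max 1 (norm (G z)) \<le> (1 + sqrt (norm (G z)))\<^sup>2"
      using s by (auto simp: power2_sum max_def)
    also have "\<dots> \<le> (\<Psi> z)\<^sup>2" using G[OF z] s by (intro power_mono) auto
    finally have "log_plus (norm (G z)) \<le> ln ((\<Psi> z)\<^sup>2)"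
      unfolding log_plus_def by (subst ln_le_cancel_iff) auto
    also have "\<dots> = 2 * ln (\<Psi> z)" using Psi1[of z] by (simp add: ln_realpow)
    finally show ?thesis .
  qed
  have contG: "continuous_on (sphere 0 r) G"
    unfolding G_def using nz nonzero_entireD[OF p] nonzero_entireD[OF q]
    by (intro continuous_intros holomorphic_on_imp_continuous_on holomorphic_on_subset[OF holomorphic_deriv[OF _ open_UNIV]])
       (auto simp: nonzero_on_circle_def)
  have "proximity_fun G r \<le> circle_mean (\<lambda>z. 2 * ln (\<Psi> z)) r"
    unfolding proximity_eq
  proof (intro circle_mean_mono cont_log_plus_norm contG)
    show "continuous_on (sphere 0 r) (\<lambda>z. 2 * ln (\<Psi> z))"
      using Psi1 by (intro continuous_intros contPsi) (metis not_one_le_zero)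
  qed (use r lp in auto)
  also have "\<dots> \<le> 2 * ln (circle_mean \<Psi> r)"
    unfolding circle_mean_cmult using r Psi1
    by (intro mult_left_mono circle_mean_ln_le contPsi) auto
  also have "\<dots> \<le> 2 * ln (412 * E * (1 + X + Y))"
  proof -
    have "circle_mean (\<lambda>_. 1) r \<le> circle_mean \<Psi> r"
      using r Psi1 contPsi by (intro circle_mean_mono) auto
    then have "1 \<le> circle_mean \<Psi> r" by simp
    have "circle_mean \<Psi> r = (4 + 2 * E * X) + 4 * E * (circle_mean (W p) r + circle_mean (W q) r)"
      unfolding \<Psi>_def using r
      by (subst circle_mean_add) (auto intro!: continuous_intros contW simp: circle_mean_cmult circle_mean_add contW)
    also have "\<dots> \<le> (4 + 2 * E * X) + 4 * E * (101 * weighted_zero_sum p R + 101 * weighted_zero_sum q R)"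
      unfolding W_def using E p q r nz
      by (intro add_left_mono mult_left_mono add_mono circle_mean_weighted_sum_le(2)) auto
    also have "\<dots> = 4 + 2 * (E * X) + 404 * (E * Y)" by (simp add: Y_def algebra_simps)
    also have "\<dots> \<le> 412 * E * (1 + X + Y)"
    proof -
      have "0 \<le> E * X" "0 \<le> E * Y" using E X0 Y0 by auto
      then show ?thesis using E by (simp add: algebra_simps)
    qed
    finally show ?thesis using \<open>1 \<le> circle_mean \<Psi> r\<close> by simp
  qed
  finally show ?thesis unfolding G_def E_def X_def Y_def by (simp add: algebra_simps)
qed

text \<open>
  For fixed \<open>p\<close> and \<open>q\<close> the formula of Jensen bounds the means in the preceding lemma by the data that
  define the characteristic of \<open>p / q\<close>: its proximity function and the counting function of the zeros of \<open>q\<close>.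
  A single majorant \<open>\<Phi>\<close> will serve for many quotients at once.
\<close>
theorem lemma_on_logarithmic_derivative:
  assumes p: "nonzero_entire p" and q: "nonzero_entire q"
  obtains C where "1 \<le> C" "\<And>r R d \<Phi>. \<lbrakk>1 \<le> r; r < R; 1 / (R - r) \<le> d; 1 \<le> d;
    nonzero_on_circle p r; nonzero_on_circle q r; nonzero_on_circle p R; nonzero_on_circle q R;
    1 + proximity_fun (\<lambda>z. p z / q z) R + \<bar>log_mean q R\<bar> \<le> \<Phi>\<rbrakk> \<Longrightarrow>
    proximity_fun (\<lambda>z. deriv p z / p z - deriv q z / q z) r \<le> 2 * ln (C * R\<^sup>2 * d\<^sup>2 * \<Phi>)"
proof -
  define K where "K = (\<lambda>p. real (zero_mult p 0) - ln (norm (zor_poly p 0 0)))"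
  define C where "C = 412 * (2 + \<bar>K p\<bar> + \<bar>K q\<bar>)"
  show thesis
  proof (rule that[of C])
    show "1 \<le> C" by (simp add: C_def)
    fix r R d \<Phi> :: real
    assume r: "1 \<le> r" "r < R" and d: "1 / (R - r) \<le> d" "1 \<le> d"
      and nz: "nonzero_on_circle p r" "nonzero_on_circle q r" "nonzero_on_circle p R" "nonzero_on_circle q R"
      and Phi: "1 + proximity_fun (\<lambda>z. p z / q z) R + \<bar>log_mean q R\<bar> \<le> \<Phi>"
    have R: "1 \<le> R" "0 \<le> R" using r by auto
    define u where "u = (\<lambda>z. p z / q z)"
    have cu: "continuous_on (sphere 0 R) u" "\<And>z. norm z = R \<Longrightarrow> u z \<noteq> 0"
      unfolding u_def using nz nonzero_entireD[OF p] nonzero_entireD[OF q]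
      by (auto intro!: continuous_intros simp: nonzero_on_circle_def)
    define X where "X = circle_mean (\<lambda>z. \<bar>ln (norm (u z))\<bar>) R"
    define Y where "Y = weighted_zero_sum p R + weighted_zero_sum q R"
    have pr0: "0 \<le> proximity_fun u R" by (rule proximity_nonneg) (use cu R in auto)
    have X: "X = proximity_fun u R + proximity_fun (\<lambda>z. 1 / u z) R"
      unfolding X_def by (rule proximity_add_inverse) (use cu R in auto)
    have "proximity_fun u R - proximity_fun (\<lambda>z. 1 / u z) R = log_mean u R"
      by (rule proximity_diff_inverse) (use cu R in auto)
    also have "\<dots> = log_mean p R - log_mean q R"
      unfolding u_def using nonzero_entireD[OF p] nonzero_entireD[OF q] nz R
      by (intro log_mean_divide) (auto simp: nonzero_on_circle_def)
    finally have J: "proximity_fun u R - proximity_fun (\<lambda>z. 1 / u z) R = log_mean p R - log_mean q R" .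
    have "Y \<le> (K p + log_mean p R) + (K q + log_mean q R)"
      unfolding Y_def K_def by (intro add_mono weighted_zero_sum_le_log_mean p q R nz)
    with X J have "1 + X + Y \<le> 1 + 2 * proximity_fun u R + 2 * log_mean q R + (K p + K q)"
      by simp
    also have "\<dots> \<le> 2 * \<Phi> + (\<bar>K p\<bar> + \<bar>K q\<bar>) * 1"
      using Phi unfolding u_def[symmetric] by (simp add: abs_if split: if_splits)
    also have "\<dots> \<le> 2 * \<Phi> + (\<bar>K p\<bar> + \<bar>K q\<bar>) * \<Phi>"
      using Phi pr0 unfolding u_def by (intro add_left_mono mult_left_mono) auto
    finally have XY: "1 + X + Y \<le> (2 + \<bar>K p\<bar> + \<bar>K q\<bar>) * \<Phi>" by (simp add: algebra_simps)
    have XY1: "1 \<le> 1 + X + Y"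
    proof -
      have "0 \<le> X" unfolding X_def using cu R by (intro circle_mean_nonneg continuous_intros) auto
      moreover have "0 \<le> Y" unfolding Y_def using R by (intro add_nonneg_nonneg weighted_zero_sum_nonneg) auto
      ultimately show ?thesis by simp
    qed
    have "proximity_fun (\<lambda>z. deriv p z / p z - deriv q z / q z) r \<le> 2 * ln (412 * R\<^sup>2 * d\<^sup>2 * (1 + X + Y))"
      using proximity_log_derivative_le[OF p q r d nz] by (simp add: X_def Y_def u_def add.assoc)
    also have "\<dots> \<le> 2 * ln (412 * R\<^sup>2 * d\<^sup>2 * ((2 + \<bar>K p\<bar> + \<bar>K q\<bar>) * \<Phi>))"
    proof -
      have pos: "0 < 412 * R\<^sup>2 * d\<^sup>2" using R d by auto
      then have "412 * R\<^sup>2 * d\<^sup>2 * (1 + X + Y) \<le> 412 * R\<^sup>2 * d\<^sup>2 * ((2 + \<bar>K p\<bar> + \<bar>K q\<bar>) * \<Phi>)"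
        using XY by (intro mult_left_mono) auto
      moreover have "0 < 412 * R\<^sup>2 * d\<^sup>2 * (1 + X + Y)" using pos XY1 by (intro mult_pos_pos) auto
      ultimately show ?thesis by (intro mult_left_mono[of _ _ "2::real"] ln_mono) auto
    qed
    also have "412 * R\<^sup>2 * d\<^sup>2 * ((2 + \<bar>K p\<bar> + \<bar>K q\<bar>) * \<Phi>) = C * R\<^sup>2 * d\<^sup>2 * \<Phi>"
      by (simp add: C_def algebra_simps)
    finally show "proximity_fun (\<lambda>z. deriv p z / p z - deriv q z / q z) r \<le> 2 * ln (C * R\<^sup>2 * d\<^sup>2 * \<Phi>)" .
  qed
qed

section \<open>Counting functions in terms of means of logarithms\<close>

text \<open>
  For \<open>r \<ge> 1\<close> all terms of the formula of Jensen except the constant one are nonnegative.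
\<close>
lemma log_mean_bounded_below:
  assumes p: "nonzero_entire p"
  obtains B where "\<And>r. 1 \<le> r \<Longrightarrow> nonzero_on_circle p r \<Longrightarrow> B \<le> log_mean p r"
proof (rule that)
  fix r :: real assume r: "1 \<le> r" "nonzero_on_circle p r"
  have "log_mean p r = ln (norm (zor_poly p 0 0)) + real (zero_mult p 0) * ln r +
     (\<Sum>a\<in>zeros_in_disc p r - {0}. real (zero_mult p a) * ln (r / norm a))"
    using r by (intro Jensen_formula[OF p]) (auto simp: nonzero_on_circle_def)
  moreover have "0 \<le> (\<Sum>a\<in>zeros_in_disc p r - {0}. real (zero_mult p a) * ln (r / norm a))"
    using r by (intro sum_nonneg mult_nonneg_nonneg) (auto simp: zeros_in_disc_def)
  moreover have "0 \<le> real (zero_mult p 0) * ln r" using r by simp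
  ultimately show "ln (norm (zor_poly p 0 0)) \<le> log_mean p r" by linarith
qed

lemma log_mean_le_of_finite_zeros:
  assumes p: "nonzero_entire p" and fin: "finite {z. p z = 0}"
  obtains B K where "\<And>r. 1 \<le> r \<Longrightarrow> nonzero_on_circle p r \<Longrightarrow> log_mean p r \<le> B + K * ln r"
proof (rule that)
  define Z where "Z = {z. p z = 0} - {0}"
  fix r :: real assume r: "1 \<le> r" "nonzero_on_circle p r"
  have "log_mean p r = ln (norm (zor_poly p 0 0)) + real (zero_mult p 0) * ln r +
     (\<Sum>a\<in>zeros_in_disc p r - {0}. real (zero_mult p a) * ln (r / norm a))"
    using r by (intro Jensen_formula[OF p]) (auto simp: nonzero_on_circle_def)
  also have "(\<Sum>a\<in>zeros_in_disc p r - {0}. real (zero_mult p a) * ln (r / norm a)) \<le>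
      (\<Sum>a\<in>zeros_in_disc p r - {0}. real (zero_mult p a) * (ln r + \<bar>ln (norm a)\<bar>))"
    using r by (intro sum_mono mult_left_mono) (auto simp: ln_div)
  also have "\<dots> \<le> (\<Sum>a\<in>Z. real (zero_mult p a) * (ln r + \<bar>ln (norm a)\<bar>))"
    using fin r by (intro sum_mono2) (auto simp: Z_def zeros_in_disc_def)
  also have "\<dots> = (\<Sum>a\<in>Z. real (zero_mult p a)) * ln r + (\<Sum>a\<in>Z. real (zero_mult p a) * \<bar>ln (norm a)\<bar>)"
    by (simp add: distrib_left sum.distrib sum_distrib_right)
  finally show "log_mean p r \<le> (ln (norm (zor_poly p 0 0)) + (\<Sum>a\<in>Z. real (zero_mult p a) * \<bar>ln (norm a)\<bar>)) +
      (real (zero_mult p 0) + (\<Sum>a\<in>Z. real (zero_mult p a))) * ln r"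
    by (simp add: algebra_simps)
qed

lemma log_mean_growth_of_infinite_zeros:
  assumes p: "nonzero_entire p" and inf: "infinite {z. p z = 0}"
  shows "eventually (\<lambda>r. nonzero_on_circle p r \<longrightarrow> K * ln r \<le> log_mean p r) at_top"
proof -
  have "infinite ({z. p z = 0} - {0})" using inf by simp
  then obtain S where S: "finite S" "card S = Suc (nat \<lceil>K\<rceil>)" "S \<subseteq> {z. p z = 0} - {0}"
    by (meson infinite_arbitrarily_large)
  have mult: "1 \<le> zero_mult p a" if "a \<in> S" for a
    using zero_mult_factor[OF p, of a] that S(3) by (metis (mono_tags, lifting) DiffD1 One_nat_def Suc_leI mem_Collect_eq subsetD)
  define c where "c = ln (norm (zor_poly p 0 0)) - (\<Sum>a\<in>S. ln (norm a))"
  have "eventually (\<lambda>r. \<forall>a\<in>S. norm a < r) at_top"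
    by (intro eventually_ball_finite S(1) ballI eventually_gt_at_top)
  moreover have "eventually (\<lambda>r. - c \<le> ln r) at_top"
    using ln_at_top unfolding filterlim_at_top by blast
  ultimately show ?thesis using eventually_ge_at_top[of 1]
  proof eventually_elim
    case (elim r)
    show ?case
    proof
      assume nz: "nonzero_on_circle p r"
      have "log_mean p r = ln (norm (zor_poly p 0 0)) + real (zero_mult p 0) * ln r +
         (\<Sum>a\<in>zeros_in_disc p r - {0}. real (zero_mult p a) * ln (r / norm a))"
        using elim nz by (intro Jensen_formula[OF p]) (auto simp: nonzero_on_circle_def)
      moreover have "(\<Sum>a\<in>S. ln (r / norm a)) \<le>
          (\<Sum>a\<in>zeros_in_disc p r - {0}. real (zero_mult p a) * ln (r / norm a))"
      proof -
        have "(\<Sum>a\<in>S. ln (r / norm a)) \<le> (\<Sum>a\<in>S. real (zero_mult p a) * ln (r / norm a))"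
        proof (intro sum_mono)
          fix a assume a: "a \<in> S"
          then have "a \<noteq> 0" "norm a < r" using S elim by auto
          then have "0 \<le> ln (r / norm a)" by simp
          moreover have "1 \<le> real (zero_mult p a)" using mult[OF a] by simp
          ultimately show "ln (r / norm a) \<le> real (zero_mult p a) * ln (r / norm a)"
            using mult_right_mono[of 1 "real (zero_mult p a)" "ln (r / norm a)"] by simp
        qed
        also have "\<dots> \<le> (\<Sum>a\<in>zeros_in_disc p r - {0}. real (zero_mult p a) * ln (r / norm a))"
          using finite_zeros_in_disc[OF p] S elim
          by (intro sum_mono2) (auto simp: zeros_in_disc_def)
        finally show ?thesis .
      qed
      moreover have "(\<Sum>a\<in>S. ln (r / norm a)) = (\<Sum>a\<in>S. ln r - ln (norm a))"
        using S elim by (intro sum.cong) (auto simp: ln_div)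
      moreover have "\<dots> = real (Suc (nat \<lceil>K\<rceil>)) * ln r - (\<Sum>a\<in>S. ln (norm a))"
        using S by (simp add: sum_subtractf)
      moreover have "0 \<le> real (zero_mult p 0) * ln r" using elim by simp
      moreover have "(K + 1) * ln r \<le> real (Suc (nat \<lceil>K\<rceil>)) * ln r"
        using elim by (intro mult_right_mono) (auto, linarith)
      moreover have "(K + 1) * ln r = K * ln r + ln r" by (simp add: algebra_simps)
      moreover have "- c \<le> ln r" using elim by simp
      ultimately show "K * ln r \<le> log_mean p r"
        unfolding c_def by linarith
    qed
  qed
qed

text \<open>
  The function \<open>f (1 / z)\<close> has an essential singularity at 0: a finite limit would make \<open>f\<close> constant by
  the theorem of Liouville, and a pole would make \<open>f\<close> a polynomial. The great theorem of Picard applies.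
\<close>
lemma transcendental_infinite_preimage:
  assumes f: "transcendental_entire f"
  obtains c where "infinite {z. f z = c}"
proof -
  have hol: "f holomorphic_on UNIV" and npoly: "\<nexists>p :: complex poly. f = poly p"
    using f by (auto simp: transcendental_entire_def)
  have tr: "(g \<longlongrightarrow> l) at_infinity" if "((g \<circ> inverse) \<longlongrightarrow> l) (at 0)" for g :: "complex \<Rightarrow> complex" and l
    using that unfolding at_to_infinity filterlim_filtermap by (simp add: o_def)
  have non1: "\<not> ((f \<circ> inverse) \<longlongrightarrow> l) (at 0)" for l
  proof
    assume "((f \<circ> inverse) \<longlongrightarrow> l) (at 0)"
    then have "f z = l" for z by (intro Liouville_weak[OF hol] tr)
    then have "f = poly [:l:]" by auto
    then show False using npoly by blast
  qed
  have non2: "\<not> ((inverse \<circ> (f \<circ> inverse)) \<longlongrightarrow> l) (at 0)" for l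
  proof
    assume "((inverse \<circ> (f \<circ> inverse)) \<longlongrightarrow> l) (at 0)"
    then have "((inverse \<circ> f) \<longlongrightarrow> l) at_infinity" by (intro tr) (simp add: o_assoc)
    then obtain a n where "\<And>z. f z = (\<Sum>i\<le>n. a i * z ^ i)" using pole_at_infinity[OF hol] by blast
    then have "f = poly (\<Sum>i\<le>n. monom (a i) i)" by (auto simp: poly_sum poly_monom)
    then show False using npoly by blast
  qed
  have "(f \<circ> inverse) holomorphic_on UNIV - {0}"
    by (intro holomorphic_on_compose_gen[OF _ hol] holomorphic_intros) auto
  then obtain a where a: "\<And>w. w \<noteq> a \<Longrightarrow> infinite {x. x \<in> UNIV - {0} \<and> (f \<circ> inverse) x = w}"
    using great_Picard_infinite[OF open_UNIV UNIV_I _ non1 non2] by blast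
  have "infinite (inverse ` {x. x \<in> UNIV - {0} \<and> (f \<circ> inverse) x = a + 1})"
    using a[of "a + 1"] by (subst finite_image_iff) (auto intro!: inj_onI)
  then have "infinite {z. f z = a + 1}"
    by (rule contrapos_nn) (erule finite_subset[rotated], auto)
  then show thesis by (rule that)
qed

text \<open>
  Let \<open>c\<close> be a value that \<open>f\<close> takes infinitely often. By the formula of Jensen each zero of \<open>f - c\<close>
  contributes \<open>ln r + O(1)\<close> to the mean of \<open>ln \<bar>f - c\<bar>\<close>, which the proximity function of \<open>f\<close> bounds up to
  a constant.
\<close>
lemma transcendental_proximity_growth:
  assumes f: "transcendental_entire f"
  obtains c where "nonzero_entire (\<lambda>z. f z - c)"
    "\<And>K. eventually (\<lambda>r. nonzero_on_circle (\<lambda>z. f z - c) r \<longrightarrow> K * ln r \<le> proximity_fun f r) at_top"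
proof -
  have hol: "f holomorphic_on UNIV" and npoly: "\<nexists>p :: complex poly. f = poly p"
    using f by (auto simp: transcendental_entire_def)
  obtain c where c: "infinite {z. f z = c}" by (rule transcendental_infinite_preimage[OF f])
  define p where "p = (\<lambda>z. f z - c)"
  have p: "nonzero_entire p"
  proof -
    have "\<exists>z. p z \<noteq> 0"
    proof (rule ccontr)
      assume "\<not> ?thesis"
      then have "f = poly [:c:]" by (auto simp: p_def)
      then show False using npoly by blast
    qed
    then show ?thesis using hol by (auto simp: nonzero_entire_def p_def intro!: holomorphic_intros)
  qed
  have inf: "infinite {z. p z = 0}" using c by (simp add: p_def)
  define A where "A = log_plus (norm c) + ln 2"
  have ev: "eventually (\<lambda>r. nonzero_on_circle p r \<longrightarrow> K * ln r \<le> proximity_fun f r) at_top" for K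
  proof -
    have "eventually (\<lambda>r. A \<le> ln r) at_top"
      using ln_at_top unfolding filterlim_at_top by blast
    with log_mean_growth_of_infinite_zeros[OF p inf, of "K + 1"] eventually_ge_at_top[of 1]
    show ?thesis
    proof eventually_elim
      case (elim r)
      show ?case
      proof
        assume nz: "nonzero_on_circle p r"
        have cf: "continuous_on (sphere 0 r) f"
          by (rule continuous_on_subset[OF holomorphic_on_imp_continuous_on[OF hol]]) auto
        have "(K + 1) * ln r \<le> log_mean p r" using elim nz by simp
        also have "\<dots> \<le> proximity_fun p r"
          using nz nonzero_entireD[OF p] elim by (intro log_mean_le_proximity) (auto simp: nonzero_on_circle_def)
        also have "\<dots> \<le> proximity_fun f r + A"
          using proximity_diff_le[of r f "\<lambda>_. c"] cf elim by (simp add: p_def A_def)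
        finally show "K * ln r \<le> proximity_fun f r" using elim by (simp add: algebra_simps)
      qed
    qed
  qed
  show thesis using that[of c] p ev unfolding p_def by blast
qed

subsection \<open>Meromorphic functions as quotients\<close>

text \<open>
  This is the factorization theorem of Weierstrass. The values of \<open>\<alpha>\<close> at isolated points are arbitrary, so
  \<open>\<alpha>\<close> is known to agree with the quotient only in punctured neighbourhoods.
\<close>
lemma meromorphic_as_quotient:
  assumes mero: "\<alpha> meromorphic_on UNIV" and nz: "\<not> (\<forall>\<^sub>\<approx>z. \<alpha> z = 0)"
  obtains p q where "nonzero_entire p" "nonzero_entire q" "\<And>z. p z = 0 \<Longrightarrow> q z \<noteq> 0"
    "\<And>z. eventually (\<lambda>w. \<alpha> w = p w / q w) (at z)" "countable {z. \<alpha> z \<noteq> p z / q z}"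
    "\<And>z. is_pole \<alpha> z \<longleftrightarrow> q z = 0" "\<And>z. q z = 0 \<Longrightarrow> zorder q z = - zorder \<alpha> z"
proof -
  have iso: "isolated_singularity_at \<alpha> z" for z
    using mero by (simp add: meromorphic_on_isolated_singularity meromorphic_on_def)
  obtain h f1 f2 where h: "h holomorphic_on UNIV" "f1 holomorphic_on UNIV" "f2 holomorphic_on UNIV"
    "\<forall>z. f1 z = 0 \<longleftrightarrow> \<not>is_pole (remove_sings \<alpha>) z \<and> remove_sings \<alpha> z = 0"
    "\<forall>z. f2 z = 0 \<longleftrightarrow> is_pole (remove_sings \<alpha>) z"
    "\<forall>z. is_pole (remove_sings \<alpha>) z \<longrightarrow> zorder f2 z = -zorder (remove_sings \<alpha>) z"
    "\<forall>z. h z \<noteq> 0" "\<forall>z. remove_sings \<alpha> z = h z * f1 z / f2 z"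
    by (rule weierstrass_factorization_meromorphic_UNIV[OF remove_sings_nicely_meromorphic[OF mero]])
  define p where "p = (\<lambda>z. h z * f1 z)"
  have near: "eventually (\<lambda>w. remove_sings \<alpha> w = \<alpha> w) (at z)" for z
    by (rule eventually_remove_sings_eq_at[OF iso])
  have eq: "eventually (\<lambda>w. \<alpha> w = p w / f2 w) (at z)" for z
    using near[of z] by eventually_elim (use h(8) in \<open>auto simp: p_def\<close>)
  have cos: "eventually (\<lambda>w. \<alpha> w = p w / f2 w) (cosparse UNIV)"
    using eq by (simp add: eventually_cosparse_open_eq)
  have "{z. \<alpha> z \<noteq> p z / f2 z} sparse_in UNIV"
    using cos by (simp add: eventually_cosparse)
  from sparse_imp_countable[OF open_UNIV this] have "countable {z. \<alpha> z \<noteq> p z / f2 z}" by simp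
  moreover have "\<exists>z. p z \<noteq> 0 \<and> f2 z \<noteq> 0"
  proof (rule ccontr)
    assume no: "\<not> ?thesis"
    have "eventually (\<lambda>w. \<alpha> w = 0) (cosparse UNIV)"
      using cos by eventually_elim (use no in auto)
    with nz show False by simp
  qed
  then have "nonzero_entire p" "nonzero_entire f2"
    using h(1,2,3) by (auto simp: nonzero_entire_def p_def intro!: holomorphic_intros)
  moreover have "f2 z \<noteq> 0" if "p z = 0" for z
    using that h(4,5,7) by (auto simp: p_def)
  moreover have "is_pole \<alpha> z \<longleftrightarrow> f2 z = 0" for z
    using h(5) is_pole_remove_sings_iff[OF iso, of z] by blast
  moreover have "zorder f2 z = - zorder \<alpha> z" if "f2 z = 0" for z
    using h(5,6) that zorder_remove_sings[OF iso, of z] by metis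
  ultimately show thesis
    by (intro that[of p f2] eq) assumption+
qed

lemma has_integral_tail_inverse:
  fixes a r :: real
  assumes "0 < a" "a \<le> r"
  shows "((\<lambda>t. if a \<le> t then 1 / t else 0) has_integral ln (r / a)) {0..r}"
proof -
  have "((\<lambda>t. 1 / t) has_integral (ln r - ln a)) {a..r}"
    using assms by (intro fundamental_theorem_of_calculus)
      (auto intro!: derivative_eq_intros simp: has_real_derivative_iff_has_vector_derivative[symmetric])
  then have "((\<lambda>t. if t \<in> {a..r} then 1 / t else 0) has_integral (ln r - ln a)) {0..r}"
    using assms by (subst has_integral_restrict) auto
  then show ?thesis
    using assms by (subst ln_div) (auto intro: has_integral_eq[rotated])
qed

text \<open>
  Every pole \<open>a \<noteq> 0\<close> contributes its order times the integral of \<open>1 / t\<close> from \<open>\<bar>a\<bar>\<close> to \<open>r\<close>, which is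
  the corresponding term of the formula of Jensen for \<open>q\<close>.
\<close>
lemma counting_fun_eq_log_mean:
  assumes q: "nonzero_entire q" and r: "1 \<le> r" "nonzero_on_circle q r"
    and pole: "\<And>z. is_pole \<alpha> z \<longleftrightarrow> q z = 0" and ord: "\<And>z. q z = 0 \<Longrightarrow> zorder q z = - zorder \<alpha> z"
  shows "log_mean q r = counting_fun \<alpha> r + ln (norm (zor_poly q 0 0))"
proof -
  define Z where "Z = zeros_in_disc q r - {0}"
  have finZ: "finite Z" unfolding Z_def using finite_zeros_in_disc[OF q] by simp
  have pc: "pole_count \<alpha> t = (\<Sum>z | norm z \<le> t \<and> q z = 0. zero_mult q z)" for t
    unfolding pole_count_def using pole ord by (intro sum.cong) (auto simp: zero_mult_def)
  have m0: "zero_mult q 0 = 0" if "q 0 \<noteq> 0"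
    using that zero_mult_factor[OF q, of 0] by (metis neq0_conv)
  have pc0: "pole_count \<alpha> 0 = zero_mult q 0"
  proof (cases "q 0 = 0")
    case True
    then have "{z. norm z \<le> 0 \<and> q z = 0} = {0}" by auto
    then show ?thesis by (simp add: pc)
  next
    case False
    then have "{z. norm z \<le> 0 \<and> q z = 0} = {}" by auto
    then show ?thesis using m0[OF False] by (simp only: pc) simp
  qed
  have step: "real (pole_count \<alpha> t) - real (pole_count \<alpha> 0) =
      (\<Sum>a\<in>Z. if norm a \<le> t then real (zero_mult q a) else 0)" if t: "t \<in> {0..r}" for t
  proof -
    have "pole_count \<alpha> t = (\<Sum>z\<in>insert 0 {a\<in>Z. norm a \<le> t}. zero_mult q z)"
      unfolding pc
    proof (rule sum.mono_neutral_left)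
      have "norm a < r" if "norm a \<le> t" "q a = 0" for a
        using that t r(2) by (cases "norm a = r") (auto simp: nonzero_on_circle_def)
      then show "{z. norm z \<le> t \<and> q z = 0} \<subseteq> insert 0 {a\<in>Z. norm a \<le> t}"
        by (auto simp: Z_def zeros_in_disc_def)
      show "\<forall>i\<in>insert 0 {a\<in>Z. norm a \<le> t} - {z. norm z \<le> t \<and> q z = 0}. zero_mult q i = 0"
        using m0 t by (cases "q 0 = 0") (auto simp: Z_def zeros_in_disc_def)
    qed (use finZ in simp)
    also have "\<dots> = zero_mult q 0 + (\<Sum>a | a \<in> Z \<and> norm a \<le> t. zero_mult q a)"
      using finZ by (subst sum.insert) (auto simp: Z_def)
    finally have "real (pole_count \<alpha> t) - real (pole_count \<alpha> 0) = (\<Sum>a | a \<in> Z \<and> norm a \<le> t. real (zero_mult q a))"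
      by (simp add: pc0)
    also have "\<dots> = (\<Sum>a\<in>Z. if norm a \<le> t then real (zero_mult q a) else 0)"
      using sum.inter_filter[OF finZ] by simp
    finally show ?thesis .
  qed
  have "((\<lambda>t. \<Sum>a\<in>Z. real (zero_mult q a) * (if norm a \<le> t then 1 / t else 0)) has_integral
      (\<Sum>a\<in>Z. real (zero_mult q a) * ln (r / norm a))) {0..r}"
    using finZ by (intro has_integral_sum has_integral_mult_right has_integral_tail_inverse)
                  (auto simp: Z_def zeros_in_disc_def)
  then have "((\<lambda>t. (real (pole_count \<alpha> t) - real (pole_count \<alpha> 0)) / t) has_integral
      (\<Sum>a\<in>Z. real (zero_mult q a) * ln (r / norm a))) {0..r}"
    by (rule has_integral_eq[rotated])
       (auto simp: step sum_divide_distrib intro!: sum.cong)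
  then have "counting_fun \<alpha> r = (\<Sum>a\<in>Z. real (zero_mult q a) * ln (r / norm a)) + real (zero_mult q 0) * ln r"
    unfolding counting_fun_def by (simp add: integral_unique pc0)
  moreover have "log_mean q r = ln (norm (zor_poly q 0 0)) + real (zero_mult q 0) * ln r +
     (\<Sum>a\<in>Z. real (zero_mult q a) * ln (r / norm a))"
    unfolding Z_def using r by (intro Jensen_formula[OF q]) (auto simp: nonzero_on_circle_def)
  ultimately show ?thesis by simp
qed

lemma nevanlinna_char_entire:
  assumes "f holomorphic_on UNIV"
  shows "nevanlinna_char f r = proximity_fun f r"
proof -
  have "\<not> is_pole f z" for z
    using assms by (intro not_is_pole_holomorphic[of UNIV]) auto
  then have "pole_count f t = 0" for t by (simp add: pole_count_def)
  then show ?thesis by (simp add: nevanlinna_char_def counting_fun_def)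
qed

section \<open>Comparable pairs of radii\<close>

text \<open>
  A substitute for the growth lemma of Borel. It holds for an arbitrary \<open>\<Phi>\<close>: in the absence of such a pair all
  admissible radii \<open>r\<close> in a long interval with \<open>2^k \<le> \<Phi> r < 2^(k+1)\<close> lie within \<open>2^(-k-3)\<close> of each
  other, and these clusters are too short to cover the interval together with \<open>E\<close>.
\<close>
lemma comparable_radii:
  fixes \<Phi> :: "real \<Rightarrow> real"
  assumes E: "E \<in> lmeasurable" and N: "countable N"
    and \<Phi>: "\<And>r. x \<le> r \<Longrightarrow> r \<notin> E \<Longrightarrow> r \<notin> N \<Longrightarrow> 1 \<le> \<Phi> r"
  obtains r R where "x \<le> r" "r < R" "R \<le> r + (measure lebesgue E + 1)" "r \<notin> E \<union> N" "R \<notin> E \<union> N"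
    "1 / (R - r) \<le> 8 * \<Phi> r" "\<Phi> R \<le> 2 * \<Phi> r"
proof (rule ccontr)
  note witness = that
  assume nt: "\<not> thesis"
  have no: "\<not> (1 / (R - r) \<le> 8 * \<Phi> r \<and> \<Phi> R \<le> 2 * \<Phi> r)"
    if h: "x \<le> r" "r < R" "R \<le> r + (measure lebesgue E + 1)" "r \<notin> E \<union> N" "R \<notin> E \<union> N" for r R
  proof
    assume "1 / (R - r) \<le> 8 * \<Phi> r \<and> \<Phi> R \<le> 2 * \<Phi> r"
    then have thesis using witness[OF h] by simp
    then show False using nt by simp
  qed
  define M where "M = measure lebesgue E + 1"
  define D where "D = (\<lambda>k::nat. {r \<in> {x..x+M} - E - N. 2 ^ k \<le> \<Phi> r \<and> \<Phi> r < 2 ^ Suc k})"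
  define c where "c = (\<lambda>k. SOME r. r \<in> D k)"
  define e where "e = (\<lambda>k::nat. (1 / 2) ^ k / 8 :: real)"
  have close: "R - r \<le> e k" if "r \<in> D k" "R \<in> D k" for r R k
  proof (cases "r < R")
    case True
    have "\<Phi> R \<le> 2 * \<Phi> r" using that by (auto simp: D_def)
    with no[of r R] True that have "8 * \<Phi> r < 1 / (R - r)"
      by (auto simp: D_def M_def)
    moreover have "8 * 2 ^ k \<le> 8 * \<Phi> r" using that by (simp add: D_def)
    ultimately have "8 * 2 ^ k < 1 / (R - r)" by linarith
    then show ?thesis using True by (simp add: e_def field_simps)
  qed (simp add: e_def order.trans[of _ 0])
  have cover: "{x..x+M} \<subseteq> (E \<union> N) \<union> (\<Union>k. {c k - e k..c k + e k})"
  proof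
    fix r assume r: "r \<in> {x..x+M}"
    show "r \<in> (E \<union> N) \<union> (\<Union>k. {c k - e k..c k + e k})"
    proof (cases "r \<in> E \<union> N")
      case False
      then have "1 \<le> \<Phi> r" using \<Phi> r by auto
      define k where "k = nat \<lfloor>log 2 (\<Phi> r)\<rfloor>"
      have "0 \<le> log 2 (\<Phi> r)" using \<open>1 \<le> \<Phi> r\<close> by simp
      then have "real k \<le> log 2 (\<Phi> r)" "log 2 (\<Phi> r) < real (Suc k)"
        unfolding k_def by linarith+
      then have k: "2 ^ k \<le> \<Phi> r" "\<Phi> r < 2 ^ Suc k"
        using \<open>1 \<le> \<Phi> r\<close> by (simp_all add: le_log_iff log_less_iff powr_realpow powr_add mult.commute)
      then have rD: "r \<in> D k" using r False by (auto simp: D_def)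
      then have "c k \<in> D k" unfolding c_def by (rule someI)
      then have "r \<in> {c k - e k..c k + e k}" using close[OF rD] close[OF _ rD] by force
      then show ?thesis by blast
    qed auto
  qed
  have sN: "N \<in> null_sets lebesgue"
    using N by (simp add: countable_imp_null_set_lborel null_sets_completionI)
  have sE: "E \<in> sets lebesgue" using E by (simp add: fmeasurable_def)
  have "ennreal M = emeasure lebesgue {x..x+M}"
    by (simp add: M_def)
  also have "\<dots> \<le> emeasure lebesgue ((E \<union> N) \<union> (\<Union>k. {c k - e k..c k + e k}))"
    using sE sN by (intro emeasure_mono cover sets.Un sets.countable_UN) (auto dest: null_setsD2)
  also have "\<dots> \<le> emeasure lebesgue (E \<union> N) + emeasure lebesgue (\<Union>k. {c k - e k..c k + e k})"
    using sE sN by (intro emeasure_subadditive sets.Un sets.countable_UN) (auto dest: null_setsD2)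
  also have "emeasure lebesgue (E \<union> N) = ennreal (measure lebesgue E)"
    using sE sN E by (simp add: emeasure_Un_null_set emeasure_eq_measure2)
  also have "emeasure lebesgue (\<Union>k. {c k - e k..c k + e k}) \<le> (\<Sum>k. emeasure lebesgue {c k - e k..c k + e k})"
    by (intro emeasure_subadditive_countably) auto
  also have "\<dots> = (\<Sum>k. ennreal ((1 / 2) ^ k * (1 / 4)))"
    by (intro arg_cong[where f = suminf] ext) (simp add: e_def)
  also have "\<dots> = ennreal (2 * (1 / 4))"
    using sums_mult2[OF geometric_sums[of "1 / 2 :: real"], of "1 / 4"]
    by (intro suminf_ennreal_eq) auto
  also have "ennreal (measure lebesgue E) + ennreal (2 * (1 / 4)) = ennreal (measure lebesgue E + 1 / 2)"
    by (subst ennreal_plus[symmetric]) auto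
  finally have "ennreal M \<le> ennreal (measure lebesgue E + 1 / 2)"
    by simp
  moreover have "0 \<le> measure lebesgue E + 1 / 2" by simp
  ultimately have "M \<le> measure lebesgue E + 1 / 2" using ennreal_le_iff by blast
  then show False by (simp add: M_def)
qed

section \<open>Asymptotic comparison along a sequence of radii\<close>

text \<open>
  A one-sided version of \<open>x \<in> o(T)\<close>, for quantities such as differences of proximity functions, which
  may be very negative.
\<close>
definition small_above :: "(nat \<Rightarrow> real) \<Rightarrow> (nat \<Rightarrow> real) \<Rightarrow> bool" where
  "small_above T x \<longleftrightarrow> (\<forall>\<epsilon>>0. eventually (\<lambda>j. x j \<le> \<epsilon> * T j) sequentially)"

lemma small_aboveD: "small_above T x \<Longrightarrow> 0 < \<epsilon> \<Longrightarrow> eventually (\<lambda>j. x j \<le> \<epsilon> * T j) sequentially"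
  by (simp add: small_above_def)

lemma small_above_mono:
  assumes "small_above T y" "eventually (\<lambda>j. x j \<le> y j) sequentially"
  shows "small_above T x"
  unfolding small_above_def
proof (intro allI impI)
  fix \<epsilon> :: real assume "0 < \<epsilon>"
  from small_aboveD[OF assms(1) this] assms(2)
  show "eventually (\<lambda>j. x j \<le> \<epsilon> * T j) sequentially" by eventually_elim simp
qed

lemma small_above_le:
  assumes "small_above T y" "\<And>j. x j \<le> y j"
  shows "small_above T x"
  by (rule small_above_mono[OF assms(1)]) (simp add: assms(2))

lemma small_above_add:
  assumes "small_above T x" "small_above T y"
  shows "small_above T (\<lambda>j. x j + y j)"
  unfolding small_above_def
proof (intro allI impI)
  fix \<epsilon> :: real assume "0 < \<epsilon>"
  then have e: "0 < \<epsilon> / 2" by simp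
  from small_aboveD[OF assms(1) e] small_aboveD[OF assms(2) e]
  show "eventually (\<lambda>j. x j + y j \<le> \<epsilon> * T j) sequentially"
    by eventually_elim simp
qed

lemma small_above_cmult:
  assumes "small_above T x" "0 < c"
  shows "small_above T (\<lambda>j. c * x j)"
  unfolding small_above_def
proof (intro allI impI)
  fix \<epsilon> :: real assume "0 < \<epsilon>"
  then have "0 < \<epsilon> / c" using assms by simp
  from small_aboveD[OF assms(1) this]
  show "eventually (\<lambda>j. c * x j \<le> \<epsilon> * T j) sequentially"
    by eventually_elim (use assms(2) in \<open>simp add: field_simps\<close>)
qed

lemma small_above_const:
  assumes "filterlim T at_top sequentially"
  shows "small_above T (\<lambda>_. c)"
  unfolding small_above_def
proof (intro allI impI)
  fix \<epsilon> :: real assume e: "0 < \<epsilon>"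
  have "eventually (\<lambda>j. c / \<epsilon> \<le> T j) sequentially"
    using assms unfolding filterlim_at_top by blast
  then show "eventually (\<lambda>j. c \<le> \<epsilon> * T j) sequentially"
    by eventually_elim (use e in \<open>simp add: field_simps\<close>)
qed

lemma small_above_sum:
  assumes "filterlim T at_top sequentially" "finite A" "\<And>a. a \<in> A \<Longrightarrow> small_above T (x a)"
  shows "small_above T (\<lambda>j. \<Sum>a\<in>A. x a j)"
  using assms(2,3)
  by (induction A rule: finite_induct) (auto intro!: small_above_add small_above_const assms(1))


text \<open>
  The exceptional set turns into the condition that the sequence of radii avoids it.
\<close>
lemma is_S_imp_small_above:
  assumes "is_S \<phi> f"
  obtains E where "E \<in> lmeasurable"
    "\<And>s T. \<lbrakk>filterlim s at_top sequentially; \<And>j. s j \<notin> E; \<And>j. \<bar>nevanlinna_char f (s j)\<bar> \<le> T j\<rbrakk> \<Longrightarrow>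
       small_above T (\<lambda>j. \<bar>\<phi> (s j)\<bar>)"
proof -
  obtain E where E: "E \<in> lmeasurable" and o: "\<phi> \<in> o[inf at_top (principal (- E))](nevanlinna_char f)"
    using assms unfolding is_S_def by blast
  show thesis
  proof (rule that[OF E])
    fix s T :: "nat \<Rightarrow> real"
    assume s: "filterlim s at_top sequentially" "\<And>j. s j \<notin> E"
      and T: "\<And>j. \<bar>nevanlinna_char f (s j)\<bar> \<le> T j"
    have lim: "filterlim s (inf at_top (principal (- E))) sequentially"
      using s by (simp add: filterlim_inf filterlim_principal)
    show "small_above T (\<lambda>j. \<bar>\<phi> (s j)\<bar>)"
      unfolding small_above_def
    proof (intro allI impI)
      fix \<epsilon> :: real assume e: "0 < \<epsilon>"
      have "eventually (\<lambda>r. norm (\<phi> r) \<le> \<epsilon> * norm (nevanlinna_char f r)) (inf at_top (principal (- E)))"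
        by (rule landau_o.smallD[OF o e])
      then have "eventually (\<lambda>j. norm (\<phi> (s j)) \<le> \<epsilon> * norm (nevanlinna_char f (s j))) sequentially"
        using lim by (rule eventually_compose_filterlim)
      then show "eventually (\<lambda>j. \<bar>\<phi> (s j)\<bar> \<le> \<epsilon> * T j) sequentially"
      proof eventually_elim
        case (elim j)
        have "\<epsilon> * \<bar>nevanlinna_char f (s j)\<bar> \<le> \<epsilon> * T j" using T[of j] e by (intro mult_left_mono) auto
        with elim show ?case by simp
      qed
    qed
  qed
qed

text \<open>
  A one-sided version of \<open>x \<in> O(G)\<close>.
\<close>
definition dominated :: "(nat \<Rightarrow> real) \<Rightarrow> (nat \<Rightarrow> real) \<Rightarrow> bool" where
  "dominated G x \<longleftrightarrow> (\<exists>C>0. eventually (\<lambda>j. x j \<le> C * G j) sequentially)"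

lemma dominated_le:
  assumes "dominated G y" "\<And>j. x j \<le> y j"
  shows "dominated G x"
proof -
  obtain C where C: "0 < C" "eventually (\<lambda>j. y j \<le> C * G j) sequentially"
    using assms(1) unfolding dominated_def by blast
  from C(2) have "eventually (\<lambda>j. x j \<le> C * G j) sequentially"
  proof eventually_elim
    case (elim j)
    with assms(2)[of j] show ?case by simp
  qed
  with C(1) show ?thesis unfolding dominated_def by blast
qed

lemma dominated_add:
  assumes "dominated G x" "dominated G y"
  shows "dominated G (\<lambda>j. x j + y j)"
proof -
  obtain C D where "0 < C" "eventually (\<lambda>j. x j \<le> C * G j) sequentially"
    "0 < D" "eventually (\<lambda>j. y j \<le> D * G j) sequentially"
    using assms unfolding dominated_def by blast
  moreover from this(2,4) have "eventually (\<lambda>j. x j + y j \<le> (C + D) * G j) sequentially"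
    by eventually_elim (simp add: algebra_simps)
  ultimately show ?thesis unfolding dominated_def by (intro exI[of _ "C + D"]) simp
qed

lemma dominated_cmult:
  assumes "dominated G x" "0 < c"
  shows "dominated G (\<lambda>j. c * x j)"
proof -
  obtain C where C: "0 < C" "eventually (\<lambda>j. x j \<le> C * G j) sequentially"
    using assms unfolding dominated_def by blast
  from C(2) have "eventually (\<lambda>j. c * x j \<le> (c * C) * G j) sequentially"
    by eventually_elim (use assms(2) in \<open>simp add: mult.assoc\<close>)
  then show ?thesis using C(1) assms(2) unfolding dominated_def by (intro exI[of _ "c * C"]) simp
qed

lemma dominated_sum:
  assumes "finite A" "dominated G (\<lambda>_. 0)" "\<And>a. a \<in> A \<Longrightarrow> dominated G (x a)"
  shows "dominated G (\<lambda>j. \<Sum>a\<in>A. x a j)"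
  using assms(1,3)
  by (induction A rule: finite_induct) (auto intro!: dominated_add assms(2))

lemma small_above_imp_dominated:
  assumes "small_above T x" "\<And>j. T j \<le> G j"
  shows "dominated G x"
proof -
  have "eventually (\<lambda>j. x j \<le> 1 * T j) sequentially"
    by (rule small_aboveD[OF assms(1)]) simp
  then have "eventually (\<lambda>j. x j \<le> 1 * G j) sequentially"
  proof eventually_elim
    case (elim j)
    with assms(2)[of j] show ?case by simp
  qed
  then show ?thesis unfolding dominated_def by (intro exI[of _ 1] conjI zero_less_one)
qed

text \<open>
  The term \<open>ln \<Phi> = o(\<Phi>)\<close> can be absorbed into the left side, which gives \<open>\<Phi> = O(T)\<close>.
\<close>
lemma small_above_ln_of_dominated:
  assumes lim: "filterlim \<Phi> at_top sequentially" and dom: "dominated (\<lambda>j. T j + ln (\<Phi> j)) \<Phi>"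
  shows "small_above T (\<lambda>j. ln (\<Phi> j))"
  unfolding small_above_def
proof (intro allI impI)
  fix \<epsilon> :: real assume e: "0 < \<epsilon>"
  obtain C where C: "0 < C" "eventually (\<lambda>j. \<Phi> j \<le> C * (T j + ln (\<Phi> j))) sequentially"
    using dom unfolding dominated_def by blast
  define \<eta> where "\<eta> = min (1 / (2 * C)) (\<epsilon> / (2 * C))"
  have eta: "0 < \<eta>" "C * \<eta> \<le> 1 / 2" "\<eta> * (2 * C) \<le> \<epsilon>"
  proof -
    show "0 < \<eta>" using C e by (simp add: \<eta>_def)
    have "\<eta> \<le> 1 / (2 * C)" "\<eta> \<le> \<epsilon> / (2 * C)" by (simp_all add: \<eta>_def)
    then show "C * \<eta> \<le> 1 / 2" "\<eta> * (2 * C) \<le> \<epsilon>" using C by (simp_all add: field_simps)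
  qed
  have "((\<lambda>x::real. ln x / x) \<longlongrightarrow> 0) at_top" by (rule ln_x_over_x_tendsto_0)
  then have "eventually (\<lambda>x::real. ln x / x < \<eta>) at_top" by (rule order_tendstoD(2)[OF _ eta(1)])
  then have "eventually (\<lambda>j. ln (\<Phi> j) / \<Phi> j < \<eta>) sequentially"
    using lim by (rule eventually_compose_filterlim)
  moreover have "eventually (\<lambda>j. 0 < \<Phi> j) sequentially"
    using lim by (auto simp: filterlim_at_top_dense)
  ultimately show "eventually (\<lambda>j. ln (\<Phi> j) \<le> \<epsilon> * T j) sequentially" using C(2)
  proof eventually_elim
    case (elim j)
    have l: "ln (\<Phi> j) \<le> \<eta> * \<Phi> j" using elim by (simp add: field_simps)
    then have "C * ln (\<Phi> j) \<le> C * (\<eta> * \<Phi> j)" using C by (intro mult_left_mono) auto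
    also have "\<dots> \<le> (1 / 2) * \<Phi> j"
      unfolding mult.assoc[symmetric] using eta elim by (intro mult_right_mono) auto
    finally have "C * ln (\<Phi> j) \<le> \<Phi> j / 2" by simp
    then have P: "\<Phi> j \<le> 2 * C * T j" using elim by (simp add: algebra_simps)
    then have "0 \<le> T j" using elim C by (smt (verit) mult_pos_neg)
    have "\<eta> * \<Phi> j \<le> \<eta> * (2 * C * T j)" using P eta by (intro mult_left_mono) auto
    also have "\<dots> = (\<eta> * (2 * C)) * T j" by simp
    also have "\<dots> \<le> \<epsilon> * T j" using eta \<open>0 \<le> T j\<close> by (intro mult_right_mono)
    finally show ?case using l by simp
  qed
qed

text \<open>
  At comparable pairs of radii \<open>s j < R j\<close> the lemma on the logarithmic derivative has an error term in
  which only quantities at \<open>s j\<close> occur.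
\<close>
lemma log_derivative_along_sequence:
  assumes u: "nonzero_entire u" and v: "nonzero_entire v" and M: "0 \<le> M"
    and s: "\<And>j. 1 \<le> s j" "\<And>j. s j < R j" "\<And>j. R j \<le> s j + M" "\<And>j. 1 / (R j - s j) \<le> 8 * \<Phi> j"
    and nz: "\<And>j. nonzero_on_circle u (s j)" "\<And>j. nonzero_on_circle v (s j)"
      "\<And>j. nonzero_on_circle u (R j)" "\<And>j. nonzero_on_circle v (R j)"
    and \<Phi>: "\<And>j. 1 \<le> \<Phi> j"
      "\<And>j. 1 + proximity_fun (\<lambda>z. u z / v z) (R j) + \<bar>log_mean v (R j)\<bar> \<le> 2 * \<Phi> j"
  shows "\<exists>C. \<forall>j. proximity_fun (\<lambda>z. deriv u z / u z - deriv v z / v z) (s j) \<le>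
    C + 4 * ln (s j) + 6 * ln (\<Phi> j)"
proof -
  obtain C where C: "1 \<le> C" and ld: "\<And>r R d \<Phi>. \<lbrakk>1 \<le> r; r < R; 1 / (R - r) \<le> d; 1 \<le> d;
    nonzero_on_circle u r; nonzero_on_circle v r; nonzero_on_circle u R; nonzero_on_circle v R;
    1 + proximity_fun (\<lambda>z. u z / v z) R + \<bar>log_mean v R\<bar> \<le> \<Phi>\<rbrakk> \<Longrightarrow>
    proximity_fun (\<lambda>z. deriv u z / u z - deriv v z / v z) r \<le> 2 * ln (C * R\<^sup>2 * d\<^sup>2 * \<Phi>)"
    using lemma_on_logarithmic_derivative[OF u v] by blast
  define D where "D = 128 * C * (1 + M)\<^sup>2"
  show ?thesis
  proof (intro exI allI)
    fix j
    have s0: "0 < s j" "0 < \<Phi> j" "0 < R j" using s(1,2)[of j] \<Phi>(1)[of j] by auto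
    have "proximity_fun (\<lambda>z. deriv u z / u z - deriv v z / v z) (s j) \<le>
        2 * ln (C * (R j)\<^sup>2 * (8 * \<Phi> j)\<^sup>2 * (2 * \<Phi> j))"
      using \<Phi>(1)[of j] by (intro ld s nz \<Phi>(2)) auto
    also have "\<dots> \<le> 2 * ln (D * (s j)\<^sup>2 * (\<Phi> j) ^ 3)"
    proof -
      have "M * 1 \<le> M * s j" using M s(1)[of j] by (intro mult_left_mono) auto
      then have "R j \<le> (1 + M) * s j" using s(3)[of j] by (simp add: algebra_simps)
      then have "(R j)\<^sup>2 \<le> ((1 + M) * s j)\<^sup>2" using s0 by (intro power_mono) auto
      then have "(128 * C * \<Phi> j ^ 3) * (R j)\<^sup>2 \<le> (128 * C * \<Phi> j ^ 3) * ((1 + M) * s j)\<^sup>2"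
        using C s0 by (intro mult_left_mono) auto
      then have "C * (R j)\<^sup>2 * (8 * \<Phi> j)\<^sup>2 * (2 * \<Phi> j) \<le> D * (s j)\<^sup>2 * (\<Phi> j) ^ 3"
        by (simp add: D_def power_mult_distrib power2_eq_square power3_eq_cube mult_ac)
      moreover have "0 < C * (R j)\<^sup>2 * (8 * \<Phi> j)\<^sup>2 * (2 * \<Phi> j)" using C s0 by simp
      ultimately show ?thesis by (intro mult_left_mono ln_mono) auto
    qed
    also have "\<dots> = 2 * ln D + 4 * ln (s j) + 6 * ln (\<Phi> j)"
    proof -
      have "0 < D" using C M by (simp add: D_def)
      then show ?thesis using s0 by (simp add: ln_mult ln_realpow)
    qed
    finally show "proximity_fun (\<lambda>z. deriv u z / u z - deriv v z / v z) (s j) \<le>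
        2 * ln D + 4 * ln (s j) + 6 * ln (\<Phi> j)" .
  qed
qed


section \<open>Functions \<open>f^n l\<close> with a small exceptional function\<close>

text \<open>
  The quotient \<open>K / p\<close> is constant near a point with \<open>p \<noteq> 0\<close>; analytic continuation does the rest.
\<close>
lemma wronskian_zero_imp_multiple:
  assumes p: "nonzero_entire p" and K: "K holomorphic_on UNIV"
    and W: "\<And>z. deriv K z * p z = K z * deriv p z"
  obtains c where "\<And>z. K z = c * p z"
proof -
  obtain z0 where z0: "p z0 \<noteq> 0" using p by (auto simp: nonzero_entire_def)
  have "open {z. p z \<noteq> 0}"
    using nonzero_entireD(3)[OF p, of UNIV] by (intro open_Collect_neq) auto
  then obtain e where e: "e > 0" "ball z0 e \<subseteq> {z. p z \<noteq> 0}"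
    using openE[of "{z. p z \<noteq> 0}" z0] z0 by auto
  have "((\<lambda>z. K z / p z) has_field_derivative 0) (at z within ball z0 e)" if "z \<in> ball z0 e" for z
  proof -
    have pz: "p z \<noteq> 0" using e that by auto
    have "(K has_field_derivative deriv K z) (at z)" "(p has_field_derivative deriv p z) (at z)"
      by (rule holomorphic_derivI[OF K open_UNIV UNIV_I], rule holomorphic_derivI[OF nonzero_entireD(1)[OF p] open_UNIV UNIV_I])
    then have "((\<lambda>z. K z / p z) has_field_derivative (deriv K z * p z - K z * deriv p z) / (p z * p z)) (at z)"
      using pz by (auto intro!: derivative_eq_intros)
    then show ?thesis using W[of z] by (simp add: has_field_derivative_at_within)
  qed
  then obtain c where c: "\<And>z. z \<in> ball z0 e \<Longrightarrow> K z / p z = c"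
    using has_field_derivative_zero_constant[of "ball z0 e" "\<lambda>z. K z / p z"] by auto
  have "K z = c * p z" for z
  proof (rule analytic_continuation_open[of "ball z0 e" UNIV K "\<lambda>z. c * p z"])
    show "K z = c * p z" if "z \<in> ball z0 e" for z
      using c[OF that] e(2) that by (auto simp: field_simps)
  qed (use e K nonzero_entireD(1)[OF p] in \<open>auto intro!: holomorphic_intros\<close>)
  then show thesis by (rule that)
qed

lemma derivative_rules_entire:
  assumes "u holomorphic_on UNIV" "v holomorphic_on UNIV"
  shows "deriv (\<lambda>z. u z * v z) z = u z * deriv v z + deriv u z * v z"
    "deriv (\<lambda>z. u z - v z) z = deriv u z - deriv v z"
    "deriv (\<lambda>z. u z ^ n) z = of_nat n * u z ^ (n - 1) * deriv u z"
proof -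
  have u: "(u has_field_derivative deriv u z) (at z)" and v: "(v has_field_derivative deriv v z) (at z)"
    by (rule holomorphic_derivI[OF assms(1) open_UNIV UNIV_I], rule holomorphic_derivI[OF assms(2) open_UNIV UNIV_I])
  show "deriv (\<lambda>z. u z * v z) z = u z * deriv v z + deriv u z * v z"
    using DERIV_mult[OF u v] by (simp add: DERIV_imp_deriv algebra_simps)
  show "deriv (\<lambda>z. u z - v z) z = deriv u z - deriv v z"
    using DERIV_diff[OF u v] by (rule DERIV_imp_deriv)
  show "deriv (\<lambda>z. u z ^ n) z = of_nat n * u z ^ (n - 1) * deriv u z"
    using DERIV_power[OF u, of n] by (simp add: DERIV_imp_deriv algebra_simps)
qed

text \<open>
  Here \<open>\<alpha> = p / q\<close> and \<open>H = q (F - \<alpha>)\<close>, so that \<open>\<gamma> = H'/H - q'/q\<close> is the logarithmic derivative of \<open>F - \<alpha>\<close>,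
  and \<open>W\<close> is \<open>A = F' - \<gamma> F = \<alpha>' - \<gamma> \<alpha>\<close> with its denominators \<open>q H\<close> cleared. The proof is the one outlined above. The
  formula of Jensen for \<open>W\<close> serves twice: it shows that the factor \<open>f\<close> of \<open>W\<close> has few zeros, and it bounds
  the proximity function of \<open>1 / A\<close>.
\<close>
lemma proximity_power_le_of_few_zeros:
  fixes f l p q F H W :: "complex \<Rightarrow> complex" and n :: nat and s T :: "nat \<Rightarrow> real"
  assumes F_def: "F = (\<lambda>z. f z ^ n * l z)"
    and H_def: "H = (\<lambda>z. F z * q z - p z)"
    and W_def: "W = (\<lambda>z. deriv (\<lambda>z. F z * q z) z * H z - F z * q z * deriv H z)"
    and ent: "nonzero_entire f" "nonzero_entire l" "nonzero_entire p" "nonzero_entire q" "nonzero_entire H"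
    and n: "2 \<le> n"
    and fin: "finite {z. H z = 0}"
    and T: "filterlim T at_top sequentially" and s1: "\<And>j. 1 \<le> s j"
    and nz: "\<And>j. nonzero_on_circle f (s j)" "\<And>j. nonzero_on_circle l (s j)" "\<And>j. nonzero_on_circle p (s j)"
      "\<And>j. nonzero_on_circle q (s j)" "\<And>j. nonzero_on_circle H (s j)"
    and nzW: "\<And>j. nonzero_entire W \<Longrightarrow> nonzero_on_circle W (s j)"
    and small_ln: "small_above T (\<lambda>j. ln (s j))"
    and small_prox: "small_above T (\<lambda>j. proximity_fun (\<lambda>z. p z / q z) (s j))"
    and small_poles: "small_above T (\<lambda>j. log_mean q (s j))"
    and small_H: "small_above T (\<lambda>j. proximity_fun (\<lambda>z. deriv H z / H z - deriv q z / q z) (s j))"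
    and small_p: "small_above T (\<lambda>j. proximity_fun (\<lambda>z. deriv p z / p z - deriv q z / q z) (s j))"
    and small_F: "small_above T (\<lambda>j. proximity_fun (\<lambda>z. deriv F z / F z) (s j))"
  shows "small_above T (\<lambda>j. real n * proximity_fun f (s j) - proximity_fun l (s j))"
proof -
  have hol: "f holomorphic_on UNIV" "l holomorphic_on UNIV" "p holomorphic_on UNIV" "q holomorphic_on UNIV"
    "H holomorphic_on UNIV" using ent nonzero_entireD(1) by auto
  have holF: "F holomorphic_on UNIV" unfolding F_def by (intro holomorphic_intros hol)
  have holK: "(\<lambda>z. F z * q z) holomorphic_on UNIV" by (intro holomorphic_intros hol holF)
  have s0: "0 \<le> s j" for j using s1[of j] by simp
  have z1: "f z \<noteq> 0" "l z \<noteq> 0" "p z \<noteq> 0" "q z \<noteq> 0" "H z \<noteq> 0" "F z \<noteq> 0" if "norm z = s j" for z j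
    using nz[of j] that by (auto simp: nonzero_on_circle_def F_def)
  have cont: "continuous_on (sphere 0 (s j)) h" if "h holomorphic_on UNIV" for h :: "complex \<Rightarrow> complex" and j
    by (rule continuous_on_subset[OF holomorphic_on_imp_continuous_on[OF that]]) auto
  have contd: "continuous_on (sphere 0 (s j)) (deriv h)" if "h holomorphic_on UNIV" for h :: "complex \<Rightarrow> complex" and j
    by (intro cont holomorphic_deriv[OF that open_UNIV])
  note conts = cont[OF hol(1)] cont[OF hol(2)] cont[OF hol(3)] cont[OF hol(4)] cont[OF hol(5)] cont[OF holF]
    contd[OF hol(1)] contd[OF hol(2)] contd[OF hol(3)] contd[OF hol(4)] contd[OF hol(5)] contd[OF holF]
  have quotient: "proximity_fun (\<lambda>z. f z ^ n) (s j) \<le> proximity_fun F (s j) + proximity_fun (\<lambda>z. 1 / l z) (s j)" for j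
  proof -
    have "proximity_fun (\<lambda>z. f z ^ n) (s j) = proximity_fun (\<lambda>z. F z * (1 / l z)) (s j)"
      by (rule proximity_cong) (use z1 s0 in \<open>auto simp: F_def\<close>)
    also have "\<dots> \<le> proximity_fun F (s j) + proximity_fun (\<lambda>z. 1 / l z) (s j)"
      using z1 by (intro proximity_mult_le s0 continuous_intros conts) auto
    finally show ?thesis .
  qed
  have jensen_l: "proximity_fun l (s j) - proximity_fun (\<lambda>z. 1 / l z) (s j) = log_mean l (s j)" for j
    using z1 by (intro proximity_diff_inverse s0 conts) auto
  obtain Bl where Bl: "\<And>r. 1 \<le> r \<Longrightarrow> nonzero_on_circle l r \<Longrightarrow> Bl \<le> log_mean l r"
    using log_mean_bounded_below[OF ent(2)] by blast
  have holW: "W holomorphic_on UNIV"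
    unfolding W_def by (intro holomorphic_intros holK hol holF) auto
  have W_eq: "W z = F z * q z * deriv p z - deriv (\<lambda>z. F z * q z) z * p z" for z
  proof -
    have "deriv H z = deriv (\<lambda>z. F z * q z) z - deriv p z"
      unfolding H_def by (rule derivative_rules_entire(2)[OF holK hol(3)])
    moreover have "H z = F z * q z - p z" by (simp add: H_def)
    ultimately have "W z = deriv (\<lambda>z. F z * q z) z * (F z * q z - p z) - F z * q z * (deriv (\<lambda>z. F z * q z) z - deriv p z)"
      unfolding W_def by (simp only:)
    then show ?thesis by (simp add: algebra_simps)
  qed
  show ?thesis
  proof (cases "nonzero_entire W")
    case False
    then have "W z = 0" for z using holW by (auto simp: nonzero_entire_def)
    then have "deriv (\<lambda>z. F z * q z) z * p z = F z * q z * deriv p z" for z using W_eq[of z] by simp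
    from wronskian_zero_imp_multiple[OF ent(3) holK this]
    obtain c where c: "\<And>z. F z * q z = c * p z" by blast
    have "real n * proximity_fun f (s j) - proximity_fun l (s j) \<le>
        log_plus (norm c) + proximity_fun (\<lambda>z. p z / q z) (s j) + (- Bl)" for j
    proof -
      have "F z = c * (p z / q z)" if "norm z = s j" for z
        using c[of z] z1(4)[OF that] by (simp add: field_simps)
      then have "proximity_fun F (s j) = proximity_fun (\<lambda>z. c * (p z / q z)) (s j)"
        by (intro proximity_cong s0) simp
      also have "\<dots> \<le> proximity_fun (\<lambda>_. c) (s j) + proximity_fun (\<lambda>z. p z / q z) (s j)"
        using z1 by (intro proximity_mult_le s0 continuous_intros conts) auto
      finally show ?thesis
        using quotient[of j] jensen_l[of j] Bl[OF s1 nz(2), of j] by (simp add: proximity_power)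
    qed
    moreover have "small_above T (\<lambda>j. log_plus (norm c) + proximity_fun (\<lambda>z. p z / q z) (s j) + (- Bl))"
      by (intro small_above_add small_above_const T small_prox)
    ultimately show ?thesis by (rule small_above_le[rotated])
  next
    case True
    have zW: "W z \<noteq> 0" if "norm z = s j" for z j
      using nzW[OF True] that by (auto simp: nonzero_on_circle_def)
    note contW = cont[OF holW]
    define A where "A = (\<lambda>z. W z / (q z * H z))"
    define \<gamma> where "\<gamma> = (\<lambda>z. deriv H z / H z - deriv q z / q z)"
    define \<delta> where "\<delta> = (\<lambda>z. deriv p z / p z - deriv q z / q z)"
    have contA: "continuous_on (sphere 0 (s j)) A" "continuous_on (sphere 0 (s j)) (\<lambda>z. 1 / A z)"
      and contg: "continuous_on (sphere 0 (s j)) \<gamma>" "continuous_on (sphere 0 (s j)) \<delta>" for j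
      unfolding A_def \<gamma>_def \<delta>_def using z1 zW by (intro continuous_intros conts contW; force)+
    have A1: "A z = (p z / q z) * (\<delta> z - \<gamma> z)" if z: "norm z = s j" for z j
    proof -
      have "deriv H z = deriv (\<lambda>z. F z * q z) z - deriv p z"
        unfolding H_def by (rule derivative_rules_entire(2)[OF holK hol(3)])
      moreover have "H z = F z * q z - p z" by (simp add: H_def)
      ultimately have "deriv p z * H z - p z * deriv H z =
          deriv p z * (F z * q z - p z) - p z * (deriv (\<lambda>z. F z * q z) z - deriv p z)"
        by (simp only:)
      then have "W z = deriv p z * H z - p z * deriv H z"
        unfolding W_eq by (simp add: algebra_simps)
      moreover have "\<delta> z - \<gamma> z = (deriv p z * H z - p z * deriv H z) / (p z * H z)"
        unfolding \<gamma>_def \<delta>_def using z1(3,5)[OF z] by (simp add: field_simps)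
      ultimately have "\<delta> z - \<gamma> z = W z / (p z * H z)" by simp
      then show ?thesis
        unfolding A_def using z1(3)[OF z] by simp
    qed
    have A2: "1 / F z = (deriv F z / F z - \<gamma> z) * (1 / A z)" if z: "norm z = s j" for z j
    proof -
      have "deriv (\<lambda>z. F z * q z) z = F z * deriv q z + deriv F z * q z"
        by (rule derivative_rules_entire(1)[OF holF hol(4)])
      then have "W z = (F z * deriv q z + deriv F z * q z) * H z - F z * q z * deriv H z"
        unfolding W_def by simp
      then have "W z = deriv F z * q z * H z - F z * q z * deriv H z + F z * deriv q z * H z"
        by (simp add: algebra_simps)
      moreover have "(deriv F z / F z - \<gamma> z) * (F z * q z * H z) =
          deriv F z * q z * H z - F z * q z * deriv H z + F z * deriv q z * H z"
        unfolding \<gamma>_def using z1(4,5,6)[OF z] by (simp add: field_simps)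
      ultimately have "W z = (deriv F z / F z - \<gamma> z) * (F z * q z * H z)"
        by (simp only:)
      then show ?thesis
        unfolding A_def using z1[OF z] zW[OF z] by (simp only: divide_divide_eq_right) (simp add: divide_simps)
    qed
    have prox_A: "proximity_fun A (s j) \<le> proximity_fun (\<lambda>z. p z / q z) (s j) +
        (proximity_fun \<delta> (s j) + proximity_fun \<gamma> (s j) + ln 2)" for j
    proof -
      have "proximity_fun A (s j) = proximity_fun (\<lambda>z. (p z / q z) * (\<delta> z - \<gamma> z)) (s j)"
        by (rule proximity_cong) (use A1 s0 in auto)
      also have "\<dots> \<le> proximity_fun (\<lambda>z. p z / q z) (s j) + proximity_fun (\<lambda>z. \<delta> z - \<gamma> z) (s j)"
        using z1 by (intro proximity_mult_le s0 continuous_intros conts contg) auto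
      also have "proximity_fun (\<lambda>z. \<delta> z - \<gamma> z) (s j) \<le> proximity_fun \<delta> (s j) + proximity_fun \<gamma> (s j) + ln 2"
        by (intro proximity_diff_le s0 contg)
      finally show ?thesis by simp
    qed
    have jensen_A: "proximity_fun A (s j) - proximity_fun (\<lambda>z. 1 / A z) (s j) =
        log_mean W (s j) - (log_mean q (s j) + log_mean H (s j))" for j
    proof -
      have "proximity_fun A (s j) - proximity_fun (\<lambda>z. 1 / A z) (s j) = log_mean A (s j)"
        using z1 zW by (intro proximity_diff_inverse s0 contA) (auto simp: A_def)
      also have "\<dots> = log_mean W (s j) - log_mean (\<lambda>z. q z * H z) (s j)"
        unfolding A_def using z1 zW by (intro log_mean_divide s0 contW continuous_intros conts) auto
      also have "log_mean (\<lambda>z. q z * H z) (s j) = log_mean q (s j) + log_mean H (s j)"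
        using z1 by (intro log_mean_mult s0 conts) auto
      finally show ?thesis .
    qed
    obtain BH KH where BH: "\<And>r. 1 \<le> r \<Longrightarrow> nonzero_on_circle H r \<Longrightarrow> log_mean H r \<le> BH + KH * ln r"
      using log_mean_le_of_finite_zeros[OF ent(5) fin] by blast
    obtain BW where BW: "\<And>r. 1 \<le> r \<Longrightarrow> nonzero_on_circle W r \<Longrightarrow> BW \<le> log_mean W r"
      using log_mean_bounded_below[OF True] by blast
    define N where "N = (\<lambda>j. proximity_fun (\<lambda>z. p z / q z) (s j) + (proximity_fun \<delta> (s j) + proximity_fun \<gamma> (s j) + ln 2) +
        (log_mean q (s j) + (BH + max 1 KH * ln (s j))))"
    have small_N: "small_above T N"
      unfolding N_def \<gamma>_def \<delta>_def
      by (intro small_above_add small_above_cmult small_above_const T small_prox small_p small_H small_poles small_ln) auto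
    have W_le: "log_mean W (s j) + proximity_fun (\<lambda>z. 1 / A z) (s j) \<le> N j" for j
    proof -
      have "KH * ln (s j) \<le> max 1 KH * ln (s j)" using s1[of j] by (intro mult_right_mono) auto
      then show ?thesis using prox_A[of j] jensen_A[of j] BH[OF s1 nz(5), of j] unfolding N_def by linarith
    qed
    \<comment> \<open>The cofactor of \<open>f\<close> in \<open>W\<close>, where \<open>f^(n-1)\<close> survives the differentiation of \<open>f^n\<close>.\<close>
    define V where "V = (\<lambda>z. f z ^ (n - 2) * (of_nat n * deriv f z * (l z * q z) + f z * deriv (\<lambda>z. l z * q z) z) * H z
        - f z ^ (n - 1) * (l z * q z) * deriv H z)"
    have holV: "V holomorphic_on UNIV"
      unfolding V_def by (intro holomorphic_intros hol) auto
    have W_fV: "W z = f z * V z" for z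
    proof -
      have hlq: "(\<lambda>z. l z * q z) holomorphic_on UNIV" by (intro holomorphic_intros hol)
      have "deriv (\<lambda>z. f z ^ n * (l z * q z)) z =
          f z ^ n * deriv (\<lambda>z. l z * q z) z + of_nat n * f z ^ (n - 1) * deriv f z * (l z * q z)"
        by (subst derivative_rules_entire(1)[OF _ hlq])
           (auto intro!: holomorphic_intros hol simp: derivative_rules_entire(3)[OF hol(1) hol(1)])
      moreover have "(\<lambda>z. F z * q z) = (\<lambda>z. f z ^ n * (l z * q z))" by (simp add: F_def mult.assoc)
      moreover obtain k where k: "n = Suc (Suc k)" using n by (metis Suc_le_D numeral_2_eq_2 Suc_le_mono)
      ultimately show ?thesis
        unfolding W_def V_def by (simp add: F_def algebra_simps)
    qed
    have entV: "nonzero_entire V"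
      using True holV by (auto simp: nonzero_entire_def W_fV)
    have zV: "nonzero_on_circle V (s j)" for j
      using zW[of _ j] by (auto simp: nonzero_on_circle_def W_fV)
    obtain BV where BV: "\<And>r. 1 \<le> r \<Longrightarrow> nonzero_on_circle V r \<Longrightarrow> BV \<le> log_mean V r"
      using log_mean_bounded_below[OF entV] by blast
    obtain Bf where Bf: "\<And>r. 1 \<le> r \<Longrightarrow> nonzero_on_circle f r \<Longrightarrow> Bf \<le> log_mean f r"
      using log_mean_bounded_below[OF ent(1)] by blast
    have f_le: "log_mean f (s j) \<le> N j + (- BV)" for j
    proof -
      have "W = (\<lambda>z. f z * V z)" by (rule ext) (rule W_fV)
      then have "log_mean W (s j) = log_mean (\<lambda>z. f z * V z) (s j)" by (rule arg_cong)
      also have "\<dots> = log_mean f (s j) + log_mean V (s j)"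
        using z1 zV by (intro log_mean_mult s0 conts cont[OF holV]) (auto simp: nonzero_on_circle_def)
      finally have "log_mean W (s j) = log_mean f (s j) + log_mean V (s j)" .
      moreover have "0 \<le> proximity_fun (\<lambda>z. 1 / A z) (s j)" by (intro proximity_nonneg contA s0)
      ultimately show ?thesis using W_le[of j] BV[OF s1 zV, of j] by linarith
    qed
    have inv_F: "proximity_fun (\<lambda>z. 1 / F z) (s j) \<le>
        (proximity_fun (\<lambda>z. deriv F z / F z) (s j) + proximity_fun \<gamma> (s j) + ln 2) + (N j + (- BW))" for j
    proof -
      have cF: "continuous_on (sphere 0 (s j)) (\<lambda>z. deriv F z / F z)"
        using z1 by (intro continuous_intros conts) auto
      have "proximity_fun (\<lambda>z. 1 / F z) (s j) = proximity_fun (\<lambda>z. (deriv F z / F z - \<gamma> z) * (1 / A z)) (s j)"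
        by (rule proximity_cong) (use A2 s0 in auto)
      also have "\<dots> \<le> proximity_fun (\<lambda>z. deriv F z / F z - \<gamma> z) (s j) + proximity_fun (\<lambda>z. 1 / A z) (s j)"
        by (intro proximity_mult_le s0 continuous_on_diff cF contg contA)
      also have "proximity_fun (\<lambda>z. deriv F z / F z - \<gamma> z) (s j) \<le>
          proximity_fun (\<lambda>z. deriv F z / F z) (s j) + proximity_fun \<gamma> (s j) + ln 2"
        by (intro proximity_diff_le s0 cF contg)
      finally show ?thesis using W_le[of j] BW[OF s1 nzW[OF True], of j] by linarith
    qed
    have "real n * proximity_fun f (s j) - proximity_fun l (s j) \<le>
        ((proximity_fun (\<lambda>z. deriv F z / F z) (s j) + proximity_fun \<gamma> (s j) + ln 2) + (N j + (- BW))) +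
        real n * (N j + (- BV))" for j
    proof -
      have "proximity_fun F (s j) - proximity_fun (\<lambda>z. 1 / F z) (s j) = log_mean F (s j)"
        using z1 by (intro proximity_diff_inverse s0 conts) auto
      also have "\<dots> = log_mean (\<lambda>z. f z ^ n) (s j) + log_mean l (s j)"
        unfolding F_def using z1 by (intro log_mean_mult s0 continuous_intros conts) auto
      also have "log_mean (\<lambda>z. f z ^ n) (s j) = real n * log_mean f (s j)"
        using z1 s0 by (intro log_mean_power) auto
      finally have "proximity_fun F (s j) = proximity_fun (\<lambda>z. 1 / F z) (s j) + real n * log_mean f (s j) + log_mean l (s j)"
        by simp
      moreover have "real n * log_mean f (s j) \<le> real n * (N j + (- BV))"
        by (intro mult_left_mono f_le) auto
      ultimately show ?thesis
        using quotient[of j] jensen_l[of j] inv_F[of j] by (simp add: proximity_power)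
    qed
    moreover have "small_above T (\<lambda>j. ((proximity_fun (\<lambda>z. deriv F z / F z) (s j) + proximity_fun \<gamma> (s j) + ln 2) + (N j + (- BW))) +
        real n * (N j + (- BV)))"
      unfolding \<gamma>_def
      using n by (intro small_above_add small_above_cmult small_above_const T small_N small_F small_H) auto
    ultimately show ?thesis by (rule small_above_le[rotated])
  qed
qed

section \<open>Linear differential polynomials\<close>

text \<open>
  If a derivative of \<open>f\<close> vanishes identically, then the power series of \<open>f\<close> at 0 is a polynomial.
\<close>
lemma higher_deriv_nonzero_entire:
  assumes f: "transcendental_entire f"
  shows "nonzero_entire ((deriv ^^ k) f)"
proof -
  have hol: "f holomorphic_on UNIV" and npoly: "\<nexists>p :: complex poly. f = poly p"
    using f by (auto simp: transcendental_entire_def)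
  have "\<exists>z. (deriv ^^ k) f z \<noteq> 0"
  proof (rule ccontr)
    assume "\<not> ?thesis"
    then have k0: "(deriv ^^ k) f = (\<lambda>_. 0)" by auto
    have zero: "(deriv ^^ n) f = (\<lambda>_. 0)" if "k \<le> n" for n
      using that
    proof (induction n rule: dec_induct)
      case (step n)
      have "(deriv ^^ Suc n) f = deriv ((deriv ^^ n) f)" by simp
      also have "\<dots> = (\<lambda>_. 0)" unfolding step.IH by simp
      finally show ?case .
    qed (rule k0)
    define c where "c = (\<lambda>n. (deriv ^^ n) f 0 / fact n)"
    have "f z = poly (\<Sum>n<k. monom (c n) n) z" for z
    proof -
      have "((\<lambda>n. (deriv ^^ n) f 0 / fact n * (z - 0) ^ n) sums f z)"
        by (rule holomorphic_power_series[of f 0 "norm z + 1"])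
           (auto intro: holomorphic_on_subset[OF hol])
      then have "(\<lambda>n. c n * z ^ n) sums f z" by (simp add: c_def)
      moreover have "(\<lambda>n. c n * z ^ n) sums (\<Sum>n<k. c n * z ^ n)"
        by (rule sums_finite) (auto simp: c_def zero)
      ultimately have "f z = (\<Sum>n<k. c n * z ^ n)" by (rule sums_unique2)
      then show ?thesis by (simp add: poly_sum poly_monom)
    qed
    then have "f = poly (\<Sum>n<k. monom (c n) n)" by auto
    with npoly show False by blast
  qed
  then show ?thesis
    using hol by (auto simp: nonzero_entire_def intro: holomorphic_higher_deriv)
qed

lemma lin_diff_poly_holomorphic:
  assumes "h holomorphic_on UNIV" "\<And>i. i \<in> {1..q} \<Longrightarrow> b i holomorphic_on UNIV"
  shows "(\<lambda>z. lin_diff_poly q b \<nu> z h) holomorphic_on UNIV"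
  unfolding lin_diff_poly_def using assms
  by (intro holomorphic_intros holomorphic_higher_deriv) auto

lemma proximity_higher_deriv_quotient_le:
  assumes h: "\<And>k. nonzero_entire ((deriv ^^ k) h)" and r: "0 \<le> r"
    and nz: "\<And>i. i < k \<Longrightarrow> nonzero_on_circle ((deriv ^^ i) h) r" "nonzero_on_circle h r"
  shows "proximity_fun (\<lambda>z. (deriv ^^ k) h z / h z) r \<le>
    (\<Sum>i<k. proximity_fun (\<lambda>z. (deriv ^^ Suc i) h z / (deriv ^^ i) h z) r)"
  using nz(1)
proof (induction k)
  case 0
  have "proximity_fun (\<lambda>z. h z / h z) r = proximity_fun (\<lambda>_. 1) r"
    by (rule proximity_cong) (use nz(2) r in \<open>auto simp: nonzero_on_circle_def\<close>)
  then show ?case by (simp add: log_plus_def)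
next
  case (Suc k)
  have c: "continuous_on (sphere 0 r) ((deriv ^^ i) h)" for i by (rule nonzero_entireD(3)[OF h])
  have n: "(deriv ^^ k) h z \<noteq> 0" "h z \<noteq> 0" if "norm z = r" for z
    using Suc.prems[of k] nz(2) that by (auto simp: nonzero_on_circle_def)
  have "proximity_fun (\<lambda>z. (deriv ^^ Suc k) h z / h z) r =
      proximity_fun (\<lambda>z. ((deriv ^^ k) h z / h z) * ((deriv ^^ Suc k) h z / (deriv ^^ k) h z)) r"
    by (rule proximity_cong) (use n r in auto)
  also have "\<dots> \<le> proximity_fun (\<lambda>z. (deriv ^^ k) h z / h z) r +
      proximity_fun (\<lambda>z. (deriv ^^ Suc k) h z / (deriv ^^ k) h z) r"
    by (intro proximity_mult_le r continuous_on_divide c c[of 0, simplified]) (use n in auto)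
  finally show ?case using Suc by (simp del: funpow.simps)
qed

text \<open>
  After division by \<open>h\<close> the linear differential polynomial contains \<open>h\<close> only in the quotients
  \<open>h^(k) / h\<close>, and these are products of logarithmic derivatives of derivatives of \<open>h\<close>.
\<close>
lemma proximity_lin_diff_poly_le:
  assumes h: "\<And>k. nonzero_entire ((deriv ^^ k) h)" and r: "0 \<le> r"
    and b: "\<And>i. i \<in> {1..q} \<Longrightarrow> b i holomorphic_on UNIV"
    and nz: "\<And>i. i < K \<Longrightarrow> nonzero_on_circle ((deriv ^^ i) h) r" "0 < K" and \<nu>: "\<And>i. i \<in> {1..q} \<Longrightarrow> \<nu> i \<le> K"
  shows "proximity_fun (\<lambda>z. lin_diff_poly q b \<nu> z h) r \<le> proximity_fun h r +
    (\<Sum>i=1..q. proximity_fun (b i) r +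
      (\<Sum>k<\<nu> i. proximity_fun (\<lambda>z. (deriv ^^ Suc k) h z / (deriv ^^ k) h z) r) + ln 2)"
proof -
  have c: "continuous_on (sphere 0 r) ((deriv ^^ i) h)" for i by (rule nonzero_entireD(3)[OF h])
  have cb: "continuous_on (sphere 0 r) (b i)" if "i \<in> {1..q}" for i
    using b[OF that] by (blast intro: continuous_on_subset holomorphic_on_imp_continuous_on)
  have nzh: "nonzero_on_circle h r" using nz(1)[of 0] nz(2) by simp
  then have n: "h z \<noteq> 0" if "norm z = r" for z using that by (auto simp: nonzero_on_circle_def)
  have cq: "continuous_on (sphere 0 r) (\<lambda>z. (deriv ^^ k) h z / h z)" for k
    by (intro continuous_on_divide c c[of 0, simplified]) (use n in auto)
  define S where "S = (\<lambda>z. \<Sum>i=1..q. b i z * ((deriv ^^ \<nu> i) h z / h z))"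
  have cS: "continuous_on (sphere 0 r) S"
    unfolding S_def by (intro continuous_on_sum continuous_on_mult cb cq)
  have "proximity_fun (\<lambda>z. lin_diff_poly q b \<nu> z h) r = proximity_fun (\<lambda>z. h z * S z) r"
    by (rule proximity_cong) (use n r in \<open>auto simp: lin_diff_poly_def S_def sum_distrib_left\<close>)
  also have "\<dots> \<le> proximity_fun h r + proximity_fun S r"
    by (intro proximity_mult_le r cS c[of 0, simplified])
  also have "proximity_fun S r \<le> (\<Sum>i=1..q. proximity_fun (\<lambda>z. b i z * ((deriv ^^ \<nu> i) h z / h z)) r + ln 2)"
    unfolding S_def by (intro proximity_sum_le continuous_on_mult cb cq r) auto
  also have "\<dots> \<le> (\<Sum>i=1..q. proximity_fun (b i) r +
      (\<Sum>k<\<nu> i. proximity_fun (\<lambda>z. (deriv ^^ Suc k) h z / (deriv ^^ k) h z) r) + ln 2)"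
  proof (intro sum_mono add_right_mono)
    fix i assume i: "i \<in> {1..q}"
    have "proximity_fun (\<lambda>z. b i z * ((deriv ^^ \<nu> i) h z / h z)) r \<le>
        proximity_fun (b i) r + proximity_fun (\<lambda>z. (deriv ^^ \<nu> i) h z / h z) r"
      by (intro proximity_mult_le r cb[OF i] cq)
    also have "proximity_fun (\<lambda>z. (deriv ^^ \<nu> i) h z / h z) r \<le>
        (\<Sum>k<\<nu> i. proximity_fun (\<lambda>z. (deriv ^^ Suc k) h z / (deriv ^^ k) h z) r)"
      using \<nu>[OF i] by (intro proximity_higher_deriv_quotient_le h r nz nzh) auto
    finally show "proximity_fun (\<lambda>z. b i z * ((deriv ^^ \<nu> i) h z / h z)) r \<le>
        proximity_fun (b i) r + (\<Sum>k<\<nu> i. proximity_fun (\<lambda>z. (deriv ^^ Suc k) h z / (deriv ^^ k) h z) r)"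
      by simp
  qed
  finally show ?thesis by simp
qed

text \<open>
  Multiplying \<open>F - p / q\<close> by \<open>q\<close> creates no zeros at the poles of \<open>p / q\<close>, as \<open>p\<close> and \<open>q\<close> have no common zeros.
\<close>
lemma finite_zeros_of_gen_Picard_exceptional:
  assumes exc: "gen_Picard_exceptional \<alpha> F" and F: "F holomorphic_on UNIV"
    and p: "nonzero_entire p" and q: "nonzero_entire q" and pq: "\<And>z. p z = 0 \<Longrightarrow> q z \<noteq> 0"
    and eq: "\<And>z. eventually (\<lambda>w. \<alpha> w = p w / q w) (at z)"
  shows "nonzero_entire (\<lambda>z. F z * q z - p z)" "finite {z. F z * q z - p z = 0}"
proof -
  define H where "H = (\<lambda>z. F z * q z - p z)"
  have "{z. H z = 0} \<subseteq> {z. (\<lambda>w. F w - \<alpha> w) \<midarrow>z\<rightarrow> 0}"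
  proof
    fix z assume "z \<in> {z. H z = 0}"
    then have z: "F z * q z = p z" by (simp add: H_def)
    then have qz: "q z \<noteq> 0" using pq[of z] by auto
    have c: "isCont F z" "isCont p z" "isCont q z"
      using F nonzero_entireD(1)[OF p] nonzero_entireD(1)[OF q]
      by (auto intro: field_differentiable_imp_continuous_at holomorphic_on_imp_differentiable_at)
    then have "(\<lambda>w. F w - p w / q w) \<midarrow>z\<rightarrow> F z - p z / q z"
      using qz unfolding isCont_def by (intro tendsto_intros)
    moreover have "F z - p z / q z = 0" using z qz by (simp add: field_simps)
    ultimately have lim: "(\<lambda>w. F w - p w / q w) \<midarrow>z\<rightarrow> 0" by (simp only:)
    have "eventually (\<lambda>w. F w - p w / q w = F w - \<alpha> w) (at z)"
      using eq[of z] by eventually_elim simp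
    with lim have "(\<lambda>w. F w - \<alpha> w) \<midarrow>z\<rightarrow> 0"
      by (rule Lim_transform_eventually)
    then show "z \<in> {z. (\<lambda>w. F w - \<alpha> w) \<midarrow>z\<rightarrow> 0}" by simp
  qed
  then have fin: "finite {z. H z = 0}"
    by (rule finite_subset) (use exc in \<open>simp add: gen_Picard_exceptional_def\<close>)
  then show "finite {z. F z * q z - p z = 0}" by (simp add: H_def)
  have "{z. H z = 0} \<noteq> UNIV" using fin infinite_UNIV_char_0 by metis
  then show "nonzero_entire (\<lambda>z. F z * q z - p z)"
    using F nonzero_entireD(1)[OF p] nonzero_entireD(1)[OF q]
    by (auto simp: nonzero_entire_def H_def intro!: holomorphic_intros)
qed

section \<open>Common generalized Picard exceptional functions\<close>

theorem theorem2p1: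
  fixes f g \<alpha> :: "complex \<Rightarrow> complex"
    and n m q :: nat
    and b :: "nat \<Rightarrow> complex \<Rightarrow> complex"
    and \<nu> :: "nat \<Rightarrow> nat"
  assumes "transcendental_entire f" and "transcendental_entire g"
    and "min n m \<ge> 2"
    and "\<alpha> meromorphic_on UNIV" and "\<not> (\<forall>\<^sub>\<approx>z. \<alpha> z = 0)"
    and "small_function \<alpha> f" and "small_function \<alpha> g"
    and "\<And>i. i \<in> {1..q} \<Longrightarrow> b i holomorphic_on UNIV"
    and "\<And>i. i \<in> {1..q} \<Longrightarrow> small_function (b i) f"
    and "\<And>i. i \<in> {1..q} \<Longrightarrow> small_function (b i) g"
    and "\<exists>z. lin_diff_poly q b \<nu> z f \<noteq> 0" and "\<exists>z. lin_diff_poly q b \<nu> z g \<noteq> 0"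
  shows "\<not> (gen_Picard_exceptional \<alpha> (\<lambda>z. f z ^ n * lin_diff_poly q b \<nu> z g) \<and>
            gen_Picard_exceptional \<alpha> (\<lambda>z. g z ^ m * lin_diff_poly q b \<nu> z f))"
proof
  assume exc: "gen_Picard_exceptional \<alpha> (\<lambda>z. f z ^ n * lin_diff_poly q b \<nu> z g) \<and>
            gen_Picard_exceptional \<alpha> (\<lambda>z. g z ^ m * lin_diff_poly q b \<nu> z f)"
  have nm: "2 \<le> n" "2 \<le> m" using assms(3) by auto
  define L where "L = (\<lambda>h z. lin_diff_poly q b \<nu> z h)"
  have tr: "transcendental_entire h" if "h \<in> {f, g}" for h using that assms(1,2) by auto
  have nd: "nonzero_entire ((deriv ^^ k) h)" if "h \<in> {f, g}" for h k
    by (rule higher_deriv_nonzero_entire[OF tr[OF that]])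
  have nh: "nonzero_entire f" "nonzero_entire g" using nd[of f 0] nd[of g 0] by auto
  have nL: "nonzero_entire (L h)" if "h \<in> {f, g}" for h
  proof -
    have "(\<lambda>z. lin_diff_poly q b \<nu> z h) holomorphic_on UNIV"
      by (rule lin_diff_poly_holomorphic) (use that nh assms(8) in \<open>auto simp: nonzero_entire_def\<close>)
    moreover have "\<exists>z. L h z \<noteq> 0" using that assms(11,12) by (auto simp: L_def)
    ultimately show ?thesis by (simp add: nonzero_entire_def L_def)
  qed
  obtain P Q where nP: "nonzero_entire P" and nQ: "nonzero_entire Q" and PQ: "\<And>z. P z = 0 \<Longrightarrow> Q z \<noteq> 0"
    and \<alpha>_near: "\<And>z. eventually (\<lambda>w. \<alpha> w = P w / Q w) (at z)" and \<alpha>_exc: "countable {z. \<alpha> z \<noteq> P z / Q z}"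
    and \<alpha>_pole: "\<And>z. is_pole \<alpha> z \<longleftrightarrow> Q z = 0" and \<alpha>_ord: "\<And>z. Q z = 0 \<Longrightarrow> zorder Q z = - zorder \<alpha> z"
    using meromorphic_as_quotient[OF assms(4,5)] by blast
  define F1 where "F1 = (\<lambda>z. f z ^ n * L g z)"
  define F2 where "F2 = (\<lambda>z. g z ^ m * L f z)"
  define H1 where "H1 = (\<lambda>z. F1 z * Q z - P z)"
  define H2 where "H2 = (\<lambda>z. F2 z * Q z - P z)"
  define W1 where "W1 = (\<lambda>z. deriv (\<lambda>z. F1 z * Q z) z * H1 z - F1 z * Q z * deriv H1 z)"
  define W2 where "W2 = (\<lambda>z. deriv (\<lambda>z. F2 z * Q z) z * H2 z - F2 z * Q z * deriv H2 z)"
  have nF: "nonzero_entire F1" "nonzero_entire F2"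
    unfolding F1_def F2_def by (intro nonzero_entire_mult nonzero_entire_power nh nL; simp)+
  have exc': "gen_Picard_exceptional \<alpha> F1" "gen_Picard_exceptional \<alpha> F2"
    using exc by (simp_all add: F1_def F2_def L_def)
  have H1: "nonzero_entire H1" "finite {z. H1 z = 0}" and H2: "nonzero_entire H2" "finite {z. H2 z = 0}"
    unfolding H1_def H2_def
    by (rule finite_zeros_of_gen_Picard_exceptional[OF exc'(1) nonzero_entireD(1)[OF nF(1)] nP nQ PQ \<alpha>_near]; assumption)+
       (rule finite_zeros_of_gen_Picard_exceptional[OF exc'(2) nonzero_entireD(1)[OF nF(2)] nP nQ PQ \<alpha>_near]; assumption)+
  obtain c where nc: "nonzero_entire (\<lambda>z. f z - c)"
    and growth: "\<And>K. eventually (\<lambda>r. nonzero_on_circle (\<lambda>z. f z - c) r \<longrightarrow> K * ln r \<le> proximity_fun f r) at_top"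
    using transcendental_proximity_growth[OF assms(1)] by blast

  define K where "K = Suc (Max (insert 0 (\<nu> ` {1..q})))"
  have K: "\<nu> i \<le> K" if "i \<in> {1..q}" for i
  proof -
    have "\<nu> i \<le> Max (insert 0 (\<nu> ` {1..q}))" using that by (intro Max_ge) auto
    then show ?thesis by (simp add: K_def)
  qed
  have K0: "0 < K" by (simp add: K_def)
  \<comment> \<open>The lemma on the logarithmic derivative will be applied to the quotients \<open>u / v\<close> of these pairs: the
    derivatives of \<open>f\<close> and \<open>g\<close>, the function \<open>\<alpha>\<close>, the differences \<open>F1 - \<alpha>\<close> and \<open>F2 - \<alpha>\<close>, and \<open>F1\<close>
    and \<open>F2\<close>. The function \<open>\<Phi>\<close> is a common majorant of their characteristics.\<close>
  define one where "one = (\<lambda>_::complex. 1::complex)"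
  have none: "nonzero_entire one" by (simp add: nonzero_entire_def one_def)
  define pairs where "pairs = (\<lambda>k. ((deriv ^^ k) f, one)) ` {..<K} \<union> (\<lambda>k. ((deriv ^^ k) g, one)) ` {..<K} \<union>
    {(P, Q), (H1, Q), (H2, Q), (F1, one), (F2, one)}"
  have fin_pairs: "finite pairs" by (simp add: pairs_def)
  have deriv_pair: "((deriv ^^ k) h, one) \<in> pairs" if "h \<in> {f, g}" "k < K" for h k
    using that by (auto simp: pairs_def)
  have ent_pairs: "nonzero_entire u" "nonzero_entire v" if "(u, v) \<in> pairs" for u v
    using that nd nP nQ H1 H2 nF none by (auto simp: pairs_def)
  define val where "val = (\<lambda>x r. proximity_fun (\<lambda>z. fst x z / snd x z) r + \<bar>log_mean (snd x) r\<bar>)"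
  define \<Phi> where "\<Phi> = (\<lambda>r. 1 + (\<Sum>x\<in>pairs. val x r))"

  \<comment> \<open>The countable set \<open>N\<close> consists of the radii of the circles that meet a zero of one of the entire
    functions involved or a point where \<open>\<alpha>\<close> differs from \<open>P / Q\<close>. The functions \<open>W1\<close> and \<open>W2\<close> may
    vanish identically and are then left out.\<close>
  define gens where "gens = fst ` pairs \<union> snd ` pairs \<union> {L f, L g, W1, W2, \<lambda>z. f z - c}"
  define N where "N = norm ` ({z. \<alpha> z \<noteq> P z / Q z} \<union> (\<Union>u\<in>{u\<in>gens. nonzero_entire u}. {z. u z = 0}))"
  have cN: "countable N"
  proof -
    have "finite {u \<in> gens. nonzero_entire u}" using fin_pairs by (simp add: gens_def)
    then have "countable (\<Union>u\<in>{u\<in>gens. nonzero_entire u}. {z. u z = 0})"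
      by (rule countable_UN[OF countable_finite]) (auto intro: countable_zeros)
    with \<alpha>_exc show ?thesis unfolding N_def by (intro countable_image countable_Un)
  qed
  have generic: "nonzero_on_circle u r" if "u \<in> gens" "nonzero_entire u" "r \<notin> N" for u r
    using that unfolding nonzero_on_circle_def N_def by blast
  have \<alpha>_eq: "\<alpha> z = P z / Q z" if "norm z \<notin> N" for z
    using that unfolding N_def by blast
  have gen_pair: "nonzero_on_circle u r" "nonzero_on_circle v r" if "(u, v) \<in> pairs" "r \<notin> N" for u v r
  proof -
    have "u \<in> gens" "v \<in> gens"
      using imageI[OF that(1), of fst] imageI[OF that(1), of snd] unfolding gens_def by simp_all
    then show "nonzero_on_circle u r" "nonzero_on_circle v r"
      using ent_pairs[OF that(1)] that(2) by (auto intro: generic)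
  qed
  have cont_pair: "continuous_on (sphere 0 r) (\<lambda>z. u z / v z)" if "(u, v) \<in> pairs" "r \<notin> N" for u v r
    using gen_pair(2)[OF that] nonzero_entireD(3)[OF ent_pairs(1)[OF that(1)]] nonzero_entireD(3)[OF ent_pairs(2)[OF that(1)]]
    by (intro continuous_on_divide) (auto simp: nonzero_on_circle_def)
  have val_nonneg: "0 \<le> val x r" if "x \<in> pairs" "0 \<le> r" "r \<notin> N" for x r
  proof -
    have "0 \<le> proximity_fun (\<lambda>z. fst x z / snd x z) r"
      by (rule proximity_nonneg[OF cont_pair]) (use that in auto)
    then show ?thesis by (simp add: val_def)
  qed
  have val_le: "1 + val x r \<le> \<Phi> r" if "x \<in> pairs" "0 \<le> r" "r \<notin> N" for x r
    unfolding \<Phi>_def using val_nonneg that fin_pairs by (intro add_left_mono member_le_sum) auto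
  have \<Phi>1: "1 \<le> \<Phi> r" if "0 \<le> r" "r \<notin> N" for r
    unfolding \<Phi>_def using val_nonneg that by (simp add: sum_nonneg)

  obtain E\<alpha> where E\<alpha>: "E\<alpha> \<in> lmeasurable"
    "\<And>s T. \<lbrakk>filterlim s at_top sequentially; \<And>j. s j \<notin> E\<alpha>; \<And>j. \<bar>nevanlinna_char f (s j)\<bar> \<le> T j\<rbrakk> \<Longrightarrow>
       small_above T (\<lambda>j. \<bar>nevanlinna_char \<alpha> (s j)\<bar>)"
    using is_S_imp_small_above[of "nevanlinna_char \<alpha>" f] assms(6) unfolding small_function_def by blast
  have "\<exists>E. E \<in> lmeasurable \<and> (\<forall>s T. filterlim s at_top sequentially \<longrightarrow> (\<forall>j. s j \<notin> E) \<longrightarrow>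
      (\<forall>j. \<bar>nevanlinna_char f (s j)\<bar> \<le> T j) \<longrightarrow> small_above T (\<lambda>j. \<bar>nevanlinna_char (b i) (s j)\<bar>))"
    if i: "i \<in> {1..q}" for i
  proof -
    have "is_S (nevanlinna_char (b i)) f" using assms(9)[OF i] by (simp add: small_function_def)
    from is_S_imp_small_above[OF this] show ?thesis by metis
  qed
  then obtain Eb where Eb: "\<And>i. i \<in> {1..q} \<Longrightarrow> Eb i \<in> lmeasurable"
    "\<And>i s T. \<lbrakk>i \<in> {1..q}; filterlim s at_top sequentially; \<And>j. s j \<notin> Eb i; \<And>j. \<bar>nevanlinna_char f (s j)\<bar> \<le> T j\<rbrakk> \<Longrightarrow>
       small_above T (\<lambda>j. \<bar>nevanlinna_char (b i) (s j)\<bar>)"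
    by metis
  define E where "E = E\<alpha> \<union> (\<Union>i\<in>{1..q}. Eb i)"
  have E: "E \<in> lmeasurable"
    unfolding E_def using E\<alpha>(1) Eb(1) by (intro fmeasurable.Un fmeasurable.finite_UN) auto
  define M where "M = measure lebesgue E + 1"
  have M: "0 \<le> M" by (simp add: M_def)

  have "\<exists>r R. real j + 1 \<le> r \<and> r < R \<and> R \<le> r + M \<and> r \<notin> E \<union> N \<and> R \<notin> E \<union> N \<and>
      1 / (R - r) \<le> 8 * \<Phi> r \<and> \<Phi> R \<le> 2 * \<Phi> r" for j
  proof (rule comparable_radii[OF E cN, of "real j + 1" \<Phi>])
    show "1 \<le> \<Phi> r" if "real j + 1 \<le> r" "r \<notin> E" "r \<notin> N" for r
      using that by (intro \<Phi>1) auto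
  qed (unfold M_def, blast)
  then obtain s R where sR: "\<And>j. real j + 1 \<le> s j" "\<And>j. s j < R j" "\<And>j. R j \<le> s j + M" "\<And>j. s j \<notin> E \<union> N"
    "\<And>j. R j \<notin> E \<union> N" "\<And>j. 1 / (R j - s j) \<le> 8 * \<Phi> (s j)" "\<And>j. \<Phi> (R j) \<le> 2 * \<Phi> (s j)"
    by metis
  have s1: "1 \<le> s j" for j using sR(1)[of j] by simp
  have s0: "0 \<le> s j" and R0: "0 \<le> R j" for j using s1[of j] sR(2)[of j] by auto
  have sN: "s j \<notin> N" and RN: "R j \<notin> N" for j using sR(4,5) by auto
  have s_lim: "filterlim s at_top sequentially"
  proof (rule filterlim_at_top_mono[OF filterlim_real_sequentially], intro always_eventually allI)
    show "real j \<le> s j" for j using sR(1)[of j] by simp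
  qed
  define T where "T = (\<lambda>j. proximity_fun f (s j) + proximity_fun g (s j))"
  have cf: "continuous_on (sphere 0 r) f" "continuous_on (sphere 0 r) g" for r
    using nonzero_entireD(3)[OF nh(1)] nonzero_entireD(3)[OF nh(2)] .
  have pf0: "0 \<le> proximity_fun f (s j)" "0 \<le> proximity_fun g (s j)" for j
    by (intro proximity_nonneg cf s0)+
  have T0: "0 \<le> T j" for j using pf0[of j] by (simp add: T_def)
  have growth_s: "eventually (\<lambda>j. k * ln (s j) \<le> proximity_fun f (s j)) sequentially" for k
  proof -
    have "eventually (\<lambda>j. nonzero_on_circle (\<lambda>z. f z - c) (s j) \<longrightarrow> k * ln (s j) \<le> proximity_fun f (s j)) sequentially"
      using growth s_lim by (rule eventually_compose_filterlim)
    then show ?thesis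
      by eventually_elim (use generic[OF _ nc sN] in \<open>auto simp: gens_def\<close>)
  qed
  have ln_lim: "filterlim (\<lambda>j. ln (s j)) at_top sequentially"
    by (rule filterlim_compose[OF ln_at_top s_lim])
  have f_lim: "filterlim (\<lambda>j. proximity_fun f (s j)) at_top sequentially"
    by (rule filterlim_at_top_mono[OF ln_lim]) (use growth_s[of 1] in simp)
  have T_lim: "filterlim T at_top sequentially"
    by (rule filterlim_at_top_mono[OF f_lim]) (use pf0 in \<open>simp add: T_def\<close>)
  have small_ln: "small_above T (\<lambda>j. ln (s j))"
    unfolding small_above_def
  proof (intro allI impI)
    fix \<epsilon> :: real assume e: "0 < \<epsilon>"
    from growth_s[of "1 / \<epsilon>"] show "eventually (\<lambda>j. ln (s j) \<le> \<epsilon> * T j) sequentially"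
    proof eventually_elim
      case (elim j)
      then have "ln (s j) \<le> \<epsilon> * proximity_fun f (s j)" using e by (simp add: field_simps)
      also have "\<dots> \<le> \<epsilon> * T j" using e pf0[of j] by (intro mult_left_mono) (auto simp: T_def)
      finally show ?case .
    qed
  qed
  have nev_f: "\<bar>nevanlinna_char f (s j)\<bar> \<le> T j" for j
    using nevanlinna_char_entire[OF nonzero_entireD(1)[OF nh(1)]] pf0[of j] by (simp add: T_def)

  have small_b: "small_above T (\<lambda>j. proximity_fun (b i) (s j))" if i: "i \<in> {1..q}" for i
  proof -
    have "small_above T (\<lambda>j. \<bar>nevanlinna_char (b i) (s j)\<bar>)"
      using i sR(4) by (intro Eb(2) s_lim nev_f) (auto simp: E_def)
    then show ?thesis
      by (rule small_above_le) (simp add: nevanlinna_char_entire[OF assms(8)[OF i]])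
  qed
  have small_nev: "small_above T (\<lambda>j. \<bar>nevanlinna_char \<alpha> (s j)\<bar>)"
    using sR(4) by (intro E\<alpha>(2) s_lim nev_f) (auto simp: E_def)
  obtain BQ where BQ: "\<And>r. 1 \<le> r \<Longrightarrow> nonzero_on_circle Q r \<Longrightarrow> BQ \<le> log_mean Q r"
    using log_mean_bounded_below[OF nQ] by blast
  define cQ where "cQ = ln (norm (zor_poly Q 0 0))"
  have PQ_pair: "(P, Q) \<in> pairs" by (simp add: pairs_def)
  have nev_\<alpha>: "nevanlinna_char \<alpha> (s j) = proximity_fun (\<lambda>z. P z / Q z) (s j) + (log_mean Q (s j) - cQ)" for j
  proof -
    have "proximity_fun \<alpha> (s j) = proximity_fun (\<lambda>z. P z / Q z) (s j)"
      by (rule proximity_cong) (use \<alpha>_eq sN s0 in auto)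
    moreover have "log_mean Q (s j) = counting_fun \<alpha> (s j) + cQ"
      unfolding cQ_def by (rule counting_fun_eq_log_mean[OF nQ s1 gen_pair(2)[OF PQ_pair sN] \<alpha>_pole \<alpha>_ord])
    ultimately show ?thesis by (simp add: nevanlinna_char_def)
  qed
  have prox_PQ0: "0 \<le> proximity_fun (\<lambda>z. P z / Q z) (s j)" for j
    by (intro proximity_nonneg cont_pair[OF PQ_pair] sN s0)
  have small_prox: "small_above T (\<lambda>j. proximity_fun (\<lambda>z. P z / Q z) (s j))"
  proof (rule small_above_le)
    show "small_above T (\<lambda>j. \<bar>nevanlinna_char \<alpha> (s j)\<bar> + (cQ - BQ))"
      by (intro small_above_add small_above_const small_nev T_lim)
    show "proximity_fun (\<lambda>z. P z / Q z) (s j) \<le> \<bar>nevanlinna_char \<alpha> (s j)\<bar> + (cQ - BQ)" for j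
      using nev_\<alpha>[of j] BQ[OF s1 gen_pair(2)[OF PQ_pair sN], of j] by linarith
  qed
  have small_Q: "small_above T (\<lambda>j. \<bar>log_mean Q (s j)\<bar>)"
  proof (rule small_above_le)
    show "small_above T (\<lambda>j. \<bar>nevanlinna_char \<alpha> (s j)\<bar> + (\<bar>cQ\<bar> + \<bar>BQ\<bar>))"
      by (intro small_above_add small_above_const small_nev T_lim)
    show "\<bar>log_mean Q (s j)\<bar> \<le> \<bar>nevanlinna_char \<alpha> (s j)\<bar> + (\<bar>cQ\<bar> + \<bar>BQ\<bar>)" for j
      using nev_\<alpha>[of j] prox_PQ0[of j] BQ[OF s1 gen_pair(2)[OF PQ_pair sN], of j] by linarith
  qed

  \<comment> \<open>As yet \<open>\<Phi>\<close> is not known to be \<open>O(T)\<close>, so the logarithmic derivatives are at first bounded in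
    terms of \<open>G = T + ln \<Phi>\<close>. This implies \<open>\<Phi> = O(G)\<close>, hence \<open>\<Phi> = O(T)\<close> and \<open>ln \<Phi> = o(T)\<close>, and
    then the same bounds are small.\<close>
  define ph where "ph = (\<lambda>j. \<Phi> (s j))"
  have ph1: "1 \<le> ph j" for j unfolding ph_def by (intro \<Phi>1 s0 sN)
  let ?ld = "\<lambda>u v j. proximity_fun (\<lambda>z. deriv u z / u z - deriv v z / v z) (s j)"
  have logd: "\<exists>C. \<forall>j. ?ld u v j \<le> C + 4 * ln (s j) + 6 * ln (ph j)"
    if uv: "(u, v) \<in> pairs" for u v
  proof -
    have "1 + proximity_fun (\<lambda>z. u z / v z) (R j) + \<bar>log_mean v (R j)\<bar> \<le> 2 * ph j" for j
      using val_le[OF uv R0 RN, of j] sR(7)[of j] by (simp add: val_def ph_def)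
    moreover have "1 / (R j - s j) \<le> 8 * ph j" for j using sR(6)[of j] by (simp add: ph_def)
    ultimately show ?thesis
      by (intro log_derivative_along_sequence[where M = M and R = R] ent_pairs[OF uv] M s1 sR(2,3)
            gen_pair[OF uv sN] gen_pair[OF uv RN] ph1)
  qed
  have logd_small: "small_above T (?ld u v)"
    if uv: "(u, v) \<in> pairs" and l: "small_above T (\<lambda>j. ln (ph j))" for u v
  proof -
    obtain C where "\<forall>j. ?ld u v j \<le> C + 4 * ln (s j) + 6 * ln (ph j)"
      using logd[OF uv] by blast
    moreover have "small_above T (\<lambda>j. C + 4 * ln (s j) + 6 * ln (ph j))"
      by (intro small_above_add small_above_cmult small_above_const T_lim small_ln l) auto
    ultimately show ?thesis by (blast intro: small_above_le)
  qed
  define G where "G = (\<lambda>j. T j + ln (ph j))"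
  have TG: "T j \<le> G j" for j using ph1[of j] by (simp add: G_def)
  have dom_small: "dominated G x" if "small_above T x" for x
    by (rule small_above_imp_dominated[OF that TG])
  have dom_const: "dominated G (\<lambda>_. a)" for a by (rule dom_small[OF small_above_const[OF T_lim]])
  have dom_T: "dominated G T"
    unfolding dominated_def using TG by (intro exI[of _ 1]) (auto intro!: always_eventually)
  have dom_f: "dominated G (\<lambda>j. proximity_fun h (s j))" if "h \<in> {f, g}" for h
    by (rule dominated_le[OF dom_T]) (use that pf0 in \<open>auto simp: T_def\<close>)
  have dom_ln: "dominated G (\<lambda>j. ln (ph j))"
    unfolding dominated_def using T0 by (intro exI[of _ 1]) (auto intro!: always_eventually simp: G_def)
  have logd_dom: "dominated G (?ld u v)"
    if uv: "(u, v) \<in> pairs" for u v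
  proof -
    obtain C where "\<forall>j. ?ld u v j \<le> C + 4 * ln (s j) + 6 * ln (ph j)"
      using logd[OF uv] by blast
    moreover have "dominated G (\<lambda>j. C + 4 * ln (s j) + 6 * ln (ph j))"
      by (intro dominated_add dominated_cmult dom_const dom_ln dom_small[OF small_ln]) auto
    ultimately show ?thesis by (blast intro: dominated_le)
  qed
  define ld where "ld = (\<lambda>h k j. proximity_fun (\<lambda>z. (deriv ^^ Suc k) h z / (deriv ^^ k) h z) (s j))"
  have ld_eq: "ld h k j = proximity_fun (\<lambda>z. deriv ((deriv ^^ k) h) z / (deriv ^^ k) h z - deriv one z / one z) (s j)" for h k j
    by (simp add: ld_def one_def)
  define X where "X = (\<lambda>h j. \<Sum>i=1..q. proximity_fun (b i) (s j) + (\<Sum>k<\<nu> i. ld h k j) + ln 2)"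
  have L_le: "proximity_fun (L h) (s j) \<le> proximity_fun h (s j) + X h j" if h: "h \<in> {f, g}" for h j
    unfolding L_def X_def ld_def
    using nd[OF h] gen_pair(1)[OF deriv_pair[OF h] sN] K K0 assms(8)
    by (intro proximity_lin_diff_poly_le[where K = K] s0) auto

  have dom_X: "dominated G (X h)" if h: "h \<in> {f, g}" for h
    unfolding X_def
  proof (intro dominated_sum dominated_add dom_const dom_small[OF small_b])
    fix i k assume "i \<in> {1..q}" "k \<in> {..<\<nu> i}"
    then have "k < K" using K[of i] by auto
    then show "dominated G (ld h k)"
      unfolding ld_eq by (intro logd_dom deriv_pair h)
  qed auto
  have dom_L: "dominated G (\<lambda>j. proximity_fun (L h) (s j))" if h: "h \<in> {f, g}" for h
    by (rule dominated_le[OF dominated_add[OF dom_f[OF h] dom_X[OF h]] L_le[OF h]])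
  have dom_power: "dominated G (\<lambda>j. proximity_fun (\<lambda>z. h z ^ k * L h' z) (s j))"
    if h: "h \<in> {f, g}" "h' \<in> {f, g}" and k: "0 < k" for h h' k
  proof (rule dominated_le)
    show "dominated G (\<lambda>j. real k * proximity_fun h (s j) + proximity_fun (L h') (s j))"
      using k by (intro dominated_add dominated_cmult dom_f dom_L h) auto
    have "continuous_on (sphere 0 r) h" for r using h cf by auto
    then show "proximity_fun (\<lambda>z. h z ^ k * L h' z) (s j) \<le> real k * proximity_fun h (s j) + proximity_fun (L h') (s j)" for j
      using proximity_mult_le[of "s j" "\<lambda>z. h z ^ k" "L h'"] s0 nonzero_entireD(3)[OF nL[OF h(2)]]
      by (auto simp: proximity_power intro!: continuous_on_power)
  qed
  have dom_F: "dominated G (\<lambda>j. proximity_fun F1 (s j))" "dominated G (\<lambda>j. proximity_fun F2 (s j))"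
    unfolding F1_def F2_def using nm by (intro dom_power; simp)+
  have dom_H: "dominated G (\<lambda>j. proximity_fun (\<lambda>z. (F z * Q z - P z) / Q z) (s j))"
    if F: "dominated G (\<lambda>j. proximity_fun F (s j))" "nonzero_entire F" for F
  proof (rule dominated_le)
    show "dominated G (\<lambda>j. proximity_fun F (s j) + proximity_fun (\<lambda>z. P z / Q z) (s j) + ln 2)"
      by (intro dominated_add F dom_const dom_small[OF small_prox])
    fix j
    have "proximity_fun (\<lambda>z. (F z * Q z - P z) / Q z) (s j) = proximity_fun (\<lambda>z. F z - P z / Q z) (s j)"
      by (rule proximity_cong)
         (use gen_pair(2)[OF PQ_pair sN, of j] s0 in \<open>auto simp: nonzero_on_circle_def field_simps\<close>)
    also have "\<dots> \<le> proximity_fun F (s j) + proximity_fun (\<lambda>z. P z / Q z) (s j) + ln 2"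
      by (intro proximity_diff_le s0 cont_pair[OF PQ_pair] sN nonzero_entireD(3)[OF F(2)])
    finally show "proximity_fun (\<lambda>z. (F z * Q z - P z) / Q z) (s j) \<le>
        proximity_fun F (s j) + proximity_fun (\<lambda>z. P z / Q z) (s j) + ln 2" .
  qed
  have dom_deriv: "dominated G (\<lambda>j. proximity_fun ((deriv ^^ k) h) (s j))" if h: "h \<in> {f, g}" and k: "k < K" for h k
  proof (rule dominated_le)
    show "dominated G (\<lambda>j. proximity_fun h (s j) + (\<Sum>i<k. ld h i j))"
    proof (intro dominated_add dominated_sum dom_f h dom_const)
      fix i assume "i \<in> {..<k}"
      then show "dominated G (ld h i)"
        unfolding ld_eq using k by (intro logd_dom deriv_pair h) auto
    qed simp
    fix j
    have nz: "nonzero_on_circle ((deriv ^^ i) h) (s j)" if "i < K" for i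
      by (rule gen_pair(1)[OF deriv_pair[OF h that] sN])
    then have nzh: "nonzero_on_circle h (s j)" using K0 by (metis funpow_0)
    have c: "continuous_on (sphere 0 (s j)) ((deriv ^^ i) h)" for i by (rule nonzero_entireD(3)[OF nd[OF h]])
    have "proximity_fun ((deriv ^^ k) h) (s j) = proximity_fun (\<lambda>z. h z * ((deriv ^^ k) h z / h z)) (s j)"
      by (rule proximity_cong) (use nzh s0 in \<open>auto simp: nonzero_on_circle_def\<close>)
    also have "\<dots> \<le> proximity_fun h (s j) + proximity_fun (\<lambda>z. (deriv ^^ k) h z / h z) (s j)"
      using nzh by (intro proximity_mult_le s0 continuous_on_divide c c[of 0, simplified]) (auto simp: nonzero_on_circle_def)
    also have "proximity_fun (\<lambda>z. (deriv ^^ k) h z / h z) (s j) \<le> (\<Sum>i<k. ld h i j)"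
      unfolding ld_def using nz k by (intro proximity_higher_deriv_quotient_le nd h s0 nzh) auto
    finally show "proximity_fun ((deriv ^^ k) h) (s j) \<le> proximity_fun h (s j) + (\<Sum>i<k. ld h i j)" by simp
  qed
  have one_eq: "val (u, one) r = proximity_fun u r" for u r
    by (simp add: val_def one_def log_mean_def)
  have Q_eq: "dominated G (\<lambda>j. val (u, Q) (s j))" if "dominated G (\<lambda>j. proximity_fun (\<lambda>z. u z / Q z) (s j))" for u
    unfolding val_def using dominated_add[OF that dom_small[OF small_Q]] by simp
  have dom_val: "dominated G (\<lambda>j. val x (s j))" if x: "x \<in> pairs" for x
  proof -
    consider (d) h k where "h \<in> {f, g}" "k < K" "x = ((deriv ^^ k) h, one)"
      | (PQ) "x = (P, Q)" | (H1) "x = (H1, Q)" | (H2) "x = (H2, Q)" | (F1) "x = (F1, one)" | (F2) "x = (F2, one)"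
      using x unfolding pairs_def by blast
    then show ?thesis
    proof cases
      case d
      then show ?thesis using dom_deriv by (simp add: one_eq)
    next
      case PQ
      then show ?thesis using Q_eq[OF dom_small[OF small_prox]] by simp
    next
      case H1
      then show ?thesis using Q_eq[of H1] dom_H[OF dom_F(1) nF(1)] by (simp add: H1_def)
    next
      case H2
      then show ?thesis using Q_eq[of H2] dom_H[OF dom_F(2) nF(2)] by (simp add: H2_def)
    next
      case F1
      then show ?thesis using dom_F by (simp add: one_eq)
    next
      case F2
      then show ?thesis using dom_F by (simp add: one_eq)
    qed
  qed
  have dom_ph: "dominated G ph"
    unfolding ph_def \<Phi>_def by (intro dominated_add dominated_sum dom_const dom_val fin_pairs)
  have "proximity_fun f (s j) \<le> ph j" for j
    using val_le[OF deriv_pair[of f 0] s0 sN, of j] K0 by (simp add: one_eq ph_def)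
  then have ph_lim: "filterlim ph at_top sequentially"
    by (intro filterlim_at_top_mono[OF f_lim]) simp
  have small_ph: "small_above T (\<lambda>j. ln (ph j))"
    by (rule small_above_ln_of_dominated[OF ph_lim dom_ph[unfolded G_def]])
  note small_ld = logd_small[OF _ small_ph]

  have small_X: "small_above T (X h)" if h: "h \<in> {f, g}" for h
    unfolding X_def
  proof (intro small_above_sum small_above_add small_above_const T_lim small_b)
    fix i k assume "i \<in> {1..q}" "k \<in> {..<\<nu> i}"
    then have "k < K" using K[of i] by auto
    then show "small_above T (ld h k)"
      unfolding ld_eq by (intro small_ld deriv_pair h)
  qed auto
  have small_F: "small_above T (\<lambda>j. proximity_fun (\<lambda>z. deriv F z / F z) (s j))" if "(F, one) \<in> pairs" for F
    using small_ld[OF that] by (simp add: one_def)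
  have nz_fg: "nonzero_on_circle f (s j)" "nonzero_on_circle g (s j)" for j
    using gen_pair(1)[OF deriv_pair[of f 0] sN] gen_pair(1)[OF deriv_pair[of g 0] sN] K0 by auto
  have nz_L: "nonzero_on_circle (L f) (s j)" "nonzero_on_circle (L g) (s j)" for j
    by (intro generic nL sN; simp add: gens_def)+
  have small_Q': "small_above T (\<lambda>j. log_mean Q (s j))"
    by (rule small_above_le[OF small_Q]) simp

  have mem: "(H1, Q) \<in> pairs" "(H2, Q) \<in> pairs" "(F1, one) \<in> pairs" "(F2, one) \<in> pairs"
    by (simp_all add: pairs_def)
  have "small_above T (\<lambda>j. real n * proximity_fun f (s j) - proximity_fun (L g) (s j))"
    by (rule proximity_power_le_of_few_zeros[OF F1_def H1_def W1_def nh(1) nL nP nQ H1(1) nm(1) H1(2) T_lim s1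
          nz_fg(1) nz_L(2) gen_pair(1)[OF PQ_pair sN] gen_pair(2)[OF PQ_pair sN] gen_pair(1)[OF mem(1) sN]
          generic[OF _ _ sN] small_ln small_prox small_Q' small_ld[OF mem(1)] small_ld[OF PQ_pair] small_F[OF mem(3)]])
       (auto simp: gens_def)
  then have "small_above T (\<lambda>j. (real n * proximity_fun f (s j) - proximity_fun (L g) (s j)) + X g j)"
    by (intro small_above_add small_X) auto
  then have A: "small_above T (\<lambda>j. real n * proximity_fun f (s j) - proximity_fun g (s j))"
    by (rule small_above_le) (use L_le[of g] in \<open>simp add: algebra_simps\<close>)
  have "small_above T (\<lambda>j. real m * proximity_fun g (s j) - proximity_fun (L f) (s j))"
    by (rule proximity_power_le_of_few_zeros[OF F2_def H2_def W2_def nh(2) nL nP nQ H2(1) nm(2) H2(2) T_lim s1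
          nz_fg(2) nz_L(1) gen_pair(1)[OF PQ_pair sN] gen_pair(2)[OF PQ_pair sN] gen_pair(1)[OF mem(2) sN]
          generic[OF _ _ sN] small_ln small_prox small_Q' small_ld[OF mem(2)] small_ld[OF PQ_pair] small_F[OF mem(4)]])
       (auto simp: gens_def)
  then have "small_above T (\<lambda>j. (real m * proximity_fun g (s j) - proximity_fun (L f) (s j)) + X f j)"
    by (intro small_above_add small_X) auto
  then have B: "small_above T (\<lambda>j. real m * proximity_fun g (s j) - proximity_fun f (s j))"
    by (rule small_above_le) (use L_le[of f] in \<open>simp add: algebra_simps\<close>)

  \<comment> \<open>The sum of the two bounds is \<open>(n - 1) prox f + (m - 1) prox g \<le> T / 2\<close>, but the left side is at least \<open>T\<close>.\<close>
  have "eventually (\<lambda>j. 0 < T j) sequentially" using T_lim by (simp add: filterlim_at_top_dense)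
  moreover have "eventually (\<lambda>j. real n * proximity_fun f (s j) - proximity_fun g (s j) \<le> 1 / 4 * T j) sequentially"
    by (rule small_aboveD[OF A]) simp
  moreover have "eventually (\<lambda>j. real m * proximity_fun g (s j) - proximity_fun f (s j) \<le> 1 / 4 * T j) sequentially"
    by (rule small_aboveD[OF B]) simp
  ultimately have "eventually (\<lambda>j. False) sequentially"
  proof eventually_elim
    case (elim j)
    have "2 * proximity_fun f (s j) \<le> real n * proximity_fun f (s j)"
      "2 * proximity_fun g (s j) \<le> real m * proximity_fun g (s j)"
      using nm pf0[of j] by (auto intro!: mult_right_mono)
    with elim show False by (simp add: T_def)
  qed
  then show False by simp
qed

end
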